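(* Let $a\in[0,1]$, $c_3=30$, $c_4=157$, let $\mathcal A$ be a monotone graph property and let $m=n^{\alpha}$ with a constant $\alpha>10/3$. Let $p_-=1-\exp(-mp^2(1-p)^{n-2})$ and $$p_+=\begin{cases}1-\exp(-mp^2(1-p)^{n-2})+c_3\sqrt[3]{mp^3}, & \text{if } \Omega(n^{-1}m^{-1/3})=p=o(n^{-1}m^{-1/4});\\[2pt] 1-\exp(-mp^2(1-p)^{n-2})+c_3\sqrt[3]{mp^3}+c_4\sqrt[6]{mp^4}, & \text{if } \Omega(n^{-1}m^{-1/4})=p=O(m^{-1/2}\ln^{1/2}n).\end{cases}$$ If $\Pr\{G(n,p_-)\in\mathcal A\}\to a$ and $\Pr\{G(n,p_+)\in\mathcal A\}\to a$, then $\Pr\{\mathcal G(n,m,p)\in\mathcal A\}\to a$.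
   Context: $G(n,p)$ denotes the binomial random graph on an $n$-element vertex set, each edge present independently with probability $p$. The random intersection graph $\mathcal G(n,m,p)$: vertex set $\mathcal V$, $|\mathcal V|=n$, object set $\mathcal W$, $|\mathcal W|=m$; each vertex $v$ receives $W(v)\subseteq\mathcal W$ with the events $w\in W(v)$ independent of probability $p$ for all $(v,w)$; $v_1\ne v_2$ are adjacent iff $W(v_1)\cap W(v_2)\ne\emptyset$. A graph property (isomorphism-closed family of graphs on the vertex set) is monotone if it is closed under adding edges or closed under deleting edges. Limits are as $n\to\infty$. *)

theory Defs
  imports "HOL-Analysis.Analysis" "HOL-Library.Landau_Symbols"
begin

text \<open>Graphs on the vertex set {0..<n} are represented by their edge sets:
  sets of 2-element subsets of {0..<n}.\<close>

definition all_edges :: "nat \<Rightarrow> nat set set" where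
  "all_edges n = {e. \<exists>u v. u < n \<and> v < n \<and> u \<noteq> v \<and> e = {u, v}}"

definition graph_property :: "(nat \<Rightarrow> nat set set set) \<Rightarrow> bool" where
  "graph_property A \<longleftrightarrow>
     (\<forall>n. A n \<subseteq> Pow (all_edges n)) \<and>
     (\<forall>n f G. bij_betw f {0..<n} {0..<n} \<longrightarrow> G \<in> A n \<longrightarrow> (\<lambda>e. f ` e) ` G \<in> A n)"

definition monotone_property :: "(nat \<Rightarrow> nat set set set) \<Rightarrow> bool" where
  "monotone_property A \<longleftrightarrow> graph_property A \<and>
     ((\<forall>n G H. G \<in> A n \<longrightarrow> G \<subseteq> H \<longrightarrow> H \<subseteq> all_edges n \<longrightarrow> H \<in> A n) \<or>
      (\<forall>n G H. G \<in> A n \<longrightarrow> H \<subseteq> G \<longrightarrow> H \<in> A n))"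

definition clamp01 :: "real \<Rightarrow> real" where
  "clamp01 p = min 1 (max 0 p)"

definition prob_Gnp :: "nat \<Rightarrow> real \<Rightarrow> nat set set set \<Rightarrow> real" where
  "prob_Gnp n p A =
     (\<Sum>G \<in> Pow (all_edges n) \<inter> A.
        clamp01 p ^ card G * (1 - clamp01 p) ^ (card (all_edges n) - card G))"

text \<open>Random intersection graph: vertices {0..<n}, objects {0..<m}; W v is the
  object set of vertex v.\<close>

definition rig_graph :: "nat \<Rightarrow> (nat \<Rightarrow> nat set) \<Rightarrow> nat set set" where
  "rig_graph n W = {{u, v} | u v. u < n \<and> v < n \<and> u \<noteq> v \<and> W u \<inter> W v \<noteq> {}}"

definition prob_RIG :: "nat \<Rightarrow> nat \<Rightarrow> real \<Rightarrow> nat set set set \<Rightarrow> real" where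
  "prob_RIG n m p A =
     (\<Sum>W \<in> PiE {0..<n} (\<lambda>_. Pow {0..<m}).
        if rig_graph n W \<in> A
        then (\<Prod>v<n. p ^ card (W v) * (1 - p) ^ (m - card (W v)))
        else 0)"

end

theory Submission
  imports Defs "HOL-Real_Asymp.Real_Asymp"
begin

text \<open>By passing to the complement we may take the property to be increasing. The random
  intersection graph is the union of the cliques on the vertex sets \<open>V(w)\<close> of the objects
  \<open>w\<close>, and only objects with \<open>2 \<le> |V(w)| \<le> 4\<close> matter.

  Lower bound: an object with two or three vertices yields one uniformly chosen pair. The objects
  with three vertices raise the rate per pair by a relative amount of order \<open>n p\<close>, which exceeds
  the fraction \<open>n\<^sup>2 p\<^sup>2\<close> of objects that are ever used; hence, exposing the pairs one at a time,
  the unused objects always suffice to hit the next pair with probability \<open>p\<^sub>-\<close>, up to an error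
  of order \<open>n p\<close> from Markov's inequality.

  Upper bound: "at most one vertex set per object" is dominated by independent vertex sets of
  slightly larger probability, so the graph is dominated by independent random edges, triangles and
  copies of \<open>K\<^sub>4\<close>. A random triangle set is covered by random edges of probability
  \<open>O(q)\<close>, \<open>q\<^sup>3 = m p\<^sup>3\<close>, by letting all triangles with the same first edge share one coin for this
  edge, then those among the survivors with the same second edge, and so on. Each such step
  costs only a constant factor as long as few surviving triangles share an edge, and this is
  guaranteed by bounds on degrees and codegrees in a random graph with \<open>q \<le> n powr (-5/9)\<close>;
  the condition \<open>\<alpha> > 10/3\<close> enters here. The same works for \<open>K\<^sub>4\<close>.\<close>

subsection \<open>Random subsets of a finite set\<close>

text \<open>No coupling is ever built. Domination means that \<open>expec\<close> of every monotone
  \<open>F\<close> does not decrease, and such inequalities can be applied under another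
  \<open>expec\<close> with the edges exposed so far held fixed; this is why several lemmas carry a
  fixed set \<open>S\<close> or \<open>Z\<close>.

  If m p^2 = O(ln n), then p is at most m^(-1/2) up to logarithms, and alpha > 10/3 makes p and m
  p^3 at most n^(-5/3) and m p^4 at most n^(-10/3). So q = (m p^3)^(1/3) and s = (m p^4)^(1/6) are
  at most n^(-5/9). The same exponent makes m (n p)^5 vanish, which disposes of objects with five or
  more vertices; in the first regime m (n p)^4 vanishes already, and no K4 is considered. That
  regime does not bound m p^2 by a multiple of ln n when alpha > 4. If m p^2 > 8 ln n there, G(n,
  p_-) is complete up to a vanishing probability, and the upper bound is immediate.

  Triangles cost 4q + 4q + 10q, the comparison of single pairs one more q, copies of K4 cost 5 * 5s
  + 25s. The sums 19q and 50s stay below 30q and 157s.\<close>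

definition expec :: "'a set \<Rightarrow> ('a \<Rightarrow> real) \<Rightarrow> ('a set \<Rightarrow> real) \<Rightarrow> real" where
  "expec E \<pi> F = (\<Sum>S\<in>Pow E. (\<Prod>e\<in>S. \<pi> e) * (\<Prod>e\<in>E - S. 1 - \<pi> e) * F S)"

lemma expec_empty [simp]: "expec {} \<pi> F = F {}"
  by (simp add: expec_def)

lemma expec_insert:
  assumes "finite E" "x \<notin> E"
  shows "expec (insert x E) \<pi> F = \<pi> x * expec E \<pi> (\<lambda>S. F (insert x S)) + (1 - \<pi> x) * expec E \<pi> F"
proof -
  have "expec (insert x E) \<pi> F
      = (\<Sum>S\<in>Pow E. (\<Prod>e\<in>S. \<pi> e) * (\<Prod>e\<in>insert x E - S. 1 - \<pi> e) * F S)
      + (\<Sum>S\<in>insert x ` Pow E. (\<Prod>e\<in>S. \<pi> e) * (\<Prod>e\<in>insert x E - S. 1 - \<pi> e) * F S)"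
    unfolding expec_def Pow_insert using assms by (subst sum.union_disjoint) auto
  also have "(\<Sum>S\<in>Pow E. (\<Prod>e\<in>S. \<pi> e) * (\<Prod>e\<in>insert x E - S. 1 - \<pi> e) * F S) = (1 - \<pi> x) * expec E \<pi> F"
    unfolding expec_def sum_distrib_left
  proof (intro sum.cong refl)
    fix S assume S: "S \<in> Pow E"
    then have "insert x E - S = insert x (E - S)" "finite (E - S)" "x \<notin> E - S" using assms by auto
    then show "(\<Prod>e\<in>S. \<pi> e) * (\<Prod>e\<in>insert x E - S. 1 - \<pi> e) * F S
      = (1 - \<pi> x) * ((\<Prod>e\<in>S. \<pi> e) * (\<Prod>e\<in>E - S. 1 - \<pi> e) * F S)" by simp
  qed
  also have "(\<Sum>S\<in>insert x ` Pow E. (\<Prod>e\<in>S. \<pi> e) * (\<Prod>e\<in>insert x E - S. 1 - \<pi> e) * F S)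
     = \<pi> x * expec E \<pi> (\<lambda>S. F (insert x S))"
  proof -
    have inj: "inj_on (insert x) (Pow E)" using assms(2) by (auto simp: inj_on_def)
    show ?thesis unfolding expec_def sum_distrib_left sum.reindex[OF inj] o_def
    proof (intro sum.cong refl)
      fix S assume S: "S \<in> Pow E"
      then have "insert x E - insert x S = E - S" "finite S" "x \<notin> S" using assms finite_subset by auto
      then show "(\<Prod>e\<in>insert x S. \<pi> e) * (\<Prod>e\<in>insert x E - insert x S. 1 - \<pi> e) * F (insert x S)
        = \<pi> x * ((\<Prod>e\<in>S. \<pi> e) * (\<Prod>e\<in>E - S. 1 - \<pi> e) * F (insert x S))" by simp
    qed
  qed
  finally show ?thesis by simp
qed

lemma expec_cong:
  assumes "\<And>S. S \<subseteq> E \<Longrightarrow> F S = G S" "\<And>e. e \<in> E \<Longrightarrow> \<pi> e = \<pi>' e"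
  shows "expec E \<pi> F = expec E \<pi>' G"
  unfolding expec_def
proof (intro sum.cong refl)
  fix S assume "S \<in> Pow E"
  then have "(\<Prod>e\<in>S. \<pi> e) = (\<Prod>e\<in>S. \<pi>' e)" "(\<Prod>e\<in>E-S. 1 - \<pi> e) = (\<Prod>e\<in>E-S. 1 - \<pi>' e)" "F S = G S"
    using assms by (auto intro!: prod.cong)
  then show "(\<Prod>e\<in>S. \<pi> e) * (\<Prod>e\<in>E - S. 1 - \<pi> e) * F S
    = (\<Prod>e\<in>S. \<pi>' e) * (\<Prod>e\<in>E - S. 1 - \<pi>' e) * G S" by simp
qed

lemma expec_le:
  assumes "\<And>e. e \<in> E \<Longrightarrow> 0 \<le> \<pi> e \<and> \<pi> e \<le> 1" "\<And>S. S \<subseteq> E \<Longrightarrow> F S \<le> G S"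
  shows "expec E \<pi> F \<le> expec E \<pi> G"
  unfolding expec_def using assms by (intro sum_mono mult_left_mono mult_nonneg_nonneg prod_nonneg) auto

lemma expec_add: "expec E \<pi> (\<lambda>S. F S + G S) = expec E \<pi> F + expec E \<pi> G"
  by (simp add: expec_def algebra_simps sum.distrib)

lemma expec_cmult: "expec E \<pi> (\<lambda>S. c * F S) = c * expec E \<pi> F"
  by (simp add: expec_def sum_distrib_left mult_ac)

lemma expec_sum: "expec E \<pi> (\<lambda>S. \<Sum>i\<in>I. F i S) = (\<Sum>i\<in>I. expec E \<pi> (F i))"
  unfolding expec_def sum_distrib_left by (rule sum.swap)

lemma expec_swap: "expec E \<pi> (\<lambda>S. expec E' \<pi>' (\<lambda>S'. F S S')) = expec E' \<pi>' (\<lambda>S'. expec E \<pi> (\<lambda>S. F S S'))"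
proof -
  have "expec E \<pi> (\<lambda>S. expec E' \<pi>' (\<lambda>S'. F S S')) = (\<Sum>S\<in>Pow E. \<Sum>S'\<in>Pow E'.
     ((\<Prod>e\<in>S. \<pi> e) * (\<Prod>e\<in>E - S. 1 - \<pi> e)) * ((\<Prod>e\<in>S'. \<pi>' e) * (\<Prod>e\<in>E' - S'. 1 - \<pi>' e)) * F S S')"
    by (simp add: expec_def sum_distrib_left mult_ac)
  also have "\<dots> = expec E' \<pi>' (\<lambda>S'. expec E \<pi> (\<lambda>S. F S S'))"
    by (subst sum.swap) (simp add: expec_def sum_distrib_left mult_ac)
  finally show ?thesis .
qed

lemma expec_const: "finite E \<Longrightarrow> expec E \<pi> (\<lambda>_. c) = c"
  by (induction E rule: finite_induct) (simp_all add: expec_insert algebra_simps)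

lemma expec_ge_const:
  assumes "finite E" "\<And>e. e \<in> E \<Longrightarrow> 0 \<le> \<pi> e \<and> \<pi> e \<le> 1" "\<And>S. S \<subseteq> E \<Longrightarrow> c \<le> F S"
  shows "c \<le> expec E \<pi> F"
  using expec_le[of E \<pi> "\<lambda>_. c" F] assms by (simp add: expec_const)

lemma expec_le_const:
  assumes "finite E" "\<And>e. e \<in> E \<Longrightarrow> 0 \<le> \<pi> e \<and> \<pi> e \<le> 1" "\<And>S. S \<subseteq> E \<Longrightarrow> F S \<le> c"
  shows "expec E \<pi> F \<le> c"
  using expec_le[of E \<pi> F "\<lambda>_. c"] assms by (simp add: expec_const)

lemma expec_union_disjoint:
  assumes "finite A" "finite B" "A \<inter> B = {}"
  shows "expec (A \<union> B) \<pi> F = expec A \<pi> (\<lambda>S. expec B \<pi> (\<lambda>S'. F (S \<union> S')))"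
  using assms
proof (induction A arbitrary: F rule: finite_induct)
  case (insert x A)
  then show ?case by (simp add: expec_insert)
qed simp

lemma expec_union:
  assumes "finite E"
  shows "expec E \<pi> (\<lambda>S. expec E \<pi>' (\<lambda>S'. F (S \<union> S'))) = expec E (\<lambda>e. 1 - (1 - \<pi> e) * (1 - \<pi>' e)) F"
  using assms
proof (induction E arbitrary: F rule: finite_induct)
  case (insert x E)
  let ?\<rho> = "\<lambda>e. 1 - (1 - \<pi> e) * (1 - \<pi>' e)"
  have 1: "expec E \<pi> (\<lambda>S. c * expec E \<pi>' (\<lambda>S'. F (insert x (S \<union> S'))) + d * expec E \<pi>' (\<lambda>S'. G (S \<union> S')))
      = c * expec E ?\<rho> (\<lambda>S. F (insert x S)) + d * expec E ?\<rho> G" for c d G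
    unfolding expec_add expec_cmult insert.IH[of G] insert.IH[of "\<lambda>S. F (insert x S)"] ..
  have "expec (insert x E) \<pi> (\<lambda>S. expec (insert x E) \<pi>' (\<lambda>S'. F (S \<union> S')))
     = \<pi> x * (\<pi>' x * expec E ?\<rho> (\<lambda>S. F (insert x S)) + (1 - \<pi>' x) * expec E ?\<rho> (\<lambda>S. F (insert x S)))
     + (1 - \<pi> x) * (\<pi>' x * expec E ?\<rho> (\<lambda>S. F (insert x S)) + (1 - \<pi>' x) * expec E ?\<rho> F)"
    unfolding expec_insert[OF insert.hyps] Un_insert_left Un_insert_right insert_absorb2
    by (simp only: 1[of _ _ F] 1[of _ _ "\<lambda>S. F (insert x S)"])
  also have "\<dots> = ?\<rho> x * expec E ?\<rho> (\<lambda>S. F (insert x S)) + (1 - ?\<rho> x) * expec E ?\<rho> F"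
    by (simp add: algebra_simps)
  finally show ?case unfolding expec_insert[OF insert.hyps] .
qed simp

lemma expec_mono_prob:
  assumes "finite E" "mono F" "\<And>e. e \<in> E \<Longrightarrow> 0 \<le> \<pi> e \<and> \<pi> e \<le> \<pi>' e \<and> \<pi>' e \<le> 1"
  shows "expec E \<pi> F \<le> expec E \<pi>' F"
  using assms
proof (induction E arbitrary: F rule: finite_induct)
  case (insert x E)
  have m: "mono (\<lambda>S. F (insert x S))" using \<open>mono F\<close> by (simp add: mono_def insert_mono subset_insertI2)
  have 1: "expec E \<pi> F \<le> expec E \<pi>' F" and 2: "expec E \<pi> (\<lambda>S. F (insert x S)) \<le> expec E \<pi>' (\<lambda>S. F (insert x S))"
    using insert.prems by (auto intro!: insert.IH m)
  have 3: "expec E \<pi>' F \<le> expec E \<pi>' (\<lambda>S. F (insert x S))"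
    using insert.prems(2) by (intro expec_le monoD[OF insert.prems(1)]) (auto intro: order_trans)
  have p: "0 \<le> \<pi> x" "\<pi> x \<le> \<pi>' x" "\<pi>' x \<le> 1" using insert.prems by auto
  have "\<pi> x * expec E \<pi> (\<lambda>S. F (insert x S)) + (1 - \<pi> x) * expec E \<pi> F
     \<le> \<pi> x * expec E \<pi>' (\<lambda>S. F (insert x S)) + (1 - \<pi> x) * expec E \<pi>' F"
    using 1 2 p by (intro add_mono mult_left_mono) auto
  also have "\<dots> \<le> \<pi>' x * expec E \<pi>' (\<lambda>S. F (insert x S)) + (1 - \<pi>' x) * expec E \<pi>' F"
    using mult_right_mono[of "\<pi> x" "\<pi>' x" "expec E \<pi>' (\<lambda>S. F (insert x S)) - expec E \<pi>' F"] 3 p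
    by (simp add: algebra_simps)
  finally show ?case using insert.hyps by (simp add: expec_insert)
qed simp

lemma expec_image:
  assumes "finite T" "inj_on h T"
  shows "expec (h ` T) \<pi> F = expec T (\<lambda>t. \<pi> (h t)) (\<lambda>S. F (h ` S))"
  using assms
proof (induction T arbitrary: F rule: finite_induct)
  case (insert x T)
  then have "h x \<notin> h ` T" by auto
  with insert show ?case by (simp add: expec_insert)
qed simp

lemma expec_all_in:
  assumes "finite E" "B \<subseteq> E"
  shows "expec E \<pi> (\<lambda>S. of_bool (B \<subseteq> S)) = (\<Prod>e\<in>B. \<pi> e)"
  using assms
proof (induction E arbitrary: B rule: finite_induct)
  case (insert x E)
  show ?case
  proof (cases "x \<in> B")
    case True
    have "expec E \<pi> (\<lambda>S. of_bool (B \<subseteq> insert x S)) = expec E \<pi> (\<lambda>S. of_bool (B - {x} \<subseteq> S))"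
      by (rule arg_cong[where f = "expec E \<pi>"]) (auto simp: fun_eq_iff)
    also have "\<dots> = (\<Prod>e\<in>B-{x}. \<pi> e)" using insert.prems by (intro insert.IH) auto
    finally have 1: "expec E \<pi> (\<lambda>S. of_bool (B \<subseteq> insert x S)) = (\<Prod>e\<in>B-{x}. \<pi> e)" .
    have "expec E \<pi> (\<lambda>S. of_bool (B \<subseteq> S)) = expec E \<pi> (\<lambda>_. 0)"
      using insert.hyps True by (intro expec_cong) auto
    then have 2: "expec E \<pi> (\<lambda>S. of_bool (B \<subseteq> S)) = 0" using insert.hyps by (simp add: expec_const)
    have "finite B" using insert.prems insert.hyps(1) by (simp add: finite_subset)
    then show ?thesis using insert.hyps 1 2 True by (simp add: expec_insert prod.remove)
  next
    case False
    then have "B \<subseteq> insert x S \<longleftrightarrow> B \<subseteq> S" for S by auto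
    moreover have "B \<subseteq> E" using False insert by auto
    ultimately show ?thesis using insert by (simp add: expec_insert algebra_simps)
  qed
qed simp

lemma expec_exists_le:
  assumes "finite E" "finite \<F>" "0 \<le> z" "z \<le> 1" "\<And>B. B \<in> \<F> \<Longrightarrow> B \<subseteq> E \<and> card B = k"
  shows "expec E (\<lambda>_. z) (\<lambda>S. of_bool (\<exists>B\<in>\<F>. B \<subseteq> S)) \<le> real (card \<F>) * z ^ k"
proof -
  have "expec E (\<lambda>_. z) (\<lambda>S. of_bool (\<exists>B\<in>\<F>. B \<subseteq> S)) \<le> expec E (\<lambda>_. z) (\<lambda>S. \<Sum>B\<in>\<F>. of_bool (B \<subseteq> S))"
  proof (rule expec_le)
    fix S show "of_bool (\<exists>B\<in>\<F>. B \<subseteq> S) \<le> (\<Sum>B\<in>\<F>. of_bool (B \<subseteq> S) :: real)"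
    proof (cases "\<exists>B\<in>\<F>. B \<subseteq> S")
      case True
      then obtain B where "B \<in> \<F>" "B \<subseteq> S" by auto
      then show ?thesis using member_le_sum[of B \<F> "\<lambda>B. of_bool (B \<subseteq> S) :: real"] assms(2) by auto
    qed (simp add: sum_nonneg)
  qed (use assms in auto)
  also have "\<dots> = (\<Sum>B\<in>\<F>. z ^ k)" unfolding expec_sum using assms by (intro sum.cong) (auto simp: expec_all_in)
  finally show ?thesis by simp
qed

lemma expec_power_card:
  "finite E \<Longrightarrow> expec E (\<lambda>_. z) (\<lambda>S. c ^ card S) = (1 + z * (c - 1)) ^ card E"
proof (induction E rule: finite_induct)
  case (insert x E)
  have "expec E (\<lambda>_. z) (\<lambda>S. c ^ card (insert x S)) = expec E (\<lambda>_. z) (\<lambda>S. c * c ^ card S)"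
  proof (intro expec_cong refl)
    fix S assume "S \<subseteq> E"
    with insert.hyps have "x \<notin> S" "finite S" by (auto intro: finite_subset)
    then show "c ^ card (insert x S) = c * c ^ card S" by simp
  qed
  then show ?case using insert by (simp add: expec_insert expec_cmult algebra_simps)
qed simp

lemma expec_restrict:
  assumes "finite E" "E' \<subseteq> E"
  shows "expec E \<pi> (\<lambda>S. F (S \<inter> E')) = expec E' \<pi> F"
proof -
  have f: "finite E'" "finite (E - E')" using assms finite_subset by auto
  have "expec E \<pi> (\<lambda>S. F (S \<inter> E')) = expec (E' \<union> (E - E')) \<pi> (\<lambda>S. F (S \<inter> E'))"
    using assms by (simp add: Un_absorb1)
  also have "\<dots> = expec E' \<pi> (\<lambda>S. expec (E - E') \<pi> (\<lambda>S'. F ((S \<union> S') \<inter> E')))"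
    using f by (subst expec_union_disjoint) auto
  also have "\<dots> = expec E' \<pi> (\<lambda>S. expec (E - E') \<pi> (\<lambda>S'. F S))"
  proof (intro expec_cong refl)
    fix S S' assume "S \<subseteq> E'" "S' \<subseteq> E - E'"
    then have "(S \<union> S') \<inter> E' = S" by auto
    then show "F ((S \<union> S') \<inter> E') = F S" by simp
  qed
  finally show ?thesis using f by (simp add: expec_const)
qed

subsection \<open>Sharing edges between hyperedges\<close>

text \<open>Independent coins of probability \<open>\<pi>\<close> are dominated by coins of probability \<open>B\<close> that are
  all multiplied by one common coin of probability \<open>A\<close>. In the induction, \<open>A'\<close> is the posterior
  probability of the common coin after a failure.\<close>

lemma expec_share_one:
  assumes "finite G" "mono F" "0 \<le> \<pi>" "0 \<le> A" "A \<le> 1" "0 \<le> B" "B < 1" "\<pi> \<le> A * B * (1 - B) ^ card G"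
  shows "expec G (\<lambda>_. \<pi>) F \<le> (1 - A) * F {} + A * expec G (\<lambda>_. B) F"
  using assms
proof (induction G arbitrary: A F rule: finite_induct)
  case (insert x G)
  define A' where "A' = A * (1 - B) / (1 - A * B)"
  have AB: "A * B < 1" "A * B \<le> B" "0 \<le> A * B"
    using insert.prems mult_left_le_one_le[of B A] by auto
  have A': "(1 - A * B) * A' = A * (1 - B)" "0 \<le> A'" using AB insert.prems by (auto simp: A'_def)
  have A'1: "A' \<le> 1" unfolding A'_def using AB insert.prems by (auto simp: algebra_simps)
  \<comment> \<open>One failure shrinks the posterior by no more than the factor
    \<open>1 - B\<close>; this is what the power of \<open>1 - B\<close> in the hypothesis pays
    for.\<close>
  have "A * (1 - B) \<le> A'"
    using mult_right_mono[of "1 - A * B" 1 A'] A' AB by simp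
  then have "A * B * (1 - B) ^ card (insert x G) \<le> A' * B * (1 - B) ^ card G"
    using insert.hyps insert.prems mult_right_mono[of "A * (1 - B)" A' "B * (1 - B) ^ card G"] by (simp add: mult_ac)
  then have \<pi>: "\<pi> \<le> A' * B * (1 - B) ^ card G" using insert.prems by linarith
  have "(1 - B) ^ card (insert x G) \<le> 1" using insert.prems by (intro power_le_one) auto
  then have \<pi>AB: "\<pi> \<le> A * B" using insert.prems(7) AB mult_left_mono[of "(1 - B) ^ card (insert x G)" 1 "A * B"] by linarith
  define e0 e1 where "e0 = expec G (\<lambda>_. B) F" and "e1 = expec G (\<lambda>_. B) (\<lambda>S. F (insert x S))"
  have mx: "mono (\<lambda>S. F (insert x S))" using insert.prems(1) by (simp add: mono_def insert_mono subset_insertI2)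
  have u0: "expec G (\<lambda>_. \<pi>) F \<le> (1 - A') * F {} + A' * e0"
    unfolding e0_def by (rule insert.IH) (use insert.prems A' A'1 \<pi> in auto)
  \<comment> \<open>Once \<open>x\<close> is in, the common coin has succeeded, so the rest of
    \<open>G\<close> is compared with coins of probability \<open>B\<close> alone.\<close>
  have u1: "expec G (\<lambda>_. \<pi>) (\<lambda>S. F (insert x S)) \<le> e1"
    unfolding e1_def by (rule expec_mono_prob) (use insert.prems insert.hyps mx \<pi>AB AB in auto)
  have e01: "e0 \<le> e1" unfolding e0_def e1_def
    using insert.prems by (intro expec_le monoD[OF insert.prems(1)]) auto
  have "F {} \<le> e0" unfolding e0_def
    using insert.prems insert.hyps by (intro expec_ge_const monoD[OF insert.prems(1)]) auto
  then have "A' * e0 + (1 - A') * F {} \<le> A' * e0 + (1 - A') * e0" using A'1 by (intro add_left_mono mult_left_mono) auto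
  then have le: "(1 - A') * F {} + A' * e0 \<le> e1" using e01 by (simp add: algebra_simps)
  have "expec (insert x G) (\<lambda>_. \<pi>) F \<le> \<pi> * e1 + (1 - \<pi>) * ((1 - A') * F {} + A' * e0)"
    unfolding expec_insert[OF insert.hyps]
    using u0 u1 insert.prems \<pi>AB AB by (intro add_mono mult_left_mono) auto
  also have "\<dots> \<le> (A * B) * e1 + (1 - A * B) * ((1 - A') * F {} + A' * e0)"
    using mult_right_mono[OF \<pi>AB, of "e1 - ((1 - A') * F {} + A' * e0)"] le by (simp add: algebra_simps)
  also have "\<dots> = (A * B) * e1 + (1 - A * B) * F {} + ((1 - A * B) * A') * (e0 - F {})"
    by (simp add: algebra_simps)
  also have "\<dots> = (1 - A) * F {} + A * expec (insert x G) (\<lambda>_. B) F"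
    unfolding A' expec_insert[OF insert.hyps] e0_def[symmetric] e1_def[symmetric] by (simp add: algebra_simps)
  finally show ?case .
qed (simp add: algebra_simps)

text \<open>The fibres of \<open>g\<close> are disjoint, hence independent, so each is handled by
  \<open>expec_share_one\<close> with a common coin of its own. \<open>X\<close> is the set of edges
  whose coin succeeded; only the hyperedges over \<open>X\<close> survive, now with probability
  \<open>B\<close>.\<close>

lemma expec_share:
  assumes "finite P" "finite T" "g ` T \<subseteq> P" "mono F" "0 \<le> \<pi>" "\<pi> \<le> 1" "0 \<le> A" "A \<le> 1" "0 \<le> B" "B < 1"
    and "\<pi> \<le> A * B * (1 - B) ^ k" "\<And>e. e \<in> P \<Longrightarrow> card {t \<in> T. g t = e} \<le> k"
  shows "expec T (\<lambda>_. \<pi>) F \<le> expec P (\<lambda>_. A) (\<lambda>X. expec {t \<in> T. g t \<in> X} (\<lambda>_. B) F)"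
  using assms(1-4,12)
proof (induction P arbitrary: T F rule: finite_induct)
  case empty
  then show ?case by simp
next
  case (insert e P)
  define T0 T1 where "T0 = {t \<in> T. g t \<in> P}" and "T1 = {t \<in> T. g t = e}"
  have T: "T = T0 \<union> T1" "T0 \<inter> T1 = {}" "finite T0" "finite T1"
    using insert by (auto simp: T0_def T1_def)
  have mU: "mono (\<lambda>S'. F (S \<union> S'))" "mono (\<lambda>S'. F (S' \<union> S))" for S
    using insert.prems(3) by (auto simp: mono_def intro!: monoD[OF insert.prems(3)])
  have "A * B * (1 - B) ^ k \<le> A * B * (1 - B) ^ card T1"
    using insert.prems assms by (intro mult_left_mono power_decreasing) (auto simp: T1_def)
  then have \<pi>: "\<pi> \<le> A * B * (1 - B) ^ card T1" using assms by linarith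
  have IH: "expec T0 (\<lambda>_. \<pi>) G \<le> expec P (\<lambda>_. A) (\<lambda>X. expec {t \<in> T0. g t \<in> X} (\<lambda>_. B) G)" if "mono G" for G
  proof (rule insert.IH)
    fix e' assume e': "e' \<in> P"
    have "card {t \<in> T0. g t = e'} \<le> card {t \<in> T. g t = e'}"
      using insert.prems by (intro card_mono) (auto simp: T0_def)
    also have "\<dots> \<le> k" using e' by (intro insert.prems) auto
    finally show "card {t \<in> T0. g t = e'} \<le> k" .
  qed (use that T in \<open>auto simp: T0_def\<close>)
  have "expec T (\<lambda>_. \<pi>) F = expec T0 (\<lambda>_. \<pi>) (\<lambda>S. expec T1 (\<lambda>_. \<pi>) (\<lambda>S'. F (S \<union> S')))"
    unfolding T(1) using T by (intro expec_union_disjoint) auto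
  also have "\<dots> \<le> expec T0 (\<lambda>_. \<pi>) (\<lambda>S. (1 - A) * F S + A * expec T1 (\<lambda>_. B) (\<lambda>S'. F (S \<union> S')))"
    using expec_share_one[OF \<open>finite T1\<close> mU(1) _ _ _ _ _ \<pi>] assms by (intro expec_le) auto
  also have "\<dots> = (1 - A) * expec T0 (\<lambda>_. \<pi>) F + A * expec T1 (\<lambda>_. B) (\<lambda>S'. expec T0 (\<lambda>_. \<pi>) (\<lambda>S. F (S \<union> S')))"
    unfolding expec_add expec_cmult by (subst expec_swap) simp
  also have "\<dots> \<le> (1 - A) * expec P (\<lambda>_. A) (\<lambda>X. expec {t \<in> T0. g t \<in> X} (\<lambda>_. B) F)
     + A * expec T1 (\<lambda>_. B) (\<lambda>S'. expec P (\<lambda>_. A) (\<lambda>X. expec {t \<in> T0. g t \<in> X} (\<lambda>_. B) (\<lambda>S. F (S \<union> S'))))"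
    using assms insert.prems by (intro add_mono mult_left_mono expec_le IH mU) auto
  also have "expec T1 (\<lambda>_. B) (\<lambda>S'. expec P (\<lambda>_. A) (\<lambda>X. expec {t \<in> T0. g t \<in> X} (\<lambda>_. B) (\<lambda>S. F (S \<union> S'))))
    = expec P (\<lambda>_. A) (\<lambda>X. expec {t \<in> T. g t \<in> insert e X} (\<lambda>_. B) F)"
  proof (subst expec_swap, intro expec_cong refl)
    fix X assume X: "X \<subseteq> P"
    have eq: "{t \<in> T. g t \<in> insert e X} = {t \<in> T0. g t \<in> X} \<union> T1" using X by (auto simp: T0_def T1_def)
    show "expec T1 (\<lambda>_. B) (\<lambda>S'. expec {t \<in> T0. g t \<in> X} (\<lambda>_. B) (\<lambda>S. F (S \<union> S')))
      = expec {t \<in> T. g t \<in> insert e X} (\<lambda>_. B) F"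
      unfolding eq using T by (subst expec_union_disjoint) (auto intro: expec_swap)
  qed
  also have "expec P (\<lambda>_. A) (\<lambda>X. expec {t \<in> T0. g t \<in> X} (\<lambda>_. B) F) = expec P (\<lambda>_. A) (\<lambda>X. expec {t \<in> T. g t \<in> X} (\<lambda>_. B) F)"
  proof (intro expec_cong refl)
    fix X assume X: "X \<subseteq> P"
    then have "{t \<in> T0. g t \<in> X} = {t \<in> T. g t \<in> X}" by (auto simp: T0_def)
    then show "expec {t \<in> T0. g t \<in> X} (\<lambda>_. B) F = expec {t \<in> T. g t \<in> X} (\<lambda>_. B) F" by simp
  qed
  finally show ?case unfolding expec_insert[OF insert.hyps] by linarith
qed

text \<open>Whether different points of \<open>P\<close> are hit depends on disjoint fibres, so the
  image is again a random set with independent elements. The instance \<open>T = {}\<close> serves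
  later to evaluate \<open>expec\<close> when all probabilities are 0.\<close>

lemma expec_image_eq:
  assumes "finite T" "finite P" "g ` T \<subseteq> P"
  shows "expec T (\<lambda>_. b) (\<lambda>S. F (g ` S)) = expec P (\<lambda>e. 1 - (1 - b) ^ card {t \<in> T. g t = e}) F"
  using assms
proof (induction T arbitrary: F rule: finite_induct)
  case empty
  have "expec P (\<lambda>e. 0) F = F {}" using \<open>finite P\<close>
    by (induction P arbitrary: F rule: finite_induct) (simp_all add: expec_insert)
  then show ?case by simp
next
  case (insert t T)
  define \<pi> where "\<pi> = (\<lambda>e. 1 - (1 - b) ^ card {t \<in> T. g t = e})"
  define \<pi>' where "\<pi>' = (\<lambda>e. 1 - (1 - b) ^ card {t' \<in> insert t T. g t' = e})"
  define Q where "Q = P - {g t}"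
  have Q: "finite Q" "g t \<notin> Q" "P = insert (g t) Q" using insert.prems by (auto simp: Q_def)
  have "{t' \<in> insert t T. g t' = g t} = insert t {t' \<in> T. g t' = g t}" by auto
  then have \<pi>'t: "1 - \<pi>' (g t) = (1 - b) * (1 - \<pi> (g t))" using insert.hyps by (simp add: \<pi>_def \<pi>'_def)
  have "\<pi>' e = \<pi> e" if "e \<in> Q" for e
  proof -
    have "{t' \<in> insert t T. g t' = e} = {t' \<in> T. g t' = e}" using that Q by auto
    then show ?thesis by (simp add: \<pi>_def \<pi>'_def)
  qed
  then have Q': "expec Q \<pi>' G = expec Q \<pi> G" for G by (intro expec_cong) auto
  have "expec (insert t T) (\<lambda>_. b) (\<lambda>S. F (g ` S)) = b * expec P \<pi> (\<lambda>S. F (insert (g t) S)) + (1 - b) * expec P \<pi> F"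
    unfolding expec_insert[OF insert.hyps] \<pi>_def
    using insert.IH[of F] insert.IH[of "\<lambda>S. F (insert (g t) S)"] insert.prems by simp
  also have "\<dots> = (b + (1 - b) * \<pi> (g t)) * expec Q \<pi> (\<lambda>S. F (insert (g t) S)) + (1 - b) * (1 - \<pi> (g t)) * expec Q \<pi> F"
    unfolding Q(3) expec_insert[OF Q(1,2)] by (simp add: algebra_simps)
  also have "b + (1 - b) * \<pi> (g t) = \<pi>' (g t)" using \<pi>'t by (simp add: algebra_simps)
  also have "(1 - b) * (1 - \<pi> (g t)) = 1 - \<pi>' (g t)" using \<pi>'t by simp
  also have "\<pi>' (g t) * expec Q \<pi> (\<lambda>S. F (insert (g t) S)) + (1 - \<pi>' (g t)) * expec Q \<pi> F = expec P \<pi>' F"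
    unfolding Q(3) expec_insert[OF Q(1,2)] Q' ..
  finally show ?case unfolding \<pi>'_def .
qed

lemma one_minus_power_le: "0 \<le> b \<Longrightarrow> b \<le> 1 \<Longrightarrow> 1 - (1 - b) ^ j \<le> real j * (b::real)"
  using Bernoulli_inequality[of "-b" j] by simp

lemma expec_image_le:
  assumes "finite T" "finite P" "g ` T \<subseteq> P" "mono F" "0 \<le> b" "b \<le> 1" "A \<le> 1"
    and "\<And>e. e \<in> P \<Longrightarrow> b * real (card {t \<in> T. g t = e}) \<le> A"
  shows "expec T (\<lambda>_. b) (\<lambda>S. F (g ` S)) \<le> expec P (\<lambda>_. A) F"
  unfolding expec_image_eq[OF assms(1-3)]
proof (rule expec_mono_prob)
  fix e assume e: "e \<in> P"
  have "1 - (1 - b) ^ card {t \<in> T. g t = e} \<le> A"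
    using one_minus_power_le[of b "card {t \<in> T. g t = e}"] assms(5,6) assms(8)[OF e] by (simp add: mult.commute)
  moreover have "(1 - b) ^ card {t \<in> T. g t = e} \<le> 1" using assms by (intro power_le_one) auto
  ultimately show "0 \<le> 1 - (1 - b) ^ card {t \<in> T. g t = e} \<and> 1 - (1 - b) ^ card {t \<in> T. g t = e} \<le> A \<and> A \<le> 1"
    using assms by auto
qed (use assms in auto)

text \<open>The list consists of the edge slots \<open>h\<close> in the order in which they are shared, with the
  probability \<open>A'\<close> of the shared edge, the probability \<open>B\<close> left for the rest of the hyperedge and
  a bound \<open>k\<close> on the number of surviving hyperedges with a given edge in that slot;
  \<open>\<tau> Z\<close> is the set of hyperedges whose earlier slots lie in \<open>Z\<close>.\<close>

fun admissible :: "('e set \<Rightarrow> bool) \<Rightarrow> ('e set \<Rightarrow> 't set) \<Rightarrow> real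
    \<Rightarrow> (('t \<Rightarrow> 'e) \<times> real \<times> real \<times> nat) list \<Rightarrow> ('t \<Rightarrow> 'e) \<Rightarrow> real \<Rightarrow> bool" where
  "admissible Bad \<tau> \<pi> [] g A \<longleftrightarrow> (\<forall>Z e. \<not> Bad Z \<longrightarrow> \<pi> * real (card {t \<in> \<tau> Z. g t = e}) \<le> A)"
| "admissible Bad \<tau> \<pi> ((h, A', B, k) # st) g A \<longleftrightarrow>
     0 \<le> A' \<and> 0 \<le> B \<and> B < 1 \<and> \<pi> \<le> A' * B * (1 - B) ^ k \<and>
     (\<forall>Z e. \<not> Bad Z \<longrightarrow> card {t \<in> \<tau> Z. h t = e} \<le> k) \<and>
     admissible Bad (\<lambda>Z. {t \<in> \<tau> Z. h t \<in> Z}) B st g A"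

text \<open>Each slot is peeled off with \<open>expec_share\<close>, and the exposed edges are
  merged with \<open>expec_union\<close>. The counts in \<open>admissible\<close> are available only
  while the exposed set is not bad; once \<open>Bad Z\<close> holds, every larger set is bad by
  monotonicity and the right-hand side is at least 1. Hence nothing has to be conditioned on: one
  error term for the final edge set covers all steps.\<close>

lemma expec_cover:
  assumes "admissible Bad \<tau> \<pi> st g A" "finite P" "mono F" "\<And>S. 0 \<le> F S" "\<And>S. F S \<le> 1" "mono Bad"
    and "mono \<tau>" "\<And>Z. finite (\<tau> Z)" "T \<subseteq> \<tau> Z" "0 \<le> \<pi>" "\<pi> \<le> 1"
    and "\<And>h. h \<in> insert g (fst ` set st) \<Longrightarrow> h ` T \<subseteq> P"
    and "0 \<le> A" "A + sum_list (map (\<lambda>x. fst (snd x)) st) \<le> 1"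
  shows "expec T (\<lambda>_. \<pi>) (\<lambda>S. F (Z \<union> (\<Union>h\<in>insert g (fst ` set st). h ` S)))
    \<le> expec P (\<lambda>_. A + sum_list (map (\<lambda>x. fst (snd x)) st)) (\<lambda>X. F (Z \<union> X) + of_bool (Bad (Z \<union> X)))"
  using assms
proof (induction st arbitrary: \<tau> \<pi> T Z)
  case Nil
  have fT: "finite T" using Nil.prems(8)[of Z] Nil.prems(9) finite_subset by blast
  show ?case
  proof (cases "Bad Z")
    case True
    have "Bad (Z \<union> X)" for X using True monoD[OF Nil.prems(6), of Z "Z \<union> X"] by auto
    then have "1 \<le> expec P (\<lambda>_. A) (\<lambda>X. F (Z \<union> X) + of_bool (Bad (Z \<union> X)))"
      using Nil.prems by (intro expec_ge_const) auto
    moreover have "expec T (\<lambda>_. \<pi>) (\<lambda>S. F (Z \<union> (\<Union>h\<in>{g}. h ` S))) \<le> 1"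
      using Nil.prems fT by (intro expec_le_const) auto
    ultimately show ?thesis by simp
  next
    case False
    have "expec T (\<lambda>_. \<pi>) (\<lambda>S. F (Z \<union> g ` S)) \<le> expec P (\<lambda>_. A) (\<lambda>X. F (Z \<union> X))"
    proof (rule expec_image_le)
      show "mono (\<lambda>X. F (Z \<union> X))" by (intro monoI monoD[OF Nil.prems(3)]) auto
      fix e
      have "card {t \<in> T. g t = e} \<le> card {t \<in> \<tau> Z. g t = e}"
        using Nil.prems by (intro card_mono) auto
      then have "\<pi> * real (card {t \<in> T. g t = e}) \<le> \<pi> * real (card {t \<in> \<tau> Z. g t = e})"
        using Nil.prems by (intro mult_left_mono) auto
      moreover have "\<pi> * real (card {t \<in> \<tau> Z. g t = e}) \<le> A" using Nil.prems(1) False by simp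
      ultimately show "\<pi> * real (card {t \<in> T. g t = e}) \<le> A" by linarith
    qed (use Nil.prems fT in auto)
    also have "\<dots> \<le> expec P (\<lambda>_. A) (\<lambda>X. F (Z \<union> X) + of_bool (Bad (Z \<union> X)))"
      using Nil.prems by (intro expec_le) auto
    finally show ?thesis by simp
  qed
next
  case (Cons s st)
  obtain h A' B k where s: "s = (h, A', B, k)" by (cases s) auto
  define A'' where "A'' = A + sum_list (map (\<lambda>x. fst (snd x)) st)"
  have adm: "0 \<le> A'" "0 \<le> B" "B < 1" "\<pi> \<le> A' * B * (1 - B) ^ k" "admissible Bad (\<lambda>Z. {t \<in> \<tau> Z. h t \<in> Z}) B st g A"
    and cd: "\<And>Z e. \<not> Bad Z \<Longrightarrow> card {t \<in> \<tau> Z. h t = e} \<le> k"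
    using Cons.prems(1) by (auto simp: s)
  have pos: "0 \<le> A''"
  proof -
    have "admissible Bad \<sigma> \<rho> st g A \<Longrightarrow> 0 \<le> sum_list (map (\<lambda>x. fst (snd x)) st)" for \<sigma> \<rho> st
      by (induction st arbitrary: \<sigma> \<rho>) (auto simp: split_paired_all)
    then show ?thesis using adm(5) Cons.prems(13) by (simp add: A''_def add_nonneg_nonneg)
  qed
  have le1: "A' + A'' \<le> 1" using Cons.prems(14) by (simp add: A''_def s)
  have fT: "finite T" using Cons.prems(8)[of Z] Cons.prems(9) finite_subset by blast
  define H where "H = (\<lambda>X. F (Z \<union> X) + of_bool (Bad (Z \<union> X)))"
  have mH: "mono H" unfolding H_def
  proof (intro monoI add_mono)
    fix X Y :: "'a set" assume "X \<subseteq> Y"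
    then have sub: "Z \<union> X \<subseteq> Z \<union> Y" by auto
    show "F (Z \<union> X) \<le> F (Z \<union> Y)" by (rule monoD[OF Cons.prems(3) sub])
    show "of_bool (Bad (Z \<union> X)) \<le> (of_bool (Bad (Z \<union> Y)) :: real)"
      using monoD[OF Cons.prems(6) sub] by auto
  qed
  let ?U = "\<lambda>S. \<Union>h\<in>insert g (fst ` set (s # st)). h ` S"
  show ?case
  proof (cases "Bad Z")
    case True
    have "Bad (Z \<union> X)" for X using True monoD[OF Cons.prems(6), of Z "Z \<union> X"] by auto
    then have "1 \<le> expec P (\<lambda>_. A'' + A') (\<lambda>X. F (Z \<union> X) + of_bool (Bad (Z \<union> X)))"
      using Cons.prems pos adm le1 by (intro expec_ge_const) auto
    moreover have "expec T (\<lambda>_. \<pi>) (\<lambda>S. F (Z \<union> ?U S)) \<le> 1"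
      using Cons.prems fT by (intro expec_le_const) auto
    ultimately show ?thesis by (simp add: A''_def s add_ac)
  next
    case False
    have "expec T (\<lambda>_. \<pi>) (\<lambda>S. F (Z \<union> ?U S))
      \<le> expec P (\<lambda>_. A') (\<lambda>X. expec {t \<in> T. h t \<in> X} (\<lambda>_. B) (\<lambda>S. F (Z \<union> ?U S)))"
    proof (rule expec_share[where k = k])
      show "mono (\<lambda>S. F (Z \<union> ?U S))" by (intro monoI monoD[OF Cons.prems(3)]) blast
      fix e
      have "card {t \<in> T. h t = e} \<le> card {t \<in> \<tau> Z. h t = e}"
        using Cons.prems by (intro card_mono) auto
      also have "\<dots> \<le> k" by (rule cd) (rule False)
      finally show "card {t \<in> T. h t = e} \<le> k" .
      show "h ` T \<subseteq> P" using Cons.prems(12)[of h] by (simp add: s)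
    qed (use Cons.prems fT adm pos le1 in auto)
    also have "\<dots> \<le> expec P (\<lambda>_. A') (\<lambda>X. expec P (\<lambda>_. A'') (\<lambda>X'. H (X \<union> X')))"
    proof (rule expec_le)
      fix X assume "X \<subseteq> P"
      let ?T = "{t \<in> T. h t \<in> X}"
      \<comment> \<open>All of \<open>X\<close> may be added, not only those edges that surviving
        hyperedges use, because \<open>F\<close> is monotone.\<close>
      have "expec ?T (\<lambda>_. B) (\<lambda>S. F (Z \<union> ?U S))
        \<le> expec ?T (\<lambda>_. B) (\<lambda>S. F ((Z \<union> X) \<union> (\<Union>h\<in>insert g (fst ` set st). h ` S)))"
        using adm by (intro expec_le monoD[OF Cons.prems(3)]) (auto simp: s)
      also have "\<dots> \<le> expec P (\<lambda>_. A'') (\<lambda>X'. F ((Z \<union> X) \<union> X') + of_bool (Bad ((Z \<union> X) \<union> X')))"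
        unfolding A''_def
      proof (rule Cons.IH[OF adm(5)])
        show "mono (\<lambda>Z. {t \<in> \<tau> Z. h t \<in> Z})" using Cons.prems(7) by (auto simp: mono_def)
        show "?T \<subseteq> {t \<in> \<tau> (Z \<union> X). h t \<in> Z \<union> X}"
          using Cons.prems(9) monoD[OF Cons.prems(7), of Z "Z \<union> X"] by auto
        show "A + sum_list (map (\<lambda>x. fst (snd x)) st) \<le> 1" using le1 adm by (simp add: A''_def)
        show "h' ` ?T \<subseteq> P" if "h' \<in> insert g (fst ` set st)" for h' using Cons.prems(12)[of h'] that by auto
      qed (use Cons.prems adm in auto)
      finally show "expec ?T (\<lambda>_. B) (\<lambda>S. F (Z \<union> ?U S)) \<le> expec P (\<lambda>_. A'') (\<lambda>X'. H (X \<union> X'))"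
        by (simp add: H_def Un_assoc)
    qed (use adm pos le1 in auto)
    also have "\<dots> = expec P (\<lambda>_. 1 - (1 - A') * (1 - A'')) H" using Cons.prems by (intro expec_union) auto
    also have "\<dots> \<le> expec P (\<lambda>_. A'' + A') H"
      using adm pos le1 mult_nonneg_nonneg[of A' A''] mult_right_mono[of A' 1 A'']
      by (intro expec_mono_prob mH Cons.prems) (auto simp: algebra_simps)
    finally show ?thesis by (simp add: A''_def s add_ac H_def)
  qed
qed

subsection \<open>Random intersection graphs as iterated unions of cliques\<close>

definition clique :: "'v set \<Rightarrow> 'v set set" where
  "clique U = {e. \<exists>u v. u \<in> U \<and> v \<in> U \<and> u \<noteq> v \<and> e = {u, v}}"

text \<open>This is the Markov operator of one object: from the edge set \<open>S\<close> it moves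
  to \<open>S\<close> with the clique on a binomial random vertex set added. Its m-th iterate at the
  empty set gives the expectation of \<open>F\<close> on the random intersection graph.\<close>

definition obj :: "'v set \<Rightarrow> real \<Rightarrow> ('v set set \<Rightarrow> real) \<Rightarrow> 'v set set \<Rightarrow> real" where
  "obj V p F S = expec V (\<lambda>_. p) (\<lambda>U. F (S \<union> clique U))"

text \<open>The incidences between vertices and objects are exposed column by column, and each
  column is one application of \<open>obj\<close>.\<close>

lemma expec_objects:
  assumes "finite V"
  shows "expec (V \<times> {..<m}) (\<lambda>_. p) (\<lambda>S. F (S0 \<union> (\<Union>w<m. clique {v. (v, w) \<in> S}))) = (obj V p ^^ m) F S0"
proof (induction m arbitrary: S0)
  case (Suc m)
  have eq: "V \<times> {..<Suc m} = V \<times> {m} \<union> V \<times> {..<m}" "V \<times> {m} = (\<lambda>v. (v, m)) ` V" by auto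
  have "expec (V \<times> {..<Suc m}) (\<lambda>_. p) (\<lambda>S. F (S0 \<union> (\<Union>w<Suc m. clique {v. (v, w) \<in> S})))
    = expec (V \<times> {m}) (\<lambda>_. p) (\<lambda>S. expec (V \<times> {..<m}) (\<lambda>_. p) (\<lambda>S'. F (S0 \<union> (\<Union>w<Suc m. clique {v. (v, w) \<in> S \<union> S'}))))"
    unfolding eq(1) using assms by (intro expec_union_disjoint) auto
  also have "\<dots> = expec (V \<times> {m}) (\<lambda>_. p) (\<lambda>S. (obj V p ^^ m) F (S0 \<union> clique {v. (v, m) \<in> S}))"
  proof (intro expec_cong refl)
    fix S assume S: "S \<subseteq> V \<times> {m}"
    show "expec (V \<times> {..<m}) (\<lambda>_. p) (\<lambda>S'. F (S0 \<union> (\<Union>w<Suc m. clique {v. (v, w) \<in> S \<union> S'})))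
      = (obj V p ^^ m) F (S0 \<union> clique {v. (v, m) \<in> S})"
      unfolding Suc.IH[symmetric]
    proof (intro expec_cong refl)
      fix S' assume S': "S' \<subseteq> V \<times> {..<m}"
      have "{v. (v, m) \<in> S \<union> S'} = {v. (v, m) \<in> S}" using S' by auto
      moreover have "{v. (v, w) \<in> S \<union> S'} = {v. (v, w) \<in> S'}" if "w < m" for w using S that by auto
      ultimately have "(\<Union>w<Suc m. clique {v. (v, w) \<in> S \<union> S'})
        = clique {v. (v, m) \<in> S} \<union> (\<Union>w<m. clique {v. (v, w) \<in> S'})"
        unfolding lessThan_Suc by auto
      then show "F (S0 \<union> (\<Union>w<Suc m. clique {v. (v, w) \<in> S \<union> S'}))
        = F (S0 \<union> clique {v. (v, m) \<in> S} \<union> (\<Union>w<m. clique {v. (v, w) \<in> S'}))"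
        by (simp only: Un_assoc)
    qed
  qed
  also have "\<dots> = expec V (\<lambda>_. p) (\<lambda>U. (obj V p ^^ m) F (S0 \<union> clique U))"
  proof -
    have "{v. (v, m) \<in> (\<lambda>v. (v, m)) ` U} = U" for U :: "'a set" by auto
    then show ?thesis unfolding eq(2) using assms by (subst expec_image) (auto simp: inj_on_def)
  qed
  finally show ?case unfolding funpow.simps o_apply by (subst obj_def)
qed simp

lemma expec_uniform:
  assumes "finite E"
  shows "expec E (\<lambda>_. p) F = (\<Sum>S\<in>Pow E. p ^ card S * (1 - p) ^ (card E - card S) * F S)"
  unfolding expec_def using assms
  by (intro sum.cong refl) (auto simp: card_Diff_subset finite_subset)

lemma prob_RIG_eq: "prob_RIG n m p A = (obj {..<n} p ^^ m) (\<lambda>S. of_bool (S \<in> A)) {}"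
proof -
  let ?E = "{..<n} \<times> {..<m}"
  have "prob_RIG n m p A = (\<Sum>S\<in>Pow ?E. p ^ card S * (1 - p) ^ (card ?E - card S) *
    of_bool ({} \<union> (\<Union>w<m. clique {v. (v, w) \<in> S}) \<in> A))"
    unfolding prob_RIG_def
  proof (rule sum.reindex_bij_witness[where i = "\<lambda>S. \<lambda>v\<in>{0..<n}. {w. (v, w) \<in> S}" and j = "\<lambda>W. Sigma {0..<n} W"])
    fix W assume W: "W \<in> {0..<n} \<rightarrow>\<^sub>E Pow {0..<m}"
    then show "Sigma {0..<n} W \<in> Pow ?E" by fastforce
    have Wv: "W v \<subseteq> {0..<m}" "card (W v) \<le> m" "finite (W v)" if "v < n" for v
    proof -
      show "W v \<subseteq> {0..<m}" using W that by (auto simp: PiE_iff)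
      then show "card (W v) \<le> m" "finite (W v)"
        using card_mono[of "{0..<m}" "W v"] finite_subset[of "W v" "{0..<m}"] by simp_all
    qed
    show "(\<lambda>v\<in>{0..<n}. {w. (v, w) \<in> Sigma {0..<n} W}) = W"
      using W by (intro ext) (auto simp: restrict_def PiE_iff extensional_def)
    have "card (Sigma {0..<n} W) = (\<Sum>v<n. card (W v))"
      using Wv(3) by (subst card_SigmaI) (auto simp: atLeast0LessThan)
    moreover have "card ?E - (\<Sum>v<n. card (W v)) = (\<Sum>v<n. m - card (W v))"
      using Wv by (subst sum_subtractf_nat) auto
    moreover have "{} \<union> (\<Union>w<m. clique {v. (v, w) \<in> Sigma {0..<n} W}) = rig_graph n W"
    proof (intro equalityI subsetI)
      fix e assume "e \<in> rig_graph n W"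
      then obtain u v w where "u < n" "v < n" "u \<noteq> v" "w \<in> W u" "w \<in> W v" "e = {u, v}"
        by (auto simp: rig_graph_def)
      moreover from this have "w < m" "e \<in> clique {v. (v, w) \<in> Sigma {0..<n} W}"
        using Wv(1)[of u] by (auto simp: clique_def)
      ultimately show "e \<in> {} \<union> (\<Union>w<m. clique {v. (v, w) \<in> Sigma {0..<n} W})" by blast
    qed (auto simp: rig_graph_def clique_def)
    ultimately show "p ^ card (Sigma {0..<n} W) * (1 - p) ^ (card ?E - card (Sigma {0..<n} W)) *
        of_bool ({} \<union> (\<Union>w<m. clique {v. (v, w) \<in> Sigma {0..<n} W}) \<in> A)
      = (if rig_graph n W \<in> A then \<Prod>v<n. p ^ card (W v) * (1 - p) ^ (m - card (W v)) else 0)"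
      by (simp add: power_sum prod.distrib)
  next
    fix S assume S: "S \<in> Pow ?E"
    then show "Sigma {0..<n} (\<lambda>v\<in>{0..<n}. {w. (v, w) \<in> S}) = S" by auto
    show "(\<lambda>v\<in>{0..<n}. {w. (v, w) \<in> S}) \<in> {0..<n} \<rightarrow>\<^sub>E Pow {0..<m}" using S by auto
  qed
  also have "\<dots> = (obj {..<n} p ^^ m) (\<lambda>S. of_bool (S \<in> A)) {}"
    by (subst expec_objects[symmetric]) (auto simp: expec_uniform)
  finally show ?thesis .
qed

text \<open>An exclusive choice is compared with independent coins. The masses \<open>r0\<close> and
  \<open>r e\<close> are left unnormalised so that the induction can drop an element. Given that the
  choice is \<open>x\<close>, nothing, or an element treated before, it is \<open>x\<close> with
  probability at most \<open>\<sigma> x\<close>, because \<open>r x \<le> r0 * \<sigma> x\<close>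
  and the total mass is at least \<open>r0\<close>.\<close>

lemma expec_exclusive_le:
  assumes "finite E" "mono F" "\<And>e. e \<in> E \<Longrightarrow> 0 \<le> r e \<and> r e \<le> r0 * \<sigma> e \<and> 0 \<le> \<sigma> e \<and> \<sigma> e \<le> 1" "0 \<le> r0"
  shows "r0 * F {} + (\<Sum>e\<in>E. r e * F {e}) \<le> (r0 + (\<Sum>e\<in>E. r e)) * expec E \<sigma> F"
  using assms(1,3)
proof (induction E rule: finite_induct)
  case (insert x E)
  let ?R = "r0 + (\<Sum>e\<in>E. r e)"
  define e0 e1 where "e0 = expec E \<sigma> F" and "e1 = expec E \<sigma> (\<lambda>S. F (insert x S))"
  have r: "0 \<le> r x" "r x \<le> r0 * \<sigma> x" "0 \<le> \<sigma> x" "\<sigma> x \<le> 1" "0 \<le> (\<Sum>e\<in>E. r e)" using insert by (auto intro: sum_nonneg)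
  have e01: "e0 \<le> e1" unfolding e0_def e1_def
    using insert.prems by (intro expec_le monoD[OF assms(2)]) auto
  have e1: "F {x} \<le> e1" unfolding e1_def
    using insert by (intro expec_ge_const monoD[OF assms(2)]) auto
  have "r x \<le> (?R + r x) * \<sigma> x" using r assms(4) by (simp add: distrib_right add_increasing2)
  then have "r x * (e1 - e0) \<le> (?R + r x) * \<sigma> x * (e1 - e0)" using e01 by (intro mult_right_mono) auto
  moreover have "r x * F {x} \<le> r x * e1" using e1 r by (intro mult_left_mono) auto
  moreover have "r0 * F {} + (\<Sum>e\<in>E. r e * F {e}) \<le> ?R * e0" unfolding e0_def using insert by auto
  ultimately show ?case using insert.hyps
    unfolding expec_insert[OF insert.hyps] e0_def[symmetric] e1_def[symmetric] by (simp add: algebra_simps)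
qed simp

lemma clique_le: "U \<subseteq> U' \<Longrightarrow> clique U \<subseteq> clique U'"
  by (auto simp: clique_def)

lemma clique_small: "finite U \<Longrightarrow> card U \<le> 1 \<Longrightarrow> clique U = {}"
  by (auto simp: clique_def card_le_Suc0_iff_eq)

lemma clique_edge: "card e = 2 \<Longrightarrow> clique e = {e}"
  by (auto simp: clique_def card_2_iff)

lemma obj_mono: "0 \<le> p \<Longrightarrow> p \<le> 1 \<Longrightarrow> mono F \<Longrightarrow> mono (obj V p F)"
  unfolding obj_def by (intro monoI expec_le) (auto intro!: monoD[of F])

lemma obj_pow_mono: "0 \<le> p \<Longrightarrow> p \<le> 1 \<Longrightarrow> mono F \<Longrightarrow> mono ((obj V p ^^ r) F)"
  by (induction r) (auto intro: obj_mono)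

lemma expec_card_gt:
  assumes "finite V" "0 \<le> p" "p \<le> (1::real)"
  shows "expec V (\<lambda>_. p) (\<lambda>U. of_bool (k \<le> card U)) \<le> (real (card V) * p) ^ k"
proof -
  have "expec V (\<lambda>_. p) (\<lambda>U. of_bool (k \<le> card U)) \<le> expec V (\<lambda>_. p) (\<lambda>U. of_bool (\<exists>B\<in>{B. B \<subseteq> V \<and> card B = k}. B \<subseteq> U))"
  proof (rule expec_le)
    fix U assume U: "U \<subseteq> V"
    show "of_bool (k \<le> card U) \<le> (of_bool (\<exists>B\<in>{B. B \<subseteq> V \<and> card B = k}. B \<subseteq> U) :: real)"
    proof (cases "k \<le> card U")
      case True
      then obtain B where "B \<subseteq> U" "card B = k" by (meson obtain_subset_with_card_n)
      then show ?thesis using U by auto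
    qed simp
  qed (use assms in auto)
  also have "\<dots> \<le> real (card {B. B \<subseteq> V \<and> card B = k}) * p ^ k"
    by (rule expec_exists_le) (use assms in auto)
  also have "\<dots> \<le> real (card V ^ k) * p ^ k"
  proof (intro mult_right_mono of_nat_mono)
    show "card {B. B \<subseteq> V \<and> card B = k} \<le> card V ^ k"
      unfolding n_subsets[OF assms(1)]
      using binomial_le_pow[of k "card V"] by (cases "k \<le> card V") (auto simp: binomial_eq_0)
  qed (use assms in auto)
  finally show ?thesis by (simp add: power_mult_distrib)
qed

text \<open>Vertex sets of size at most one add no edge, and those larger than
  \<open>\<kappa>\<close> are paid for by \<open>F \<le> 1\<close> and \<open>expec_card_gt\<close>.
  The denominator in \<open>\<sigma>\<close> meets the requirement of
  \<open>expec_exclusive_le\<close>: an object picks no set from \<open>Ty\<close> with at least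
  that probability.\<close>

lemma obj_le:
  assumes V: "finite V" and p: "0 \<le> p" "p \<le> 1" "(real (card V) * p)\<^sup>2 \<le> 1 / 2"
    and F: "mono F" "\<And>S. 0 \<le> F S" "\<And>S. F S \<le> 1"
    and \<sigma>: "\<And>e. e \<in> Ty \<Longrightarrow> \<sigma> e = p ^ card e * (1 - p) ^ (card V - card e) / (1 - (real (card V) * p)\<^sup>2)"
    and Ty: "Ty = {e. e \<subseteq> V \<and> 2 \<le> card e \<and> card e \<le> \<kappa>}"
    and \<sigma>1: "\<And>e. e \<in> Ty \<Longrightarrow> \<sigma> e \<le> 1"
  shows "obj V p F S \<le> expec Ty \<sigma> (\<lambda>R. F (S \<union> \<Union>(clique ` R))) + (real (card V) * p) ^ Suc \<kappa>"
proof -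
  define w where "w U = p ^ card U * (1 - p) ^ (card V - card U)" for U :: "'a set"
  define Q where "Q = (real (card V) * p)\<^sup>2"
  define G where "G U = F (S \<union> clique U)" for U
  have ew: "expec V (\<lambda>_. p) H = (\<Sum>U\<in>Pow V. w U * H U)" for H
    unfolding w_def by (rule expec_uniform) (rule V)
  have w0: "0 \<le> w U" for U using p by (simp add: w_def)
  have fTy: "finite Ty" "Ty \<subseteq> Pow V" unfolding Ty using V by auto
  have sum1: "(\<Sum>U\<in>Pow V. w U) = 1" using ew[of "\<lambda>_. 1"] V by (simp add: expec_const)
  have sumTy: "(\<Sum>U\<in>Ty. w U) \<le> Q"
  proof -
    have "(\<Sum>U\<in>Ty. w U) \<le> (\<Sum>U\<in>Pow V. w U * of_bool (2 \<le> card U))"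
    proof -
      have "(\<Sum>U\<in>Ty. w U) = (\<Sum>U\<in>Ty. w U * of_bool (2 \<le> card U))" by (intro sum.cong) (auto simp: Ty)
      also have "\<dots> \<le> (\<Sum>U\<in>Pow V. w U * of_bool (2 \<le> card U))"
        using V w0 fTy by (intro sum_mono2) auto
      finally show ?thesis .
    qed
    also have "\<dots> \<le> Q" unfolding ew[symmetric] Q_def using expec_card_gt[OF V p(1,2), of 2] by simp
    finally show ?thesis .
  qed
  define r0 where "r0 = 1 - (\<Sum>U\<in>Ty. w U)"
  have "obj V p F S = (\<Sum>U\<in>Pow V. w U * G U)" unfolding obj_def ew G_def ..
  also have "\<dots> \<le> (\<Sum>U\<in>Pow V. (if U \<in> Ty then w U * G U else w U * F S) + w U * of_bool (Suc \<kappa> \<le> card U))"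
  proof (rule sum_mono)
    fix U assume U: "U \<in> Pow V"
    then have fU: "finite U" using V finite_subset by auto
    consider "U \<in> Ty" | "card U \<le> 1" "U \<notin> Ty" | "Suc \<kappa> \<le> card U" "U \<notin> Ty" using U unfolding Ty by fastforce
    then show "w U * G U \<le> (if U \<in> Ty then w U * G U else w U * F S) + w U * of_bool (Suc \<kappa> \<le> card U)"
    proof cases
      case 3
      have "w U * G U \<le> w U * (F S + 1)" using w0 F by (intro mult_left_mono) (auto simp: G_def add_increasing)
      then show ?thesis using 3 by (simp add: algebra_simps)
    qed (use w0 fU in \<open>auto simp: G_def clique_small\<close>)
  qed
  also have "\<dots> = (\<Sum>U\<in>Pow V. if U \<in> Ty then w U * G U else w U * F S) + expec V (\<lambda>_. p) (\<lambda>U. of_bool (Suc \<kappa> \<le> card U))"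
    unfolding ew by (simp add: sum.distrib)
  also have "\<dots> \<le> (\<Sum>U\<in>Pow V. if U \<in> Ty then w U * G U else w U * F S) + (real (card V) * p) ^ Suc \<kappa>"
    using expec_card_gt[OF V p(1,2)] by (intro add_left_mono)
  also have "(\<Sum>U\<in>Pow V. if U \<in> Ty then w U * G U else w U * F S) = r0 * F S + (\<Sum>e\<in>Ty. w e * G e)"
  proof -
    have "(\<Sum>U\<in>Pow V. if U \<in> Ty then w U * G U else w U * F S) = (\<Sum>U\<in>Pow V. w U * F S + (if U \<in> Ty then w U * (G U - F S) else 0))"
      by (intro sum.cong) (auto simp: algebra_simps)
    also have "\<dots> = F S + (\<Sum>e\<in>Ty. w e * (G e - F S))"
      using V fTy sum1 by (simp add: sum.distrib sum.If_cases Int_absorb1 flip: sum_distrib_right)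
    finally show ?thesis by (simp add: r0_def right_diff_distrib sum_subtractf algebra_simps sum_distrib_left sum_distrib_right)
  qed
  also have "r0 * F S + (\<Sum>e\<in>Ty. w e * G e) \<le> (r0 + (\<Sum>e\<in>Ty. w e)) * expec Ty \<sigma> (\<lambda>R. F (S \<union> \<Union>(clique ` R)))"
  proof -
    define H where "H R = F (S \<union> \<Union>(clique ` R))" for R
    have "r0 * H {} + (\<Sum>e\<in>Ty. w e * H {e}) \<le> (r0 + (\<Sum>e\<in>Ty. w e)) * expec Ty \<sigma> H"
    proof (rule expec_exclusive_le[OF fTy(1)])
      show "mono H" unfolding H_def by (intro monoI monoD[OF F(1)]) auto
      have r0: "1 - Q \<le> r0" using sumTy by (simp add: r0_def)
      then show "0 \<le> r0" using p by (simp add: Q_def)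
      fix e assume e: "e \<in> Ty"
      have \<sigma>e: "\<sigma> e = w e / (1 - Q)" using \<sigma>[OF e] by (simp add: w_def Q_def)
      have Q1: "0 < 1 - Q" using p by (simp add: Q_def)
      have "w e = (1 - Q) * \<sigma> e" using Q1 by (simp add: \<sigma>e)
      also have "\<dots> \<le> r0 * \<sigma> e" using r0 Q1 w0 by (intro mult_right_mono) (auto simp: \<sigma>e)
      finally show "0 \<le> w e \<and> w e \<le> r0 * \<sigma> e \<and> 0 \<le> \<sigma> e \<and> \<sigma> e \<le> 1"
        using w0 Q1 \<sigma>1[OF e] by (auto simp: \<sigma>e)
    qed
    moreover have "H = (\<lambda>R. F (S \<union> \<Union>(clique ` R)))" by (simp add: fun_eq_iff H_def)
    ultimately show ?thesis by (simp add: G_def)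
  qed
  also have "r0 + (\<Sum>e\<in>Ty. w e) = 1" by (simp add: r0_def)
  finally show ?thesis by simp
qed

text \<open>Objects are replaced one after another. By \<open>expec_union\<close> the independent
  vertex sets that dominate the single objects merge into one independent family, while the errors
  add up.\<close>

lemma obj_pow_le:
  assumes step: "\<And>F S. mono F \<Longrightarrow> (\<And>S. 0 \<le> F S) \<Longrightarrow> (\<And>S. F S \<le> 1) \<Longrightarrow>
      obj V p F S \<le> expec Ty \<sigma> (\<lambda>R. F (S \<union> \<Union>(clique ` R))) + (\<epsilon>::real)"
    and p: "0 \<le> p" "p \<le> 1" and fin: "finite V" "finite Ty" and \<sigma>: "\<And>e. e \<in> Ty \<Longrightarrow> 0 \<le> \<sigma> e \<and> \<sigma> e \<le> 1"
    and F: "mono F" "\<And>S. 0 \<le> F S" "\<And>S. F S \<le> 1"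
  shows "(obj V p ^^ m) F S \<le> expec Ty (\<lambda>e. 1 - (1 - \<sigma> e) ^ m) (\<lambda>R. F (S \<union> \<Union>(clique ` R))) + real m * \<epsilon>"
proof (induction m arbitrary: S)
  case 0
  have "expec Ty (\<lambda>e. 0) (\<lambda>R. F (S \<union> \<Union>(clique ` R))) = F S" using expec_image_eq[of "{}" Ty "\<lambda>_. undefined" 0 "\<lambda>R. F (S \<union> \<Union>(clique ` R))"] fin by simp
  then show ?case by simp
next
  case (Suc m)
  let ?H = "(obj V p ^^ m) F"
  have H: "0 \<le> (obj V p ^^ r) F S \<and> (obj V p ^^ r) F S \<le> 1" for r S
  proof (induction r arbitrary: S)
    case (Suc r)
    then show ?case using p fin
      by (auto simp: obj_def intro!: expec_ge_const expec_le_const)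
  qed (use F in auto)
  have "(obj V p ^^ Suc m) F S \<le> expec Ty \<sigma> (\<lambda>R. ?H (S \<union> \<Union>(clique ` R))) + \<epsilon>"
    using H by (simp, intro step obj_pow_mono p F) auto
  also have "expec Ty \<sigma> (\<lambda>R. ?H (S \<union> \<Union>(clique ` R)))
    \<le> expec Ty \<sigma> (\<lambda>R. expec Ty (\<lambda>e. 1 - (1 - \<sigma> e) ^ m) (\<lambda>R'. F (S \<union> \<Union>(clique ` (R \<union> R')))) + real m * \<epsilon>)"
  proof (intro expec_le \<sigma>)
    fix R
    have eq: "S \<union> \<Union>(clique ` (R \<union> R')) = (S \<union> \<Union>(clique ` R)) \<union> \<Union>(clique ` R')" for R' by auto
    show "?H (S \<union> \<Union>(clique ` R)) \<le> expec Ty (\<lambda>e. 1 - (1 - \<sigma> e) ^ m) (\<lambda>R'. F (S \<union> \<Union>(clique ` (R \<union> R')))) + real m * \<epsilon>"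
      unfolding eq by (rule Suc.IH)
  qed
  also have "\<dots> = expec Ty (\<lambda>e. 1 - (1 - \<sigma> e) ^ Suc m) (\<lambda>R. F (S \<union> \<Union>(clique ` R))) + real m * \<epsilon>"
    unfolding expec_add expec_const[OF fin(2)]
    by (subst expec_union[OF fin(2), where F = "\<lambda>R. F (S \<union> \<Union>(clique ` R))"]) (simp add: algebra_simps)
  finally show ?case by (simp add: algebra_simps)
qed

subsection \<open>Exposing the edges one at a time\<close>

text \<open>One step adds a uniformly chosen element of \<open>E\<close>, each with probability \<open>\<sigma>\<close>, or nothing;
  the natural number counts the steps that chose something.\<close>

definition kern :: "'e set \<Rightarrow> real \<Rightarrow> ('e set \<Rightarrow> nat \<Rightarrow> real) \<Rightarrow> 'e set \<Rightarrow> nat \<Rightarrow> real" where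
  "kern E \<sigma> F S h = (1 - real (card E) * \<sigma>) * F S h + \<sigma> * (\<Sum>e\<in>E. F (insert e S) (Suc h))"

lemma kern_pow_shift:
  "(kern E \<sigma> ^^ r) (\<lambda>S h. F (insert x S) (h + j)) S h = (kern E \<sigma> ^^ r) F (insert x S) (h + j)"
proof (induction r arbitrary: S h)
  case (Suc r)
  then show ?case by (simp add: kern_def insert_commute[of x])
qed simp

lemma kern_pow_mono:
  assumes "0 \<le> \<sigma>" "real (card E) * \<sigma> \<le> 1" "\<And>S h. h0 \<le> h \<Longrightarrow> F S h \<le> G S h" "h0 \<le> h"
  shows "(kern E \<sigma> ^^ r) F S h \<le> (kern E \<sigma> ^^ r) G S h"
  using assms(4)
proof (induction r arbitrary: S h)
  case (Suc r)
  then show ?case using assms(1,2) by (auto simp: kern_def intro!: add_mono mult_left_mono sum_mono)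
qed (use assms in auto)

lemma kern_pow_const: "(kern E \<sigma> ^^ r) (\<lambda>S h. c) S h = c"
  by (induction r arbitrary: S h) (auto simp: kern_def algebra_simps)

lemma kern_pow_count: "(kern E \<sigma> ^^ r) (\<lambda>S h. real h) S h = real h + real r * real (card E) * \<sigma>"
  by (induction r arbitrary: S h) (auto simp: kern_def algebra_simps)

lemma kern_pow_add: "(kern E \<sigma> ^^ r) (\<lambda>S h. F S h + G S h) S h = (kern E \<sigma> ^^ r) F S h + (kern E \<sigma> ^^ r) G S h"
  by (induction r arbitrary: S h) (auto simp: kern_def algebra_simps sum.distrib)

lemma kern_pow_cmult: "(kern E \<sigma> ^^ r) (\<lambda>S h. c * F S h) S h = c * (kern E \<sigma> ^^ r) F S h"
  by (induction r arbitrary: S h) (auto simp: kern_def algebra_simps sum_distrib_left)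

text \<open>Conditioned on not choosing \<open>x\<close>, a step chooses each remaining element with
  probability \<open>\<sigma> / (1 - \<sigma>)\<close>. The hitting probability thus grows during
  the exposure, which is why \<open>expec_le_kern_pow\<close> keeps a fixed lower bound
  \<open>\<sigma>0\<close>.\<close>

lemma kern_insert:
  assumes "finite E" "x \<notin> E" "\<sigma> < 1"
  shows "kern (insert x E) \<sigma> F S h = (1 - \<sigma>) * kern E (\<sigma> / (1 - \<sigma>)) F S h + \<sigma> * F (insert x S) (Suc h)"
proof -
  have "(1 - \<sigma>) * kern E (\<sigma> / (1 - \<sigma>)) F S h
    = ((1 - \<sigma>) - real (card E) * ((1 - \<sigma>) * (\<sigma> / (1 - \<sigma>)))) * F S h + ((1 - \<sigma>) * (\<sigma> / (1 - \<sigma>))) * (\<Sum>e\<in>E. F (insert e S) (Suc h))"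
    by (simp only: kern_def algebra_simps)
  also have "(1 - \<sigma>) * (\<sigma> / (1 - \<sigma>)) = \<sigma>" using assms by simp
  finally show ?thesis using assms by (simp add: kern_def algebra_simps)
qed

lemma kern_expec: "kern E \<sigma> (\<lambda>S h. expec P \<pi> (\<lambda>J. G J S h)) S h = expec P \<pi> (\<lambda>J. kern E \<sigma> (G J) S h)"
  unfolding kern_def expec_add expec_cmult expec_sum ..

text \<open>The set \<open>J\<close> collects the steps that choose \<open>x\<close>.\<close>

lemma kern_pow_insert:
  assumes "finite E" "x \<notin> E" "\<sigma> < 1"
  shows "(kern (insert x E) \<sigma> ^^ r) F S h = expec {..<r} (\<lambda>_. \<sigma>) (\<lambda>J.
    (kern E (\<sigma> / (1 - \<sigma>)) ^^ (r - card J)) F (if J = {} then S else insert x S) (h + card J))"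
proof (induction r arbitrary: S h)
  case (Suc r)
  let ?K = "kern E (\<sigma> / (1 - \<sigma>))"
  let ?s = "\<lambda>J::nat set. \<lambda>S. if J = {} then S else insert x S"
  have nr: "r \<notin> {..<r}" "finite {..<r}" by auto
  have fin: "finite J" "r \<notin> J" "card J \<le> r" if "J \<subseteq> {..<r}" for J
    using that finite_subset[of J "{..<r}"] card_mono[of "{..<r}" J] by auto
  have "(kern (insert x E) \<sigma> ^^ Suc r) F S h
    = (1 - \<sigma>) * ?K ((kern (insert x E) \<sigma> ^^ r) F) S h + \<sigma> * (kern (insert x E) \<sigma> ^^ r) F (insert x S) (Suc h)"
    by (simp add: kern_insert[OF assms])
  also have "(kern (insert x E) \<sigma> ^^ r) F = (\<lambda>S h. expec {..<r} (\<lambda>_. \<sigma>) (\<lambda>J. (?K ^^ (r - card J)) F (?s J S) (h + card J)))"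
    by (intro ext) (rule Suc.IH)
  also have "?K \<dots> S h = expec {..<r} (\<lambda>_. \<sigma>) (\<lambda>J. (?K ^^ (Suc r - card J)) F (?s J S) (h + card J))"
    unfolding kern_expec
  proof (intro expec_cong refl)
    fix J assume J: "J \<subseteq> {..<r}"
    let ?G = "(?K ^^ (r - card J)) F"
    have "?K (\<lambda>S h. ?G (?s J S) (h + card J)) S h = ?K ?G (?s J S) (h + card J)"
    proof (cases "J = {}")
      case False
      then show ?thesis using kern_pow_shift[of 1 E "\<sigma> / (1 - \<sigma>)" ?G x "card J" S h] by simp
    qed simp
    also have "\<dots> = (?K ^^ (Suc r - card J)) F (?s J S) (h + card J)"
      using fin[OF J] by (simp add: Suc_diff_le)
    finally show "?K (\<lambda>S h. ?G (?s J S) (h + card J)) S h = (?K ^^ (Suc r - card J)) F (?s J S) (h + card J)" .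
  qed
  also have "expec {..<r} (\<lambda>_. \<sigma>) (\<lambda>J. (?K ^^ (r - card J)) F (?s J (insert x S)) (Suc h + card J))
    = expec {..<r} (\<lambda>_. \<sigma>) (\<lambda>J. (?K ^^ (Suc r - card (insert r J))) F (?s (insert r J) S) (h + card (insert r J)))"
    using fin by (intro expec_cong) auto
  finally show ?case unfolding lessThan_Suc expec_insert[OF nr(2,1)] by simp
qed simp

text \<open>When \<open>x\<close> or more objects are unused, the next element is hit with probability at least \<open>q\<close>;
  otherwise the indicator on the right-hand side pays.\<close>

lemma expec_le_kern_pow:
  assumes "finite E" "mono F" "\<And>S. 0 \<le> F S" "\<And>S. F S \<le> 1" "0 \<le> q" "q \<le> 1"
    and q: "\<And>r. x \<le> real r \<Longrightarrow> (1 - \<sigma>0) ^ r \<le> 1 - q" and "0 \<le> \<sigma>0" "\<sigma>0 \<le> \<sigma>" "real (card E) * \<sigma> < 1" "r \<le> m"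
  shows "expec E (\<lambda>_. q) (\<lambda>X. F (S \<union> X)) \<le> (kern E \<sigma> ^^ r) (\<lambda>S h. F S + of_bool (real (m - h) < x)) S (m - r)"
  using assms(1,9-11)
proof (induction E arbitrary: \<sigma> r S rule: finite_induct)
  case empty
  have "(kern {} \<sigma> ^^ r) G = G" for G :: "'a set \<Rightarrow> nat \<Rightarrow> real"
    by (induction r) (auto simp: kern_def fun_eq_iff)
  then show ?case by simp
next
  case (insert e E)
  let ?G = "\<lambda>S h. F S + of_bool (real (m - h) < x)"
  have \<sigma>0: "0 \<le> \<sigma>" using insert.prems assms(8) by simp
  show ?case
  \<comment> \<open>There are \<open>r\<close> steps left and the counter stands at
    \<open>m - r\<close>. It never decreases, so for \<open>r < x\<close> the indicator is 1
    throughout.\<close>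
  proof (cases "real r < x")
    case True
    have "expec (insert e E) (\<lambda>_. q) (\<lambda>X. F (S \<union> X)) \<le> 1"
      using insert.hyps assms by (intro expec_le_const) auto
    also have "1 = (kern (insert e E) \<sigma> ^^ r) (\<lambda>S h. 1) S (m - r)" by (simp only: kern_pow_const)
    also have "\<dots> \<le> (kern (insert e E) \<sigma> ^^ r) ?G S (m - r)"
    proof (rule kern_pow_mono[where h0 = "m - r"])
      fix S h assume "m - r \<le> h"
      then have "real (m - h) \<le> real r" by simp
      then show "1 \<le> ?G S h" using True assms(3)[of S] by auto
    qed (use insert.prems \<sigma>0 in auto)
    finally show ?thesis .
  next
    case False
    define \<sigma>' where "\<sigma>' = \<sigma> / (1 - \<sigma>)"
    have c: "\<sigma> + real (card E) * \<sigma> < 1" using insert by (simp add: algebra_simps)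
    then have \<sigma>1: "\<sigma> < 1" using \<sigma>0 mult_nonneg_nonneg[of "real (card E)" \<sigma>] by linarith
    have \<sigma>': "\<sigma>0 \<le> \<sigma>'" "real (card E) * \<sigma>' < 1"
    proof -
      have "\<sigma> \<le> \<sigma>'" using \<sigma>1 \<sigma>0 mult_left_mono[of "1-\<sigma>" 1 \<sigma>] by (simp add: \<sigma>'_def pos_le_divide_eq)
      then show "\<sigma>0 \<le> \<sigma>'" using insert.prems by simp
      show "real (card E) * \<sigma>' < 1" using c \<sigma>1 by (simp add: \<sigma>'_def pos_divide_less_eq)
    qed
    define x0 x1 where "x0 = expec E (\<lambda>_. q) (\<lambda>X. F (S \<union> X))" and "x1 = expec E (\<lambda>_. q) (\<lambda>X. F (insert e S \<union> X))"
    have x01: "x0 \<le> x1" unfolding x0_def x1_def using assms by (intro expec_le monoD[OF assms(2)]) auto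
    have "(1 - \<sigma>) ^ r \<le> (1 - \<sigma>0) ^ r" using \<sigma>1 insert.prems by (intro power_mono) auto
    also have "\<dots> \<le> 1 - q" using False by (intro q) auto
    finally have le: "(1 - \<sigma>) ^ r \<le> 1 - q" .
    \<comment> \<open>The process misses \<open>e\<close> with probability
      \<open>(1 - \<sigma>) ^ r\<close>, which is at most \<open>1 - q\<close>, so it puts no more
      weight on the smaller value \<open>x0\<close>.\<close>
    have "expec (insert e E) (\<lambda>_. q) (\<lambda>X. F (S \<union> X)) = x1 - (1 - q) * (x1 - x0)"
      unfolding expec_insert[OF insert.hyps] x0_def x1_def by (simp add: algebra_simps)
    also have "\<dots> \<le> x1 - (1 - \<sigma>) ^ r * (x1 - x0)"
      using le x01 by (intro diff_left_mono mult_right_mono) auto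
    \<comment> \<open>As \<open>0 ^ 0 = 1\<close>, the power \<open>0 ^ card J\<close> is the
      indicator that no step chose \<open>e\<close>.\<close>
    also have "(1 - \<sigma>) ^ r = expec {..<r} (\<lambda>_. \<sigma>) (\<lambda>J. 0 ^ card J)"
      by (subst expec_power_card) auto
    also have "x1 - \<dots> * (x1 - x0) = expec {..<r} (\<lambda>_. \<sigma>) (\<lambda>J. x1 + (- (x1 - x0)) * 0 ^ card J)"
      unfolding expec_add expec_cmult by (simp add: expec_const algebra_simps)
    also have "\<dots> \<le> expec {..<r} (\<lambda>_. \<sigma>) (\<lambda>J. (kern E \<sigma>' ^^ (r - card J)) ?G (if J = {} then S else insert e S) (m - r + card J))"
    proof (rule expec_le)
      fix J assume J: "J \<subseteq> {..<r}"
      then have fJ: "finite J" "card J \<le> r" using finite_subset[of J "{..<r}"] card_mono[of "{..<r}" J] by auto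
      have "x1 + (- (x1 - x0)) * 0 ^ card J = expec E (\<lambda>_. q) (\<lambda>X. F ((if J = {} then S else insert e S) \<union> X))"
        using fJ by (auto simp: x0_def x1_def)
      also have "\<dots> \<le> (kern E \<sigma>' ^^ (r - card J)) ?G (if J = {} then S else insert e S) (m - (r - card J))"
        by (rule insert.IH) (use \<sigma>' insert.prems in auto)
      also have "m - (r - card J) = m - r + card J" using fJ insert.prems by simp
      finally show "x1 + (- (x1 - x0)) * 0 ^ card J \<le> (kern E \<sigma>' ^^ (r - card J)) ?G (if J = {} then S else insert e S) (m - r + card J)" .
    qed (use \<sigma>0 \<sigma>1 in auto)
    also have "\<dots> = (kern (insert e E) \<sigma> ^^ r) ?G S (m - r)"
      unfolding \<sigma>'_def by (rule kern_pow_insert[OF insert.hyps \<sigma>1, symmetric])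
    finally show ?thesis .
  qed
qed

lemma expec_le_kern_pow_count:
  assumes "finite E" "mono F" "\<And>S. 0 \<le> F S" "\<And>S. F S \<le> 1" "0 \<le> q" "q \<le> 1"
    and q: "\<And>r. x \<le> real r \<Longrightarrow> (1 - \<sigma>) ^ r \<le> 1 - q" and "0 \<le> \<sigma>" "real (card E) * \<sigma> < 1" "x < real m"
  shows "expec E (\<lambda>_. q) F \<le> (kern E \<sigma> ^^ m) (\<lambda>S h. F S) {} 0 + real m * real (card E) * \<sigma> / (real m - x)"
proof -
  have "expec E (\<lambda>_. q) F = expec E (\<lambda>_. q) (\<lambda>X. F ({} \<union> X))" by simp
  also have "\<dots> \<le> (kern E \<sigma> ^^ m) (\<lambda>S h. F S + of_bool (real (m - h) < x)) {} (m - m)"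
  proof (rule expec_le_kern_pow[where \<sigma>0 = \<sigma>])
    fix r assume "x \<le> real r" then show "(1 - \<sigma>) ^ r \<le> 1 - q" by (rule q)
  qed (use assms(1-6,8-) in auto)
  also have "\<dots> \<le> (kern E \<sigma> ^^ m) (\<lambda>S h. F S + (1 / (real m - x)) * real h) {} 0"
    unfolding diff_self_eq_0
  proof (rule kern_pow_mono[where h0 = 0])
    fix S and h :: nat
    \<comment> \<open>The indicator is replaced by a linear function of the count, whose mean is
      known exactly from \<open>kern_pow_count\<close>.\<close>
    have "of_bool (real (m - h) < x) \<le> (1 / (real m - x)) * real h"
    proof (cases "real (m - h) < x")
      case True
      then have "real m - x \<le> real h" by (simp add: of_nat_diff_real split: if_splits)
      then show ?thesis using True assms by (simp add: field_simps)
    qed (use assms in auto)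
    then show "F S + of_bool (real (m - h) < x) \<le> F S + (1 / (real m - x)) * real h" by simp
  qed (use assms in auto)
  also have "\<dots> = (kern E \<sigma> ^^ m) (\<lambda>S h. F S) {} 0 + real m * real (card E) * \<sigma> / (real m - x)"
    unfolding kern_pow_add kern_pow_cmult kern_pow_count by simp
  finally show ?thesis .
qed

text \<open>A three-element vertex set is credited with only one of its pairs, chosen uniformly;
  each pair lies in \<open>card V - 2\<close> such sets, which gives the second summand of
  \<open>\<rho>\<close>. Larger sets are credited with nothing. Since \<open>G\<close> is monotone,
  discarding edges only lowers the expectation.\<close>

lemma kern_le_obj:
  assumes V: "finite V" and p: "0 \<le> p" "p \<le> 1" and G: "mono G"
    and E: "E = {e. e \<subseteq> V \<and> card e = 2}"
    and \<rho>: "\<rho> = p\<^sup>2 * (1 - p) ^ (card V - 2) + real (card V - 2) / 3 * (p ^ 3 * (1 - p) ^ (card V - 3))"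
  shows "kern E \<rho> (\<lambda>S h. G S) S h \<le> obj V p G S"
proof -
  define w where "w U = p ^ card U * (1 - p) ^ (card V - card U)" for U :: "'a set"
  define D where "D U = G (S \<union> clique U) - G S" for U
  define d where "d e = G (insert e S) - G S" for e
  let ?T = "{U. U \<subseteq> V \<and> card U = 3}"
  have ew: "expec V (\<lambda>_. p) H = (\<Sum>U\<in>Pow V. w U * H U)" for H
    unfolding w_def by (rule expec_uniform) (rule V)
  have w0: "0 \<le> w U" for U using p by (simp add: w_def)
  have D0: "0 \<le> D U" for U using monoD[OF G, of S "S \<union> clique U"] by (simp add: D_def)
  have fin: "finite E" "finite ?T" using V by (auto simp: E)
  have dD: "d e \<le> D U" if "e \<in> clique U" for e U
    using monoD[OF G, of "insert e S" "S \<union> clique U"] that by (simp add: d_def D_def)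
  have D2: "D e = d e" if "e \<in> E" for e using that by (simp add: E D_def d_def clique_edge)
  have T: "(\<Sum>e\<in>{e\<in>E. e \<subseteq> U}. d e) \<le> 3 * D U" if U: "U \<in> ?T" for U
  proof -
    have fU: "finite U" using U V finite_subset by auto
    have "{e\<in>E. e \<subseteq> U} = {e. e \<subseteq> U \<and> card e = 2}" using U by (auto simp: E)
    then have "card {e\<in>E. e \<subseteq> U} = 3" using U n_subsets[OF fU, of 2] by (simp add: choose_two)
    moreover have "(\<Sum>e\<in>{e\<in>E. e \<subseteq> U}. d e) \<le> (\<Sum>e\<in>{e\<in>E. e \<subseteq> U}. D U)"
      by (intro sum_mono dD) (auto simp: E clique_def card_2_iff)
    ultimately show ?thesis by simp
  qed
  have cnt: "card {U\<in>?T. e \<subseteq> U} = card V - 2" if e: "e \<in> E" for e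
  proof -
    have fe: "finite e" "card e = 2" "e \<subseteq> V" using e V finite_subset by (auto simp: E)
    have "{U\<in>?T. e \<subseteq> U} = (\<lambda>v. insert v e) ` (V - e)"
    proof (intro equalityI subsetI)
      fix U assume U: "U \<in> {U\<in>?T. e \<subseteq> U}"
      then have "finite U" using V finite_subset by auto
      then have "card (U - e) = 1" using U fe by (simp add: card_Diff_subset)
      then obtain v where "U - e = {v}" by (rule card_1_singletonE)
      then show "U \<in> (\<lambda>v. insert v e) ` (V - e)" using U by auto
    qed (use fe in auto)
    moreover have "inj_on (\<lambda>v. insert v e) (V - e)" by (auto simp: inj_on_def)
    ultimately show ?thesis using fe V by (simp add: card_image card_Diff_subset)
  qed
  let ?w2 = "p\<^sup>2 * (1 - p) ^ (card V - 2)" and ?w3 = "p ^ 3 * (1 - p) ^ (card V - 3)"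
  \<comment> \<open>Double counting of the incidences between a pair and a three-element set
    containing it.\<close>
  have "?w3 * (real (card V - 2) * (\<Sum>e\<in>E. d e)) = ?w3 * (\<Sum>e\<in>E. \<Sum>U\<in>{U\<in>?T. e \<subseteq> U}. d e)"
  proof -
    have "(\<Sum>e\<in>E. \<Sum>U\<in>{U\<in>?T. e \<subseteq> U}. d e) = (\<Sum>e\<in>E. real (card V - 2) * d e)"
      by (intro sum.cong refl) (simp only: sum_constant cnt)
    then show ?thesis by (simp only: sum_distrib_left)
  qed
  also have "(\<Sum>e\<in>E. \<Sum>U\<in>{U\<in>?T. e \<subseteq> U}. d e) = (\<Sum>U\<in>?T. \<Sum>e\<in>{e\<in>E. e \<subseteq> U}. d e)"
    by (rule sum.swap_restrict) (use fin in auto)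
  also have "?w3 * \<dots> \<le> ?w3 * (\<Sum>U\<in>?T. 3 * D U)" using p by (intro mult_left_mono sum_mono T) auto
  finally have 3: "real (card V - 2) / 3 * ?w3 * (\<Sum>e\<in>E. d e) \<le> (\<Sum>U\<in>?T. w U * D U)"
  proof -
    have "(\<Sum>U\<in>?T. w U * D U) = ?w3 * (\<Sum>U\<in>?T. D U)" by (simp add: w_def sum_distrib_left)
    moreover have "(\<Sum>U\<in>?T. 3 * D U) = 3 * (\<Sum>U\<in>?T. D U)" by (simp only: sum_distrib_left)
    moreover assume "?w3 * (real (card V - 2) * (\<Sum>e\<in>E. d e)) \<le> ?w3 * (\<Sum>U\<in>?T. 3 * D U)"
    ultimately show ?thesis by (simp add: algebra_simps)
  qed
  have "kern E \<rho> (\<lambda>S h. G S) S h = G S + \<rho> * (\<Sum>e\<in>E. d e)"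
    by (simp add: kern_def d_def sum_subtractf algebra_simps)
  also have "\<dots> = G S + (?w2 * (\<Sum>e\<in>E. d e) + real (card V - 2) / 3 * ?w3 * (\<Sum>e\<in>E. d e))"
    by (simp add: \<rho> algebra_simps)
  also have "?w2 * (\<Sum>e\<in>E. d e) = (\<Sum>U\<in>E. w U * D U)"
    using D2 by (simp add: sum_distrib_left w_def E)
  also have "G S + ((\<Sum>U\<in>E. w U * D U) + real (card V - 2) / 3 * ?w3 * (\<Sum>e\<in>E. d e))
    \<le> G S + ((\<Sum>U\<in>E. w U * D U) + (\<Sum>U\<in>?T. w U * D U))" using 3 by simp
  also have "\<dots> = G S + (\<Sum>U\<in>E \<union> ?T. w U * D U)" using fin by (subst sum.union_disjoint) (auto simp: E)
  also have "\<dots> \<le> G S + (\<Sum>U\<in>Pow V. w U * D U)"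
    using V w0 D0 by (intro add_left_mono sum_mono2) (auto simp: E)
  also have "(\<Sum>U\<in>Pow V. w U * D U) = obj V p G S - G S"
  proof -
    have "obj V p G S = expec V (\<lambda>_. p) (\<lambda>U. D U + G S)" by (simp add: obj_def D_def)
    also have "\<dots> = expec V (\<lambda>_. p) D + G S" using V by (simp add: expec_add expec_const)
    finally show ?thesis by (simp add: ew)
  qed
  finally show ?thesis by simp
qed

lemma kern_pow_le_obj_pow:
  assumes V: "finite V" and p: "0 \<le> p" "p \<le> 1" and F: "mono F"
    and E: "E = {e. e \<subseteq> V \<and> card e = 2}"
    and \<rho>: "\<rho> = p\<^sup>2 * (1 - p) ^ (card V - 2) + real (card V - 2) / 3 * (p ^ 3 * (1 - p) ^ (card V - 3))"
    and "real (card E) * \<rho> \<le> 1"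
  shows "(kern E \<rho> ^^ r) (\<lambda>S h. F S) S h \<le> (obj V p ^^ r) F S"
proof (induction r arbitrary: S h)
  case (Suc r)
  have "0 \<le> \<rho>" using p by (simp add: \<rho>)
  then have "kern E \<rho> ((kern E \<rho> ^^ r) (\<lambda>S h. F S)) S h \<le> kern E \<rho> (\<lambda>S h. (obj V p ^^ r) F S) S h"
    using kern_pow_mono[of \<rho> E 0 "(kern E \<rho> ^^ r) (\<lambda>S h. F S)" "\<lambda>S h. (obj V p ^^ r) F S" h 1 S] Suc.IH assms(7) by simp
  also have "\<dots> \<le> obj V p ((obj V p ^^ r) F) S"
    by (rule kern_le_obj[OF V p obj_pow_mono[OF p F] E \<rho>])
  finally show ?case by simp
qed simp

subsection \<open>Random triangles and random copies of K4\<close>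

lemma all_edges_eq: "all_edges n = {e. e \<subseteq> {..<n} \<and> card e = 2}"
  by (auto simp: all_edges_def card_2_iff)

lemma finite_all_edges: "finite (all_edges n)"
  by (rule finite_subset[of _ "Pow {..<n}"]) (auto simp: all_edges_eq)

section \<open>Degrees and codegrees in a random graph\<close>

definition codeg :: "nat \<Rightarrow> nat set set \<Rightarrow> nat \<Rightarrow> nat \<Rightarrow> nat set" where
  "codeg n Z u v = {w. w < n \<and> {u, w} \<in> Z \<and> {v, w} \<in> Z}"

text \<open>On this event the sharing argument is given up. For edge probability z = O(n^(-5/9)) the
  threshold 20 is large enough for the union bound n^22 z^40 to vanish, since 22 - 200/9 < 0. The
  parameter \<open>k\<close> will be about sqrt n: above the typical degree n^(4/9), yet at most
  1/q.\<close>

definition crowded :: "nat \<Rightarrow> nat \<Rightarrow> nat set set \<Rightarrow> bool" where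
  "crowded n k Z \<longleftrightarrow> (\<exists>v<n. k < card {u. u < n \<and> {u, v} \<in> Z}) \<or>
     (\<exists>u<n. \<exists>v<n. u \<noteq> v \<and> 20 \<le> card (codeg n Z u v))"

lemma finite_codeg: "finite (codeg n Z u v)"
  by (simp add: codeg_def)

lemma mono_crowded: "mono (crowded n k)"
proof (intro monoI le_boolI)
  fix Z Z' :: "nat set set" assume Z: "Z \<subseteq> Z'" and c: "crowded n k Z"
  have d: "card {u. u < n \<and> {u, v} \<in> Z} \<le> card {u. u < n \<and> {u, v} \<in> Z'}" for v
    using Z by (intro card_mono) auto
  have c': "card (codeg n Z u v) \<le> card (codeg n Z' u v)" for u v
    using Z by (intro card_mono finite_codeg) (auto simp: codeg_def)
  show "crowded n k Z'" using c less_le_trans[OF _ d] le_trans[OF _ c'] unfolding crowded_def by meson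
qed

text \<open>An exponential Markov inequality with base 2: the degree of \<open>v\<close> is binomial
  over the edges at \<open>v\<close>, and \<open>expec_power_card\<close> evaluates the mean of 2
  raised to it.\<close>

lemma prob_degree:
  assumes "0 \<le> z" "z \<le> 1" "v < n"
  shows "expec (all_edges n) (\<lambda>_. z) (\<lambda>Z. of_bool (k < card {u. u < n \<and> {u, v} \<in> Z})) \<le> (1 + z) ^ n / 2 ^ k"
proof -
  define Ev where "Ev = {e \<in> all_edges n. v \<in> e}"
  have Ev: "Ev \<subseteq> all_edges n" "finite Ev" using finite_all_edges by (auto simp: Ev_def)
  have "Ev \<subseteq> (\<lambda>u. {u, v}) ` {..<n}" by (auto simp: Ev_def all_edges_def)
  then have cEv: "card Ev \<le> n" using surj_card_le[of "{..<n}" Ev "\<lambda>u. {u, v}"] by simp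
  have "expec (all_edges n) (\<lambda>_. z) (\<lambda>Z. of_bool (k < card {u. u < n \<and> {u, v} \<in> Z}))
    \<le> expec (all_edges n) (\<lambda>_. z) (\<lambda>Z. (1 / 2 ^ k) * 2 ^ card (Z \<inter> Ev))"
  proof (rule expec_le)
    fix Z assume Z: "Z \<subseteq> all_edges n"
    show "of_bool (k < card {u. u < n \<and> {u, v} \<in> Z}) \<le> (1 / 2 ^ k) * (2::real) ^ card (Z \<inter> Ev)"
    proof (cases "k < card {u. u < n \<and> {u, v} \<in> Z}")
      case True
      have "card {u. u < n \<and> {u, v} \<in> Z} \<le> card (Z \<inter> Ev)"
        using Z Ev by (intro card_inj_on_le[of "\<lambda>u. {u, v}"]) (auto simp: inj_on_def Ev_def doubleton_eq_iff)
      then have "(2::real) ^ k \<le> 2 ^ card (Z \<inter> Ev)" using True by (intro power_increasing) auto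
      then show ?thesis using True by simp
    qed simp
  qed (use assms in auto)
  also have "\<dots> = (1 / 2 ^ k) * (1 + z) ^ card Ev"
    unfolding expec_cmult using expec_restrict[OF finite_all_edges Ev(1), of "\<lambda>_. z" "\<lambda>S. 2 ^ card S"]
      expec_power_card[OF Ev(2), of z 2] by simp
  also have "\<dots> \<le> (1 / 2 ^ k) * (1 + z) ^ n"
    using assms cEv by (intro mult_left_mono power_increasing) auto
  finally show ?thesis by simp
qed

text \<open>A union bound over copies of the complete bipartite graph with parts of sizes 2 and 20:
  at most n^22 choices of vertices, 40 edges each.\<close>

lemma prob_codegree:
  assumes "0 \<le> z" "z \<le> 1"
  shows "expec (all_edges n) (\<lambda>_. z) (\<lambda>Z. of_bool (\<exists>u<n. \<exists>v<n. u \<noteq> v \<and> 20 \<le> card (codeg n Z u v))) \<le> real n ^ 22 * z ^ 40"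
proof -
  define I where "I = {..<n} \<times> {..<n} \<times> {W. W \<subseteq> {..<n} \<and> card W = 20}"
  define f where "f = (\<lambda>(u, v, W). (\<lambda>w. {u, w}) ` W \<union> (\<lambda>w. {v::nat, w}) ` W)"
  define \<F> where "\<F> = f ` {(u, v, W) \<in> I. u \<noteq> v \<and> u \<notin> W \<and> v \<notin> W}"
  have fI: "finite I" by (auto simp: I_def)
  have cI: "card I \<le> n ^ 22"
  proof -
    have "card {W. W \<subseteq> {..<n} \<and> card W = 20} \<le> n ^ 20"
      using binomial_le_pow[of 20 n] by (cases "20 \<le> n") (auto simp: n_subsets binomial_eq_0)
    then have "n * n * card {W. W \<subseteq> {..<n} \<and> card W = 20} \<le> n * n * n ^ 20" by (rule mult_le_mono2)
    also have "n * n * n ^ 20 = n ^ 22" by (simp add: power_numeral_reduce)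
    finally show ?thesis by (simp add: I_def card_cartesian_product)
  qed
  have c\<F>: "finite \<F>" "card \<F> \<le> n ^ 22"
  proof -
    have sub: "{(u, v, W) \<in> I. u \<noteq> v \<and> u \<notin> W \<and> v \<notin> W} \<subseteq> I" by auto
    then have fin: "finite {(u, v, W) \<in> I. u \<noteq> v \<and> u \<notin> W \<and> v \<notin> W}" using fI by (rule finite_subset)
    show "card \<F> \<le> n ^ 22" unfolding \<F>_def
      using card_image_le[OF fin, of f] card_mono[OF fI sub] cI by linarith
    show "finite \<F>" unfolding \<F>_def using fin by (rule finite_imageI)
  qed
  have B: "B \<subseteq> all_edges n \<and> card B = 40" if "B \<in> \<F>" for B
  proof -
    obtain u v W where uv: "u < n" "v < n" "W \<subseteq> {..<n}" "card W = 20" "u \<noteq> v" "u \<notin> W" "v \<notin> W"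
      and B: "B = (\<lambda>w. {u, w}) ` W \<union> (\<lambda>w. {v, w}) ` W"
    proof -
      obtain t where t: "t \<in> {(u, v, W) \<in> I. u \<noteq> v \<and> u \<notin> W \<and> v \<notin> W}" "B = f t"
        using \<open>B \<in> \<F>\<close> unfolding \<F>_def by (elim imageE)
      obtain u v W where "t = (u, v, W)" by (cases t)
      with t show thesis by (intro that[of u v W]) (auto simp: I_def f_def)
    qed
    have fW: "finite W" using uv(3) finite_subset by auto
    have "card ((\<lambda>w. {u, w}) ` W) = 20" "card ((\<lambda>w. {v, w}) ` W) = 20"
      using uv by (auto simp: card_image inj_on_def doubleton_eq_iff)
    moreover have "(\<lambda>w. {u, w}) ` W \<inter> (\<lambda>w. {v, w}) ` W = {}" using uv by (auto simp: doubleton_eq_iff)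
    ultimately have "card B = 40" unfolding B using fW by (simp add: card_Un_disjoint)
    moreover have "B \<subseteq> all_edges n" unfolding B all_edges_def using uv by blast
    ultimately show ?thesis by simp
  qed
  have "expec (all_edges n) (\<lambda>_. z) (\<lambda>Z. of_bool (\<exists>u<n. \<exists>v<n. u \<noteq> v \<and> 20 \<le> card (codeg n Z u v)))
    \<le> expec (all_edges n) (\<lambda>_. z) (\<lambda>Z. of_bool (\<exists>B\<in>\<F>. B \<subseteq> Z))"
  proof (rule expec_le)
    fix Z assume Z: "Z \<subseteq> all_edges n"
    have "\<exists>B\<in>\<F>. B \<subseteq> Z" if uv: "u < n" "v < n" "u \<noteq> v" "20 \<le> card (codeg n Z u v)" for u v
    proof -
      obtain W where W: "W \<subseteq> codeg n Z u v" "card W = 20" using uv by (meson obtain_subset_with_card_n)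
      have "u \<notin> W" "v \<notin> W" using W(1) Z by (auto simp: codeg_def all_edges_eq)
      then have "(u, v, W) \<in> {(u, v, W) \<in> I. u \<noteq> v \<and> u \<notin> W \<and> v \<notin> W}" using uv W by (auto simp: I_def codeg_def)
      then have "f (u, v, W) \<in> \<F>" unfolding \<F>_def by (rule imageI)
      moreover have "f (u, v, W) \<subseteq> Z" using W(1) by (auto simp: f_def codeg_def)
      ultimately show ?thesis by blast
    qed
    then show "of_bool (\<exists>u<n. \<exists>v<n. u \<noteq> v \<and> 20 \<le> card (codeg n Z u v)) \<le> (of_bool (\<exists>B\<in>\<F>. B \<subseteq> Z) :: real)" by auto
  qed (use assms in auto)
  also have "\<dots> \<le> real (card \<F>) * z ^ 40"
    by (rule expec_exists_le) (use assms c\<F> B finite_all_edges in auto)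
  also have "\<dots> \<le> real (n ^ 22) * z ^ 40"
    using c\<F> assms by (intro mult_right_mono of_nat_mono) auto
  finally show ?thesis by simp
qed

lemma prob_crowded:
  assumes "0 \<le> z" "z \<le> 1"
  shows "expec (all_edges n) (\<lambda>_. z) (\<lambda>Z. of_bool (crowded n k Z)) \<le> real n * ((1 + z) ^ n / 2 ^ k) + real n ^ 22 * z ^ 40"
proof -
  let ?d = "\<lambda>v Z. of_bool (k < card {u. u < n \<and> {u, v} \<in> Z}) :: real"
  let ?c = "\<lambda>Z. of_bool (\<exists>u<n. \<exists>v<n. u \<noteq> v \<and> 20 \<le> card (codeg n Z u v)) :: real"
  have "expec (all_edges n) (\<lambda>_. z) (\<lambda>Z. of_bool (crowded n k Z)) \<le> expec (all_edges n) (\<lambda>_. z) (\<lambda>Z. (\<Sum>v<n. ?d v Z) + ?c Z)"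
  proof (rule expec_le)
    fix Z
    show "of_bool (crowded n k Z) \<le> (\<Sum>v<n. ?d v Z) + ?c Z"
    proof (cases "\<exists>v<n. k < card {u. u < n \<and> {u, v} \<in> Z}")
      case True
      then obtain v where "v < n" "k < card {u. u < n \<and> {u, v} \<in> Z}" by auto
      then have "1 \<le> (\<Sum>v<n. ?d v Z)" using member_le_sum[of v "{..<n}" "\<lambda>v. ?d v Z"] by auto
      then show ?thesis by simp
    next
      case False
      then have "crowded n k Z \<longleftrightarrow> (\<exists>u<n. \<exists>v<n. u \<noteq> v \<and> 20 \<le> card (codeg n Z u v))"
        unfolding crowded_def by blast
      then show ?thesis by (simp add: sum_nonneg)
    qed
  qed (use assms in auto)
  also have "\<dots> \<le> (\<Sum>v<n. (1 + z) ^ n / 2 ^ k) + real n ^ 22 * z ^ 40"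
    unfolding expec_add expec_sum using assms by (intro add_mono sum_mono prob_degree prob_codegree) auto
  finally show ?thesis by simp
qed

section \<open>Counting surviving triangles and copies of K4 over an edge\<close>

definition triples :: "nat \<Rightarrow> (nat \<times> nat \<times> nat) set" where
  "triples n = {(a, b, c). a < b \<and> b < c \<and> c < n}"

definition quads :: "nat \<Rightarrow> (nat \<times> nat \<times> nat \<times> nat) set" where
  "quads n = {(a, b, c, d). a < b \<and> b < c \<and> c < d \<and> d < n}"

lemma finite_triples: "finite (triples n)"
  by (rule finite_subset[of _ "{..<n} \<times> {..<n} \<times> {..<n}"]) (auto simp: triples_def)

lemma finite_quads: "finite (quads n)"
  by (rule finite_subset[of _ "{..<n} \<times> {..<n} \<times> {..<n} \<times> {..<n}"]) (auto simp: quads_def)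

lemma card_le_inj:
  assumes "inj_on f X" "f ` X \<subseteq> Y" "finite Y" "card Y \<le> k"
  shows "card X \<le> k"
  using card_inj_on_le[OF assms(1-3)] assms(4) by linarith

text \<open>By Bernoulli, k B <= 1/2 keeps \<open>(1 - B) ^ k\<close> at least 1/2, so a sharing
  step costs only a factor of 2.\<close>

lemma share_condition:
  assumes "0 \<le> B" "B < 1" "real k * B \<le> 1 / 2" "0 \<le> A" "\<pi> \<le> A * B / 2"
  shows "\<pi> \<le> A * B * (1 - B) ^ k"
proof -
  have "1 / 2 \<le> (1 - B) ^ k" using Bernoulli_inequality[of "-B" k] assms by simp
  then have "A * B * (1 / 2) \<le> A * B * (1 - B) ^ k" using assms by (intro mult_left_mono) auto
  then show ?thesis using assms by simp
qed

text \<open>Reduces the count to edges with two distinct ends below \<open>n\<close>, which is what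
  \<open>crowdedD\<close> needs; over any other \<open>e\<close> there is no hyperedge at
  all.\<close>

lemma card_slot_le:
  assumes "\<And>t. t \<in> X \<Longrightarrow> \<exists>x y. x < y \<and> y < (n::nat) \<and> g t = {x, y}"
    and "\<And>x y. x < y \<Longrightarrow> y < n \<Longrightarrow> card {t \<in> X. g t = {x, y}} \<le> k"
  shows "card {t \<in> X. g t = e} \<le> k"
proof (cases "{t \<in> X. g t = e} = {}")
  case False
  then obtain t where t: "t \<in> X" "g t = e" by auto
  from assms(1)[OF t(1)] obtain x y where "x < y" "y < n" "g t = {x, y}" by auto
  then show ?thesis using assms(2)[of x y] t(2) by simp
next
  case True
  then show ?thesis by (simp only: card.empty zero_le)
qed

lemma crowdedD:
  assumes "\<not> crowded n k Z"
  shows "v < n \<Longrightarrow> card {u. u < n \<and> {u, v} \<in> Z} \<le> k"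
    and "u < n \<Longrightarrow> v < n \<Longrightarrow> u \<noteq> v \<Longrightarrow> card (codeg n Z u v) \<le> 20"
proof -
  show "v < n \<Longrightarrow> card {u. u < n \<and> {u, v} \<in> Z} \<le> k"
    using assms not_le unfolding crowded_def by blast
  show "u < n \<Longrightarrow> v < n \<Longrightarrow> u \<noteq> v \<Longrightarrow> card (codeg n Z u v) \<le> 20"
    using assms nat_le_linear[of "card (codeg n Z u v)" 20] unfolding crowded_def by blast
qed

abbreviation (input) "t_ab \<equiv> \<lambda>(a, b, c). {a, b :: nat}"
abbreviation (input) "t_ac \<equiv> \<lambda>(a, b, c). {a, c :: nat}"
abbreviation (input) "t_bc \<equiv> \<lambda>(a, b, c). {b, c :: nat}"

text \<open>Over ab there are at most n choices of c; over ac with ab exposed, b is a neighbour of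
  a; over bc with both others exposed, a is a common neighbour of b and c. The chain 2 q^3, q^2, q/2
  is chosen so that the shared probability 4 q meets \<open>share_condition\<close> with equality,
  and the last slot costs 20 * q/2 = 10 q.\<close>

lemma triples_admissible:
  assumes q: "0 \<le> q" "real n * q\<^sup>2 \<le> 1 / 2" "real k * q \<le> 1" "18 * q \<le> 1"
  shows "admissible (crowded n k) (\<lambda>_. triples n) (2 * q ^ 3) [(t_ab, 4 * q, q\<^sup>2, n), (t_ac, 4 * q, q / 2, k)] t_bc (10 * q)"
proof -
  have c1: "card {t \<in> triples n. t_ab t = e} \<le> n" for e
    by (rule card_le_inj[of "\<lambda>(a, b, c). c" _ "{..<n}"]) (auto simp: inj_on_def triples_def doubleton_eq_iff)
  have slots: "\<exists>x y. x < y \<and> y < n \<and> t_ac t = {x, y}" "\<exists>x y. x < y \<and> y < n \<and> t_bc t = {x, y}"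
    if "t \<in> triples n" for t
  proof -
    obtain a b c where t: "t = (a, b, c)" "a < b" "b < c" "c < n"
      using \<open>t \<in> triples n\<close> by (auto simp: triples_def)
    show "\<exists>x y. x < y \<and> y < n \<and> t_ac t = {x, y}" using t by (intro exI[of _ a] exI[of _ c]) auto
    show "\<exists>x y. x < y \<and> y < n \<and> t_bc t = {x, y}" using t by (intro exI[of _ b] exI[of _ c]) auto
  qed
  have c2: "card {t \<in> {t \<in> triples n. t_ab t \<in> Z}. t_ac t = e} \<le> k" if Z: "\<not> crowded n k Z" for Z e
  proof (rule card_slot_le)
    show "\<exists>x y. x < y \<and> y < n \<and> t_ac t = {x, y}" if "t \<in> {t \<in> triples n. t_ab t \<in> Z}" for t
      using that by (intro slots(1)) auto
    fix x y :: nat assume e: "x < y" "y < n"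
    show "card {t \<in> {t \<in> triples n. t_ab t \<in> Z}. t_ac t = {x, y}} \<le> k"
    proof (rule card_le_inj[of "\<lambda>(a, b, c). b" _ "{u. u < n \<and> {u, x} \<in> Z}"])
      show "card {u. u < n \<and> {u, x} \<in> Z} \<le> k" using e by (intro crowdedD[OF Z]) auto
    qed (use e in \<open>auto simp: inj_on_def triples_def doubleton_eq_iff insert_commute\<close>)
  qed
  have c3: "card {t \<in> {t \<in> {t \<in> triples n. t_ab t \<in> Z}. t_ac t \<in> Z}. t_bc t = e} \<le> 20" if Z: "\<not> crowded n k Z" for Z e
  proof (rule card_slot_le)
    show "\<exists>x y. x < y \<and> y < n \<and> t_bc t = {x, y}" if "t \<in> {t \<in> {t \<in> triples n. t_ab t \<in> Z}. t_ac t \<in> Z}" for t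
      using that by (intro slots(2)) auto
    fix x y :: nat assume e: "x < y" "y < n"
    show "card {t \<in> {t \<in> {t \<in> triples n. t_ab t \<in> Z}. t_ac t \<in> Z}. t_bc t = {x, y}} \<le> 20"
    proof (rule card_le_inj[of "\<lambda>(a, b, c). a" _ "codeg n Z x y"])
      show "card (codeg n Z x y) \<le> 20" using e by (intro crowdedD[OF Z]) auto
    qed (use e in \<open>auto simp: inj_on_def triples_def doubleton_eq_iff codeg_def insert_commute\<close>)
  qed
  have q1: "q\<^sup>2 < 1" using q by (simp add: power_less_one_iff)
  have "q / 2 * real (card {t \<in> {t \<in> {t \<in> triples n. t_ab t \<in> Z}. t_ac t \<in> Z}. t_bc t = e}) \<le> q / 2 * real 20" if "\<not> crowded n k Z" for Z e
    using q c3[OF that, of e] by (intro mult_left_mono of_nat_mono) auto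
  moreover have "2 * q ^ 3 \<le> 4 * q * q\<^sup>2 * (1 - q\<^sup>2) ^ n"
    using q q1 by (intro share_condition) (auto simp: power_numeral_reduce)
  moreover have "q\<^sup>2 \<le> 4 * q * (q / 2) * (1 - q / 2) ^ k"
    using q by (intro share_condition) (auto simp: power_numeral_reduce)
  ultimately show ?thesis using q q1 c1 c2 by simp
qed

abbreviation (input) "q_ab \<equiv> \<lambda>(a, b, c, d). {a, b :: nat}"
abbreviation (input) "q_ac \<equiv> \<lambda>(a, b, c, d). {a, c :: nat}"
abbreviation (input) "q_ad \<equiv> \<lambda>(a, b, c, d). {a, d :: nat}"
abbreviation (input) "q_bc \<equiv> \<lambda>(a, b, c, d). {b, c :: nat}"
abbreviation (input) "q_bd \<equiv> \<lambda>(a, b, c, d). {b, d :: nat}"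
abbreviation (input) "q_cd \<equiv> \<lambda>(a, b, c, d). {c, d :: nat}"

lemma card_Sigma_le:
  assumes "finite I" "\<And>i. i \<in> I \<Longrightarrow> finite (J i) \<and> card (J i) \<le> k" "card I \<le> l"
  shows "finite (Sigma I J) \<and> card (Sigma I J) \<le> l * k"
proof -
  have "card (Sigma I J) = (\<Sum>i\<in>I. card (J i))" using assms by (intro card_SigmaI) auto
  also have "\<dots> \<le> card I * k" using sum_bounded_above[of I "\<lambda>i. card (J i)" k] assms by simp
  also have "\<dots> \<le> l * k" using assms(3) by (rule mult_le_mono1)
  finally show ?thesis using assms by auto
qed

text \<open>The order ab, ac, bc, ad, bd, cd completes the triangle abc first, so that codegrees
  help from then on: the counts are n^2, n^2, 20 n, 20 n, 400 and 400. Each \<open>B\<close> is the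
  previous probability divided by 2 s, for which a shared probability of 4 s would meet
  \<open>share_condition\<close> exactly. The last slot costs 400 * s/16 = 25 s.\<close>

lemma quads_admissible:
  assumes s: "0 \<le> s" "50 * s \<le> 1" and n: "real (n * n) * s ^ 4 \<le> 1" "real n * s\<^sup>2 \<le> 1 / 5"
  shows "admissible (crowded n k) (\<lambda>_. quads n) (2 * s ^ 6)
    [(q_ab, 5 * s, s ^ 5, n * n), (q_ac, 5 * s, s ^ 4 / 2, n * n), (q_bc, 5 * s, s ^ 3 / 4, 20 * n),
     (q_ad, 5 * s, s\<^sup>2 / 8, n * 20), (q_bd, 5 * s, s / 16, 20 * 20)] q_cd (25 * s)"
proof -
  define X1 where "X1 = (\<lambda>Z. {t \<in> quads n. q_ab t \<in> Z})"
  define X2 where "X2 = (\<lambda>Z. {t \<in> X1 Z. q_ac t \<in> Z})"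
  define X3 where "X3 = (\<lambda>Z. {t \<in> X2 Z. q_bc t \<in> Z})"
  define X4 where "X4 = (\<lambda>Z. {t \<in> X3 Z. q_ad t \<in> Z})"
  define X5 where "X5 = (\<lambda>Z. {t \<in> X4 Z. q_bd t \<in> Z})"
  note X = X5_def X4_def X3_def X2_def X1_def quads_def
  have c1: "card {t \<in> quads n. q_ab t = e} \<le> n * n" for e
    by (rule card_le_inj[of "\<lambda>(a, b, c, d). (c, d)" _ "{..<n} \<times> {..<n}"]) (auto simp: inj_on_def quads_def doubleton_eq_iff)
  have c2: "card {t \<in> X1 Z. q_ac t = e} \<le> n * n" for Z e
    by (rule card_le_inj[of "\<lambda>(a, b, c, d). (b, d)" _ "{..<n} \<times> {..<n}"]) (auto simp: inj_on_def X doubleton_eq_iff)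
  have slots: "\<exists>x y. x < y \<and> y < n \<and> q_bc t = {x, y}" "\<exists>x y. x < y \<and> y < n \<and> q_ad t = {x, y}"
    "\<exists>x y. x < y \<and> y < n \<and> q_bd t = {x, y}" "\<exists>x y. x < y \<and> y < n \<and> q_cd t = {x, y}"
    if "t \<in> quads n" for t
  proof -
    obtain a b c d where t: "t = (a, b, c, d)" "a < b" "b < c" "c < d" "d < n"
      using \<open>t \<in> quads n\<close> by (auto simp: quads_def)
    show "\<exists>x y. x < y \<and> y < n \<and> q_bc t = {x, y}" using t by (intro exI[of _ b] exI[of _ c]) auto
    show "\<exists>x y. x < y \<and> y < n \<and> q_ad t = {x, y}" using t by (intro exI[of _ a] exI[of _ d]) auto
    show "\<exists>x y. x < y \<and> y < n \<and> q_bd t = {x, y}" using t by (intro exI[of _ b] exI[of _ d]) auto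
    show "\<exists>x y. x < y \<and> y < n \<and> q_cd t = {x, y}" using t by (intro exI[of _ c] exI[of _ d]) auto
  qed
  have sub: "X1 Z \<subseteq> quads n" "X2 Z \<subseteq> quads n" "X3 Z \<subseteq> quads n" "X4 Z \<subseteq> quads n" "X5 Z \<subseteq> quads n" for Z
    by (auto simp: X5_def X4_def X3_def X2_def X1_def)
  have c3: "card {t \<in> X2 Z. q_bc t = e} \<le> 20 * n" if Z: "\<not> crowded n k Z" for Z e
  proof (rule card_slot_le)
    show "\<exists>x y. x < y \<and> y < n \<and> q_bc t = {x, y}" if "t \<in> X2 Z" for t
      using that sub(2)[of Z] by (intro slots(1)) auto
    fix x y :: nat assume e: "x < y" "y < n"
    have Y: "finite (Sigma (codeg n Z x y) (\<lambda>_. {..<n})) \<and> card (Sigma (codeg n Z x y) (\<lambda>_. {..<n})) \<le> 20 * n"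
      using e by (intro card_Sigma_le crowdedD(2)[OF Z] finite_codeg) auto
    show "card {t \<in> X2 Z. q_bc t = {x, y}} \<le> 20 * n"
    proof (rule card_le_inj[of "\<lambda>(a, b, c, d). (a, d)" _ "Sigma (codeg n Z x y) (\<lambda>_. {..<n})"])
      show "inj_on (\<lambda>(a, b, c, d). (a, d)) {t \<in> X2 Z. q_bc t = {x, y}}"
        using e by (auto simp: inj_on_def X doubleton_eq_iff)
      show "(\<lambda>(a, b, c, d). (a, d)) ` {t \<in> X2 Z. q_bc t = {x, y}} \<subseteq> Sigma (codeg n Z x y) (\<lambda>_. {..<n})"
        using e by (auto simp: X doubleton_eq_iff codeg_def insert_commute)
    qed (use Y in auto)
  qed
  have c4: "card {t \<in> X3 Z. q_ad t = e} \<le> n * 20" if Z: "\<not> crowded n k Z" for Z e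
  proof (rule card_slot_le)
    show "\<exists>x y. x < y \<and> y < n \<and> q_ad t = {x, y}" if "t \<in> X3 Z" for t
      using that sub(3)[of Z] by (intro slots(2)) auto
    fix x y :: nat assume e: "x < y" "y < n"
    \<comment> \<open>Here a is \<open>x\<close>. The codegree bound speaks of distinct vertices, so
      b = \<open>x\<close> is excluded; since a < b, nothing is lost.\<close>
    let ?Y = "Sigma ({..<n} - {x}) (\<lambda>b. codeg n Z x b)"
    have Y: "finite ?Y \<and> card ?Y \<le> n * 20"
      using e card_Diff1_le[of "{..<n}" x] by (intro card_Sigma_le conjI crowdedD(2)[OF Z] finite_codeg) auto
    show "card {t \<in> X3 Z. q_ad t = {x, y}} \<le> n * 20"
    proof (rule card_le_inj[of "\<lambda>(a, b, c, d). (b, c)" _ ?Y])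
      show "inj_on (\<lambda>(a, b, c, d). (b, c)) {t \<in> X3 Z. q_ad t = {x, y}}"
        using e by (auto simp: inj_on_def X doubleton_eq_iff)
      show "(\<lambda>(a, b, c, d). (b, c)) ` {t \<in> X3 Z. q_ad t = {x, y}} \<subseteq> ?Y"
        using e by (auto simp: X doubleton_eq_iff codeg_def insert_commute)
    qed (use Y in auto)
  qed
  have c5: "card {t \<in> X4 Z. q_bd t = e} \<le> 20 * 20" if Z: "\<not> crowded n k Z" for Z e
  proof (rule card_slot_le)
    show "\<exists>x y. x < y \<and> y < n \<and> q_bd t = {x, y}" if "t \<in> X4 Z" for t
      using that sub(4)[of Z] by (intro slots(3)) auto
    fix x y :: nat assume e: "x < y" "y < n"
    \<comment> \<open>With b = \<open>x\<close> and d = \<open>y\<close>: the vertex a is a common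
      neighbour of b and d, and then c is one of a and b.\<close>
    let ?Y = "Sigma (codeg n Z x y - {x}) (\<lambda>a. codeg n Z x a)"
    have "card (codeg n Z x y - {x}) \<le> 20"
      using crowdedD(2)[OF Z, of x y] e card_Diff1_le[of "codeg n Z x y" x] by simp
    then have Y: "finite ?Y \<and> card ?Y \<le> 20 * 20"
      using e finite_codeg by (intro card_Sigma_le conjI crowdedD(2)[OF Z]) (auto simp: codeg_def)
    show "card {t \<in> X4 Z. q_bd t = {x, y}} \<le> 20 * 20"
    proof (rule card_le_inj[of "\<lambda>(a, b, c, d). (a, c)" _ ?Y])
      show "inj_on (\<lambda>(a, b, c, d). (a, c)) {t \<in> X4 Z. q_bd t = {x, y}}"
        using e by (auto simp: inj_on_def X doubleton_eq_iff)
      show "(\<lambda>(a, b, c, d). (a, c)) ` {t \<in> X4 Z. q_bd t = {x, y}} \<subseteq> ?Y"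
        using e by (auto simp: X doubleton_eq_iff codeg_def insert_commute)
    qed (use Y in auto)
  qed
  have c6: "card {t \<in> X5 Z. q_cd t = e} \<le> 20 * 20" if Z: "\<not> crowded n k Z" for Z e
  proof (rule card_slot_le)
    show "\<exists>x y. x < y \<and> y < n \<and> q_cd t = {x, y}" if "t \<in> X5 Z" for t
      using that sub(5)[of Z] by (intro slots(4)) auto
    fix x y :: nat assume e: "x < y" "y < n"
    let ?Y = "Sigma (codeg n Z x y) (\<lambda>_. codeg n Z x y)"
    have Y: "finite ?Y \<and> card ?Y \<le> 20 * 20"
      using e by (intro card_Sigma_le conjI crowdedD(2)[OF Z] finite_codeg) auto
    show "card {t \<in> X5 Z. q_cd t = {x, y}} \<le> 20 * 20"
    proof (rule card_le_inj[of "\<lambda>(a, b, c, d). (a, b)" _ ?Y])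
      show "inj_on (\<lambda>(a, b, c, d). (a, b)) {t \<in> X5 Z. q_cd t = {x, y}}"
        using e by (auto simp: inj_on_def X doubleton_eq_iff)
      show "(\<lambda>(a, b, c, d). (a, b)) ` {t \<in> X5 Z. q_cd t = {x, y}} \<subseteq> ?Y"
        using e by (auto simp: X doubleton_eq_iff codeg_def insert_commute)
    qed (use Y in auto)
  qed
  have s1: "s < 1" "s \<le> 1 / 50" using s by auto
  have pw: "s ^ j < 1" "s ^ j \<le> 1" if "0 < j" for j
    using s s1 that power_less_one_iff[of s j] power_le_one[of s j] by auto
  have nn: "real (n * n) * s ^ 5 \<le> 1 / 2"
    using mult_mono[OF n(1) s1(2)] s by (simp add: power_numeral_reduce mult_ac)
  have n3: "real n * s ^ 3 \<le> 1 / 40"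
    using mult_mono[OF n(2) s1(2)] s n by (simp add: power_numeral_reduce mult_ac)
  have "s / 16 * real (card {t \<in> X5 Z. q_cd t = e}) \<le> s / 16 * real (20 * 20)" if "\<not> crowded n k Z" for Z e
    using s c6[OF that, of e] by (intro mult_left_mono of_nat_mono) auto
  then have f6: "s / 16 * real (card {t \<in> X5 Z. q_cd t = e}) \<le> 25 * s" if "\<not> crowded n k Z" for Z e
    using that by fastforce
  have f1: "2 * s ^ 6 \<le> 5 * s * s ^ 5 * (1 - s ^ 5) ^ (n * n)"
    using s nn pw[of 5] by (intro share_condition) (auto simp: power_numeral_reduce mult_ac)
  have f2: "s ^ 5 \<le> 5 * s * (s ^ 4 / 2) * (1 - s ^ 4 / 2) ^ (n * n)"
    using s n pw[of 4] by (intro share_condition) (auto simp: power_numeral_reduce mult_ac)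
  have f3: "s ^ 4 / 2 \<le> 5 * s * (s ^ 3 / 4) * (1 - s ^ 3 / 4) ^ (20 * n)"
    using s n3 pw[of 3] by (intro share_condition) (auto simp: power_numeral_reduce mult_ac)
  have f4: "s ^ 3 / 4 \<le> 5 * s * (s\<^sup>2 / 8) * (1 - s\<^sup>2 / 8) ^ (n * 20)"
    using s n pw[of 2] by (intro share_condition) (auto simp: power_numeral_reduce mult_ac)
  have f5: "s\<^sup>2 / 8 \<le> 5 * s * (s / 16) * (1 - s / 16) ^ (20 * 20)"
    using s by (intro share_condition) (auto simp: power_numeral_reduce mult_ac)
  have lt: "s ^ 5 < 1" "s ^ 4 / 2 < 1" "s ^ 3 / 4 < 1" "s\<^sup>2 / 8 < 1" "s / 16 < 1"
    using pw(1)[of 5] pw(1)[of 4] pw(1)[of 3] pw(1)[of 2] s1 by auto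
  have "admissible (crowded n k) X5 (s / 16) [] q_cd (25 * s)"
    unfolding admissible.simps using f6 by blast
  then have "admissible (crowded n k) X4 (s\<^sup>2 / 8) [(q_bd, 5 * s, s / 16, 20 * 20)] q_cd (25 * s)"
    unfolding admissible.simps(2) X5_def[symmetric] using f5 lt(5) c5 s(1) by (intro conjI allI impI) auto
  then have "admissible (crowded n k) X3 (s ^ 3 / 4) [(q_ad, 5 * s, s\<^sup>2 / 8, n * 20), (q_bd, 5 * s, s / 16, 20 * 20)] q_cd (25 * s)"
    unfolding admissible.simps(2)[of _ X3] X4_def[symmetric] using f4 lt(4) c4 s(1) by (intro conjI allI impI) simp_all
  then have "admissible (crowded n k) X2 (s ^ 4 / 2) [(q_bc, 5 * s, s ^ 3 / 4, 20 * n), (q_ad, 5 * s, s\<^sup>2 / 8, n * 20), (q_bd, 5 * s, s / 16, 20 * 20)] q_cd (25 * s)"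
    unfolding admissible.simps(2)[of _ X2] X3_def[symmetric] using f3 lt(3) c3 s(1) by (intro conjI allI impI) simp_all
  then have "admissible (crowded n k) X1 (s ^ 5) [(q_ac, 5 * s, s ^ 4 / 2, n * n), (q_bc, 5 * s, s ^ 3 / 4, 20 * n), (q_ad, 5 * s, s\<^sup>2 / 8, n * 20), (q_bd, 5 * s, s / 16, 20 * 20)] q_cd (25 * s)"
    unfolding admissible.simps(2)[of _ X1] X2_def[symmetric] using f2 lt(2) c2 s(1) by (intro conjI allI impI) simp_all
  then show ?thesis
    unfolding admissible.simps(2)[of _ "\<lambda>_. quads n"] X1_def[symmetric] using f1 lt(1) c1 s(1) by (intro conjI allI impI) simp_all
qed

text \<open>Sharing needs a first, second and third edge of every hyperedge, so vertex sets are
  encoded as increasing tuples; sorting provides the bijection.\<close>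

lemma triples_image:
  "(\<lambda>(a, b, c). {a, b, c}) ` triples n = {e. e \<subseteq> {..<n} \<and> card e = 3}"
  "inj_on (\<lambda>(a, b, c). {a, b, c}) (triples n)"
proof -
  show "(\<lambda>(a, b, c). {a, b, c}) ` triples n = {e. e \<subseteq> {..<n} \<and> card e = 3}"
  proof (intro equalityI subsetI)
    fix e assume e: "e \<in> {e. e \<subseteq> {..<n} \<and> card e = 3}"
    then have fe: "finite e" using finite_subset by auto
    then have "length (sorted_list_of_set e) = Suc (Suc (Suc 0))" using e by simp
    then obtain a b c where l: "sorted_list_of_set e = [a, b, c]" unfolding length_Suc_conv by auto
    have "sorted_wrt (<) (sorted_list_of_set e)" by simp
    then have "a < b" "b < c" unfolding l by auto
    moreover have s: "e = {a, b, c}" using set_sorted_list_of_set[OF fe] unfolding l by simp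
    ultimately have "(a, b, c) \<in> triples n" using e by (auto simp: triples_def)
    then show "e \<in> (\<lambda>(a, b, c). {a, b, c}) ` triples n" using s by (intro image_eqI[of _ _ "(a, b, c)"]) auto
  qed (auto simp: triples_def)
  show "inj_on (\<lambda>(a, b, c). {a, b, c}) (triples n)"
  proof (rule inj_onI)
    fix t t' assume t: "t \<in> triples n" "t' \<in> triples n" "(\<lambda>(a, b, c). {a, b, c}) t = (\<lambda>(a, b, c). {a, b, c}) t'"
    obtain a b c a' b' c' where tt: "t = (a, b, c)" "t' = (a', b', c')" by (metis prod_cases3)
    have "[a, b, c] = [a', b', c']" using t by (intro sorted_distinct_set_unique) (auto simp: tt triples_def)
    then show "t = t'" by (simp add: tt)
  qed
qed

lemma quads_image:
  "(\<lambda>(a, b, c, d). {a, b, c, d}) ` quads n = {e. e \<subseteq> {..<n} \<and> card e = 4}"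
  "inj_on (\<lambda>(a, b, c, d). {a, b, c, d}) (quads n)"
proof -
  show "(\<lambda>(a, b, c, d). {a, b, c, d}) ` quads n = {e. e \<subseteq> {..<n} \<and> card e = 4}"
  proof (intro equalityI subsetI)
    fix e assume e: "e \<in> {e. e \<subseteq> {..<n} \<and> card e = 4}"
    then have fe: "finite e" using finite_subset by auto
    then have "length (sorted_list_of_set e) = Suc (Suc (Suc (Suc 0)))" using e by simp
    then obtain a b c d where l: "sorted_list_of_set e = [a, b, c, d]" unfolding length_Suc_conv by auto
    have "sorted_wrt (<) (sorted_list_of_set e)" by simp
    then have "a < b" "b < c" "c < d" unfolding l by auto
    moreover have s: "e = {a, b, c, d}" using set_sorted_list_of_set[OF fe] unfolding l by simp
    ultimately have "(a, b, c, d) \<in> quads n" using e by (auto simp: quads_def)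
    then show "e \<in> (\<lambda>(a, b, c, d). {a, b, c, d}) ` quads n" using s by (intro image_eqI[of _ _ "(a, b, c, d)"]) auto
  qed (auto simp: quads_def)
  show "inj_on (\<lambda>(a, b, c, d). {a, b, c, d}) (quads n)"
  proof (rule inj_onI)
    fix t t' assume t: "t \<in> quads n" "t' \<in> quads n" "(\<lambda>(a, b, c, d). {a, b, c, d}) t = (\<lambda>(a, b, c, d). {a, b, c, d}) t'"
    obtain a b c d a' b' c' d' where tt: "t = (a, b, c, d)" "t' = (a', b', c', d')" by (metis prod_cases4)
    have "[a, b, c, d] = [a', b', c', d']" using t by (intro sorted_distinct_set_unique) (auto simp: tt quads_def)
    then show "t = t'" by (simp add: tt)
  qed
qed

lemma clique_insert: "clique (insert x U) = clique U \<union> (\<lambda>y. {x, y}) ` (U - {x})"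
proof (intro equalityI subsetI)
  fix e assume "e \<in> clique (insert x U)"
  then obtain u v where e: "u \<in> insert x U" "v \<in> insert x U" "u \<noteq> v" "e = {u, v}" by (auto simp: clique_def)
  consider "u = x" | "v = x" | "u \<noteq> x" "v \<noteq> x" by auto
  then show "e \<in> clique U \<union> (\<lambda>y. {x, y}) ` (U - {x})"
  proof cases
    case 1 with e show ?thesis by (intro UnI2 image_eqI[of _ _ v]) auto
  next
    case 2 with e show ?thesis by (intro UnI2 image_eqI[of _ _ u]) auto
  next
    case 3 with e show ?thesis unfolding clique_def by blast
  qed
next
  fix e assume "e \<in> clique U \<union> (\<lambda>y. {x, y}) ` (U - {x})"
  then show "e \<in> clique (insert x U)"
  proof
    assume "e \<in> (\<lambda>y. {x, y}) ` (U - {x})"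
    then obtain y where "y \<in> U" "y \<noteq> x" "e = {x, y}" by auto
    then show ?thesis unfolding clique_def by blast
  qed (use clique_le[of U "insert x U"] in auto)
qed

lemma clique_triple:
  assumes "t \<in> triples n"
  shows "clique ((\<lambda>(a, b, c). {a, b, c}) t) = {t_ab t, t_ac t, t_bc t}"
proof -
  obtain a b c where t: "t = (a, b, c)" "a < b" "b < c" using assms by (auto simp: triples_def)
  then show ?thesis by (auto simp: clique_insert clique_small insert_Diff_if)
qed

lemma clique_quad:
  assumes "t \<in> quads n"
  shows "clique ((\<lambda>(a, b, c, d). {a, b, c, d}) t) = {q_ab t, q_ac t, q_ad t, q_bc t, q_bd t, q_cd t}"
proof -
  obtain a b c d where t: "t = (a, b, c, d)" "a < b" "b < c" "c < d" using assms by (auto simp: quads_def)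
  then show ?thesis by (auto simp: clique_insert clique_small insert_Diff_if)
qed

lemma Union_three: "(\<Union>t\<in>S. {f t, g t, h t}) = f ` S \<union> g ` S \<union> h ` S"
  by auto

lemma Union_six:
  "(\<Union>t\<in>S. {f t, g t, h t, f' t, g' t, h' t}) = f ` S \<union> g ` S \<union> h ` S \<union> f' ` S \<union> g' ` S \<union> h' ` S"
  by auto

section \<open>Covering random triangles and copies of K4 by random edges\<close>

lemma triples_cover:
  assumes q: "0 \<le> q" "real n * q\<^sup>2 \<le> 1 / 2" "real k * q \<le> 1" "18 * q \<le> 1"
    and F: "mono F" "\<And>S. 0 \<le> F S" "\<And>S. F S \<le> 1"
  shows "expec {e. e \<subseteq> {..<n} \<and> card e = 3} (\<lambda>_. 2 * q ^ 3) (\<lambda>R. F (\<Union>(clique ` R)))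
    \<le> expec (all_edges n) (\<lambda>_. 18 * q) (\<lambda>X. F X + of_bool (crowded n k X))"
proof -
  let ?st = "[(t_ab, 4 * q, q\<^sup>2, n), (t_ac, 4 * q, q / 2, k)]"
  have "expec {e. e \<subseteq> {..<n} \<and> card e = 3} (\<lambda>_. 2 * q ^ 3) (\<lambda>R. F (\<Union>(clique ` R)))
    = expec (triples n) (\<lambda>_. 2 * q ^ 3) (\<lambda>S. F ({} \<union> (\<Union>h\<in>insert t_bc (fst ` set ?st). h ` S)))"
    unfolding triples_image(1)[symmetric] expec_image[OF finite_triples triples_image(2)]
  proof (intro expec_cong refl)
    fix S assume S: "S \<subseteq> triples n"
    have "\<Union>(clique ` ((\<lambda>(a, b, c). {a, b, c}) ` S)) = (\<Union>t\<in>S. {t_ab t, t_ac t, t_bc t})"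
      unfolding image_image by (rule SUP_cong[OF refl clique_triple]) (use S in auto)
    also have "\<dots> = {} \<union> (\<Union>h\<in>insert t_bc (fst ` set ?st). h ` S)"
      unfolding Union_three by (simp add: Un_ac)
    finally show "F (\<Union>(clique ` ((\<lambda>(a, b, c). {a, b, c}) ` S))) = F ({} \<union> (\<Union>h\<in>insert t_bc (fst ` set ?st). h ` S))"
      by (rule arg_cong)
  qed
  also have "\<dots> \<le> expec (all_edges n) (\<lambda>_. 10 * q + sum_list (map (\<lambda>x. fst (snd x)) ?st)) (\<lambda>X. F ({} \<union> X) + of_bool (crowded n k ({} \<union> X)))"
  proof (rule expec_cover[OF triples_admissible[OF q] finite_all_edges F mono_crowded])
    show "2 * q ^ 3 \<le> 1" using power_mono[of q "1 / 2" 3] q by (simp add: power_divide)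
    show "h ` triples n \<subseteq> all_edges n" if "h \<in> insert t_bc (fst ` set ?st)" for h
      using that by (auto simp: triples_def all_edges_def) (metis less_trans less_irrefl)+
  qed (use q finite_triples in \<open>auto simp: mono_def\<close>)
  finally show ?thesis by simp
qed

lemma quads_cover:
  assumes s: "0 \<le> s" "50 * s \<le> 1" and n: "real (n * n) * s ^ 4 \<le> 1" "real n * s\<^sup>2 \<le> 1 / 5"
    and F: "mono F" "\<And>S. 0 \<le> F S" "\<And>S. F S \<le> 1"
  shows "expec {e. e \<subseteq> {..<n} \<and> card e = 4} (\<lambda>_. 2 * s ^ 6) (\<lambda>R. F (\<Union>(clique ` R)))
    \<le> expec (all_edges n) (\<lambda>_. 50 * s) (\<lambda>X. F X + of_bool (crowded n k X))"
proof -
  let ?st = "[(q_ab, 5 * s, s ^ 5, n * n), (q_ac, 5 * s, s ^ 4 / 2, n * n), (q_bc, 5 * s, s ^ 3 / 4, 20 * n),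
     (q_ad, 5 * s, s\<^sup>2 / 8, n * 20), (q_bd, 5 * s, s / 16, 20 * 20)]"
  have "expec {e. e \<subseteq> {..<n} \<and> card e = 4} (\<lambda>_. 2 * s ^ 6) (\<lambda>R. F (\<Union>(clique ` R)))
    = expec (quads n) (\<lambda>_. 2 * s ^ 6) (\<lambda>S. F ({} \<union> (\<Union>h\<in>insert q_cd (fst ` set ?st). h ` S)))"
    unfolding quads_image(1)[symmetric] expec_image[OF finite_quads quads_image(2)]
  proof (intro expec_cong refl)
    fix S assume S: "S \<subseteq> quads n"
    have "\<Union>(clique ` ((\<lambda>(a, b, c, d). {a, b, c, d}) ` S)) = (\<Union>t\<in>S. {q_ab t, q_ac t, q_ad t, q_bc t, q_bd t, q_cd t})"
      unfolding image_image by (rule SUP_cong[OF refl clique_quad]) (use S in auto)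
    also have "\<dots> = {} \<union> (\<Union>h\<in>insert q_cd (fst ` set ?st). h ` S)"
      unfolding Union_six by (simp add: Un_ac)
    finally show "F (\<Union>(clique ` ((\<lambda>(a, b, c, d). {a, b, c, d}) ` S))) = F ({} \<union> (\<Union>h\<in>insert q_cd (fst ` set ?st). h ` S))"
      by (rule arg_cong)
  qed
  also have "\<dots> \<le> expec (all_edges n) (\<lambda>_. 25 * s + sum_list (map (\<lambda>x. fst (snd x)) ?st)) (\<lambda>X. F ({} \<union> X) + of_bool (crowded n k ({} \<union> X)))"
  proof (rule expec_cover[OF quads_admissible[OF s n] finite_all_edges F mono_crowded])
    show "2 * s ^ 6 \<le> 1" using power_mono[of s "1 / 2" 6] s by (simp add: power_divide)
    show "h ` quads n \<subseteq> all_edges n" if "h \<in> insert q_cd (fst ` set ?st)" for h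
    proof
      fix e assume "e \<in> h ` quads n"
      then obtain a b c d where t: "a < b" "b < c" "c < d" "d < n" "e = h (a, b, c, d)" by (auto simp: quads_def)
      have "card e = 2 \<and> e \<subseteq> {..<n}" using that t by auto
      then show "e \<in> all_edges n" by (simp add: all_edges_eq)
    qed
  qed (use s finite_quads in \<open>auto simp: mono_def\<close>)
  finally show ?thesis by simp
qed

subsection \<open>Bounds for fixed parameters\<close>

lemma card_all_edges: "card (all_edges n) = n * (n - 1) div 2"
  unfolding all_edges_eq using n_subsets[of "{..<n}" 2] by (simp add: choose_two)

lemma card_all_edges_le: "2 * card (all_edges n) \<le> n * n"
  unfolding card_all_edges
  using div_times_less_eq_dividend[of "n * (n - 1)" 2] mult_le_mono2[of "n - 1" n n] by linarith

lemma prob_Gnp_eq: "prob_Gnp n p A = expec (all_edges n) (\<lambda>_. clamp01 p) (\<lambda>S. of_bool (S \<in> A))"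
proof -
  have "finite (Pow (all_edges n))" using finite_all_edges by simp
  then show ?thesis
    unfolding prob_Gnp_def expec_uniform[OF finite_all_edges] sum.inter_restrict[OF \<open>finite (Pow (all_edges n))\<close>]
    by (intro sum.cong refl) simp
qed

lemma obj_pow_ge:
  assumes "finite V" "0 \<le> p" "p \<le> 1" "mono F"
  shows "F S \<le> (obj V p ^^ m) F S"
proof (induction m)
  case (Suc m)
  have "(obj V p ^^ m) F S \<le> obj V p ((obj V p ^^ m) F) S"
    unfolding obj_def[of V p "(obj V p ^^ m) F" S]
    using assms by (intro expec_ge_const monoD[OF obj_pow_mono]) auto
  with Suc show ?case by simp
qed simp

lemma one_minus_power_ge: "0 \<le> p \<Longrightarrow> p \<le> 1 \<Longrightarrow> j \<le> n \<Longrightarrow> 1 - real n * p \<le> (1 - p) ^ j" for p :: real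
  using one_minus_power_le[of p j] mult_right_mono[of "real j" "real n" p] by simp

text \<open>Two-element vertex sets hit a given pair at rate \<open>\<rho>\<close>, which is all the
  target requires from \<open>m\<close> objects; three-element sets add \<open>\<delta>\<close>. The
  exposure may therefore use up a fraction \<open>\<delta> / (\<rho> + \<delta>)\<close> of the
  objects, of order n p, whereas the mean fraction used is only of order (n p)^2.\<close>

lemma lower_bound:
  fixes p :: real and n m :: nat
  assumes p: "0 \<le> p" "p \<le> 1" and n: "3 \<le> n" and np: "real n * p \<le> 1 / 2"
    and F: "mono F" "\<And>S. 0 \<le> F S" "\<And>S. F S \<le> 1"
  shows "expec (all_edges n) (\<lambda>_. 1 - exp (- real m * p\<^sup>2 * (1 - p) ^ (n - 2))) F
    \<le> (obj {..<n} p ^^ m) F {} + 36 * (real n * p)"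
proof (cases "p = 0 \<or> m = 0")
  \<comment> \<open>The target is the empty graph here. The other case divides by
    \<open>\<delta>\<close> and cancels \<open>m\<close>, so both must be positive there.\<close>
  case True
  have "expec (all_edges n) (\<lambda>_. 0) F = F {}"
    using expec_image_eq[of "{}" "all_edges n" "\<lambda>_. undefined" 0 F] finite_all_edges by simp
  moreover have eq: "1 - exp (- real m * p\<^sup>2 * (1 - p) ^ (n - 2)) = 0" using True by auto
  moreover have "0 \<le> 36 * (real n * p)" using p by simp
  moreover have "F {} \<le> (obj {..<n} p ^^ m) F {}" using p F by (intro obj_pow_ge) auto
  ultimately show ?thesis unfolding eq by linarith
next
  case False
  then have p0: "0 < p" and m0: "0 < m" using p by auto
  define \<rho> where "\<rho> = p\<^sup>2 * (1 - p) ^ (n - 2)"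
  define \<delta> where "\<delta> = real (n - 2) / 3 * (p ^ 3 * (1 - p) ^ (n - 3))"
  let ?N = "real (card (all_edges n))"
  have pn: "p < 1" "p \<le> 1 / 6" using np n mult_right_mono[of 3 "real n" p] p by auto
  have \<rho>: "0 < \<rho>" "\<rho> \<le> p\<^sup>2" unfolding \<rho>_def
    using p0 pn power_le_one[of "1 - p" "n - 2"] mult_left_mono[of "(1 - p) ^ (n - 2)" 1 "p\<^sup>2"] by auto
  have n2: "real n / 3 \<le> real (n - 2)" using n by (simp add: of_nat_diff)
  have half: "1 / 2 \<le> (1 - p) ^ (n - 3)" using one_minus_power_ge[of p "n - 3" n] p np by simp
  have "real n * p ^ 3 / 18 = real n / 3 / 3 * (p ^ 3 * (1 / 2))" by simp
  also have "\<dots> \<le> \<delta>" unfolding \<delta>_def using n2 half p by (intro mult_mono divide_right_mono mult_left_mono) auto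
  finally have \<delta>l: "real n * p ^ 3 / 18 \<le> \<delta>" .
  have np3: "0 < real n * p ^ 3" using n p0 by simp
  have "\<delta> \<le> real n / 3 * (p ^ 3 * 1)" unfolding \<delta>_def
    using p by (intro mult_mono divide_right_mono mult_left_mono power_le_one) auto
  also have "\<dots> = (real n * p) / 3 * p\<^sup>2" by (simp add: power_numeral_reduce)
  also have "\<dots> \<le> 1 * p\<^sup>2" using np by (intro mult_right_mono) auto
  finally have \<delta>u: "\<delta> \<le> p\<^sup>2" by simp
  have N: "?N \<le> (real n)\<^sup>2 / 2" "1 \<le> ?N"
  proof -
    have "real (2 * card (all_edges n)) \<le> real (n * n)" using card_all_edges_le by (rule of_nat_mono)
    then show "?N \<le> (real n)\<^sup>2 / 2" by (simp add: power2_eq_square)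
    have "2 * 1 \<le> n * (n - 1)" using n by (intro mult_le_mono) auto
    then show "1 \<le> ?N" unfolding card_all_edges using div_le_mono[of 2 "n * (n - 1)" 2] by simp
  qed
  have sum2: "\<rho> + \<delta> \<le> 2 * p\<^sup>2" using \<rho> \<delta>u by simp
  have \<delta>0: "0 < \<delta>" using \<delta>l np3 by linarith
  have "?N * (\<rho> + \<delta>) \<le> (real n)\<^sup>2 / 2 * (2 * p\<^sup>2)" using N sum2 \<rho> \<delta>0 by (intro mult_mono) auto
  also have "\<dots> = (real n * p)\<^sup>2" by (simp add: power_mult_distrib)
  also have "\<dots> \<le> (1 / 2)\<^sup>2" using np p by (intro power_mono) auto
  finally have N1: "?N * (\<rho> + \<delta>) < 1" by (simp add: power2_eq_square)
  have "1 * (\<rho> + \<delta>) \<le> ?N * (\<rho> + \<delta>)" using N(2) \<rho> \<delta>0 by (intro mult_right_mono) linarith+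
  from le_less_trans[OF this N1] have le1: "\<rho> + \<delta> \<le> 1" by simp
  define x where "x = real m * \<rho> / (\<rho> + \<delta>)"
  have xm: "real m - x = real m * \<delta> / (\<rho> + \<delta>)" using \<rho> \<delta>0 by (simp add: x_def field_simps)
  have "0 < real m * \<delta> / (\<rho> + \<delta>)" using \<rho> \<delta>0 m0 by simp
  then have xm0: "x < real m" using xm by linarith
  have exp: "- real m * p\<^sup>2 * (1 - p) ^ (n - 2) = - (real m * \<rho>)" by (simp add: \<rho>_def)
  have "expec (all_edges n) (\<lambda>_. 1 - exp (- (real m * \<rho>))) F
    \<le> (kern (all_edges n) (\<rho> + \<delta>) ^^ m) (\<lambda>S h. F S) {} 0 + real m * ?N * (\<rho> + \<delta>) / (real m - x)"
  proof (rule expec_le_kern_pow_count)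
    fix r :: nat assume r: "x \<le> real r"
    have "1 - (\<rho> + \<delta>) \<le> exp (- (\<rho> + \<delta>))" using exp_ge_add_one_self[of "- (\<rho> + \<delta>)"] by linarith
    then have "(1 - (\<rho> + \<delta>)) ^ r \<le> exp (- (\<rho> + \<delta>)) ^ r" using le1 by (intro power_mono) auto
    also have "\<dots> = exp (- (real r * (\<rho> + \<delta>)))" by (simp only: exp_of_nat_mult[symmetric] mult_minus_right)
    also have "\<dots> \<le> exp (- (real m * \<rho>))" using r \<rho> \<delta>0 by (simp add: x_def divide_le_eq)
    finally show "(1 - (\<rho> + \<delta>)) ^ r \<le> 1 - (1 - exp (- (real m * \<rho>)))" by simp
  qed (use finite_all_edges F \<rho> \<delta>0 N1 xm0 in auto)
  also have "(kern (all_edges n) (\<rho> + \<delta>) ^^ m) (\<lambda>S h. F S) {} 0 \<le> (obj {..<n} p ^^ m) F {}"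
    by (rule kern_pow_le_obj_pow) (use p F N1 in \<open>auto simp: all_edges_eq \<rho>_def \<delta>_def\<close>)
  also have "real m * ?N * (\<rho> + \<delta>) / (real m - x) = ?N * (\<rho> + \<delta>)\<^sup>2 / \<delta>"
    unfolding xm using m0 \<rho> \<delta>0 by (simp add: field_simps power2_eq_square)
  \<comment> \<open>At most n^2/2 pairs, the square of 2 p^2 and the lower bound n p^3/18 for
    \<open>\<delta>\<close> combine to 36 n p.\<close>
  also have "\<dots> \<le> ((real n)\<^sup>2 / 2 * (2 * p\<^sup>2)\<^sup>2) / (real n * p ^ 3 / 18)"
    using N sum2 \<rho> \<delta>0 \<delta>l np3 by (intro frac_le mult_mono power_mono) auto
  also have "\<dots> = 36 * (real n * p)" using n p0 by (simp add: field_simps power_numeral_reduce)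
  finally show ?thesis unfolding exp by simp
qed

text \<open>With c = \<open>\<rho> / (1 - Q)\<close> the argument rests on 1 - c >= exp (- c / (1 -
  c)). The quotient c / (1 - c) equals \<open>\<rho> / (1 - Q - \<rho>)\<close> and is at most
  \<open>\<rho> * (1 + 4 * Q)\<close>; the excess in the exponent is then taken out linearly. So
  \<open>4 * Q\<close> absorbs both the normalisation by \<open>1 - Q\<close> and the second-order
  loss.\<close>

lemma pair_prob_le:
  fixes \<rho> Q :: real
  assumes "0 \<le> \<rho>" "\<rho> \<le> Q" "Q \<le> 1 / 8"
  shows "1 - (1 - \<rho> / (1 - Q)) ^ m \<le> 1 - exp (- (real m * \<rho>)) + 4 * Q * (real m * \<rho>)"
proof -
  define c where "c = \<rho> / (1 - Q)"
  have Q: "0 < 1 - 2 * Q" "0 < 1 - Q" "0 \<le> Q" using assms by auto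
  have c0: "0 \<le> c" using assms by (simp add: c_def)
  have c1: "1 - c = (1 - Q - \<rho>) / (1 - Q)" using Q by (simp add: c_def field_simps)
  then have cp: "0 < 1 - c" using assms by simp
  have "c / (1 - c) = \<rho> / (1 - Q - \<rho>)" unfolding c1 using Q by (simp add: c_def)
  also have "\<dots> \<le> \<rho> / (1 - 2 * Q)" using assms Q by (intro divide_left_mono mult_pos_pos) auto
  also have "\<dots> \<le> \<rho> * (1 + 4 * Q)"
  proof -
    have "4 * Q * (2 * Q) \<le> 4 * Q * (1 / 2)" using assms Q by (intro mult_left_mono) auto
    then have "1 \<le> (1 + 4 * Q) * (1 - 2 * Q)" by (simp add: algebra_simps)
    then have "\<rho> * 1 \<le> \<rho> * ((1 + 4 * Q) * (1 - 2 * Q))" using assms by (intro mult_left_mono) auto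
    then show ?thesis using Q by (simp add: pos_divide_le_eq mult_ac)
  qed
  finally have cc: "c / (1 - c) \<le> \<rho> * (1 + 4 * Q)" .
  have "1 / (1 - c) = 1 + c / (1 - c)" using cp by (simp add: field_simps)
  also have "\<dots> \<le> exp (c / (1 - c))" by (rule exp_ge_add_one_self)
  also have "\<dots> \<le> exp (\<rho> * (1 + 4 * Q))" using cc by simp
  finally have "1 \<le> exp (\<rho> * (1 + 4 * Q)) * (1 - c)" using cp by (simp only: pos_divide_le_eq)
  then have "exp (- (\<rho> * (1 + 4 * Q))) * 1 \<le> exp (- (\<rho> * (1 + 4 * Q))) * (exp (\<rho> * (1 + 4 * Q)) * (1 - c))"
    by (intro mult_left_mono) auto
  also have "\<dots> = (exp (- (\<rho> * (1 + 4 * Q))) * exp (\<rho> * (1 + 4 * Q))) * (1 - c)" by (rule mult.assoc[symmetric])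
  also have "exp (- (\<rho> * (1 + 4 * Q))) * exp (\<rho> * (1 + 4 * Q)) = 1" by (rule exp_minus_inverse[of "- (\<rho> * (1 + 4 * Q))", simplified minus_minus])
  finally have "exp (- (\<rho> * (1 + 4 * Q))) \<le> 1 - c" by simp
  then have "exp (- (\<rho> * (1 + 4 * Q))) ^ m \<le> (1 - c) ^ m" by (intro power_mono) auto
  also have "exp (- (\<rho> * (1 + 4 * Q))) ^ m = exp (- (real m * \<rho>)) * exp (- (4 * Q * (real m * \<rho>)))"
    by (simp add: exp_of_nat_mult[symmetric] exp_add[symmetric] algebra_simps)
  finally have "exp (- (real m * \<rho>)) * exp (- (4 * Q * (real m * \<rho>))) \<le> (1 - c) ^ m" .
  moreover have "exp (- (real m * \<rho>)) * (1 - 4 * Q * (real m * \<rho>)) \<le> exp (- (real m * \<rho>)) * exp (- (4 * Q * (real m * \<rho>)))"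
    using exp_ge_add_one_self[of "- (4 * Q * (real m * \<rho>))"] by (intro mult_left_mono) auto
  moreover have "exp (- (real m * \<rho>)) * (4 * Q * (real m * \<rho>)) \<le> 1 * (4 * Q * (real m * \<rho>))"
    using assms Q by (intro mult_right_mono) auto
  ultimately show ?thesis unfolding c_def[symmetric] by (simp add: algebra_simps)
qed

text \<open>Here \<open>\<tau> j\<close> plays the probability that a given j-element set occurs
  among the independent vertex sets, and \<open>y\<close> is a bound for single pairs. With the
  pairs held fixed, the triangles are covered by edges of probability \<open>18 * q\<close>, and the
  two random edge sets merge.\<close>

lemma pairs_triples_cover:
  assumes q: "0 \<le> q" "real n * q\<^sup>2 \<le> 1 / 2" "real k * q \<le> 1" "18 * q \<le> 1"
    and F: "mono F" "\<And>S. 0 \<le> F S" "\<And>S. F S \<le> 1"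
    and \<tau>: "0 \<le> \<tau> 2" "\<tau> 2 \<le> 1" "\<tau> 2 \<le> y" "min 1 (y + 18 * q) \<le> z" "z \<le> 1" "0 \<le> \<tau> 3" "\<tau> (3::nat) \<le> 2 * q ^ 3"
  shows "expec {e. e \<subseteq> {..<n} \<and> 2 \<le> card e \<and> card e \<le> 3} (\<lambda>e. \<tau> (card e)) (\<lambda>R. F (\<Union>(clique ` R)))
    \<le> expec (all_edges n) (\<lambda>_. z) F + expec (all_edges n) (\<lambda>_. 18 * q) (\<lambda>X. of_bool (crowded n k X))"
proof -
  let ?E = "all_edges n" and ?T = "{e. e \<subseteq> {..<n} \<and> card e = 3}"
  have fT: "finite ?T" by (rule finite_subset[of _ "Pow {..<n}"]) auto
  have q3: "2 * q ^ 3 \<le> 1" using power_mono[of q "1 / 2" 3] q by (simp add: power_divide)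
  have split: "{e. e \<subseteq> {..<n} \<and> 2 \<le> card e \<and> card e \<le> 3} = ?E \<union> ?T"
    unfolding all_edges_eq by (auto simp: le_Suc_eq numeral_eq_Suc)
  have "expec (?E \<union> ?T) (\<lambda>e. \<tau> (card e)) (\<lambda>R. F (\<Union>(clique ` R)))
    = expec ?E (\<lambda>e. \<tau> (card e)) (\<lambda>R. expec ?T (\<lambda>e. \<tau> (card e)) (\<lambda>R'. F (\<Union>(clique ` (R \<union> R')))))"
    by (rule expec_union_disjoint) (use fT finite_all_edges in \<open>auto simp: all_edges_eq\<close>)
  also have "\<dots> = expec ?E (\<lambda>_. \<tau> 2) (\<lambda>R. expec ?T (\<lambda>_. \<tau> 3) (\<lambda>R'. F (R \<union> \<Union>(clique ` R'))))"
  proof (rule expec_cong)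
    fix R assume R: "R \<subseteq> ?E"
    have "clique e = {e}" if "e \<in> R" for e using that R by (intro clique_edge) (auto simp: all_edges_eq)
    then have "\<Union>(clique ` R) = R" by auto
    then show "expec ?T (\<lambda>e. \<tau> (card e)) (\<lambda>R'. F (\<Union>(clique ` (R \<union> R'))))
      = expec ?T (\<lambda>_. \<tau> 3) (\<lambda>R'. F (R \<union> \<Union>(clique ` R')))"
      by (intro expec_cong) (auto simp: image_Un)
  qed (auto simp: all_edges_eq)
  also have "\<dots> \<le> expec ?E (\<lambda>_. \<tau> 2) (\<lambda>R. expec ?E (\<lambda>_. 18 * q) (\<lambda>X. F (R \<union> X)) + expec ?E (\<lambda>_. 18 * q) (\<lambda>X. of_bool (crowded n k X)))"
  proof (rule expec_le)
    fix R
    have m: "mono (\<lambda>X. F (R \<union> X))" by (intro monoI monoD[OF F(1)]) auto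
    have "expec ?T (\<lambda>_. \<tau> 3) (\<lambda>R'. F (R \<union> \<Union>(clique ` R'))) \<le> expec ?T (\<lambda>_. 2 * q ^ 3) (\<lambda>R'. F (R \<union> \<Union>(clique ` R')))"
      by (rule expec_mono_prob[OF fT]) (use \<tau> q3 in \<open>auto intro!: monoI monoD[OF F(1)]\<close>)
    also have "\<dots> \<le> expec ?E (\<lambda>_. 18 * q) (\<lambda>X. F (R \<union> X) + of_bool (crowded n k X))"
      by (rule triples_cover[OF q m]) (use F in auto)
    finally show "expec ?T (\<lambda>_. \<tau> 3) (\<lambda>R'. F (R \<union> \<Union>(clique ` R')))
      \<le> expec ?E (\<lambda>_. 18 * q) (\<lambda>X. F (R \<union> X)) + expec ?E (\<lambda>_. 18 * q) (\<lambda>X. of_bool (crowded n k X))"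
      by (simp add: expec_add)
  qed (use \<tau> q in auto)
  also have "\<dots> = expec ?E (\<lambda>_. 1 - (1 - \<tau> 2) * (1 - 18 * q)) F + expec ?E (\<lambda>_. 18 * q) (\<lambda>X. of_bool (crowded n k X))"
    unfolding expec_add by (simp add: expec_const finite_all_edges expec_union)
  also have "expec ?E (\<lambda>_. 1 - (1 - \<tau> 2) * (1 - 18 * q)) F \<le> expec ?E (\<lambda>_. z) F"
  proof (rule expec_mono_prob[OF finite_all_edges F(1)])
    \<comment> \<open>The merged probability is at most \<open>\<tau> 2 + 18 * q\<close> and also at
      most 1; the minimum in the hypothesis on \<open>z\<close> reflects this and matches the
      truncation by \<open>clamp01\<close>.\<close>
    have "0 \<le> \<tau> 2 * (18 * q)" "0 \<le> (1 - \<tau> 2) * (1 - 18 * q)" "0 \<le> (1 - \<tau> 2) * (18 * q)"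
      using \<tau> q by (intro mult_nonneg_nonneg; simp)+
    moreover have "1 - (1 - \<tau> 2) * (1 - 18 * q) = \<tau> 2 + 18 * q - \<tau> 2 * (18 * q)"
      "\<tau> 2 + 18 * q - \<tau> 2 * (18 * q) = \<tau> 2 + (1 - \<tau> 2) * (18 * q)"
      by (simp_all add: algebra_simps)
    ultimately show "0 \<le> 1 - (1 - \<tau> 2) * (1 - 18 * q) \<and> 1 - (1 - \<tau> 2) * (1 - 18 * q) \<le> z \<and> z \<le> 1"
      using \<tau> by linarith
  qed
  finally show ?thesis unfolding split by simp
qed

lemma pairs_triples_quads_cover:
  assumes q: "0 \<le> q" "real n * q\<^sup>2 \<le> 1 / 2" "real k * q \<le> 1" "18 * q \<le> 1"
    and s: "0 \<le> s" "50 * s \<le> 1" and n: "real (n * n) * s ^ 4 \<le> 1" "real n * s\<^sup>2 \<le> 1 / 5"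
    and F: "mono F" "\<And>S. 0 \<le> F S" "\<And>S. F S \<le> 1"
    and \<tau>: "0 \<le> \<tau> 2" "\<tau> 2 \<le> 1" "\<tau> 2 \<le> y" "min 1 (y + 18 * q + 50 * s) \<le> z" "z \<le> 1"
      "0 \<le> \<tau> 3" "\<tau> (3::nat) \<le> 2 * q ^ 3" "0 \<le> \<tau> 4" "\<tau> 4 \<le> 2 * s ^ 6"
  shows "expec {e. e \<subseteq> {..<n} \<and> 2 \<le> card e \<and> card e \<le> 4} (\<lambda>e. \<tau> (card e)) (\<lambda>R. F (\<Union>(clique ` R)))
    \<le> expec (all_edges n) (\<lambda>_. z) F + expec (all_edges n) (\<lambda>_. 18 * q) (\<lambda>X. of_bool (crowded n k X))
      + expec (all_edges n) (\<lambda>_. 50 * s) (\<lambda>X. of_bool (crowded n k X))"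
proof -
  let ?E = "all_edges n" and ?T = "{e. e \<subseteq> {..<n} \<and> card e = 4}" and ?T3 = "{e. e \<subseteq> {..<n} \<and> 2 \<le> card e \<and> card e \<le> 3}"
  define z3 where "z3 = min 1 (y + 18 * q)"
  define B3 where "B3 = expec ?E (\<lambda>_. 18 * q) (\<lambda>X. of_bool (crowded n k X))"
  define B4 where "B4 = expec ?E (\<lambda>_. 50 * s) (\<lambda>X. of_bool (crowded n k X))"
  have z3: "0 \<le> z3" "z3 \<le> 1" using \<tau> q by (auto simp: z3_def)
  have fT: "finite ?T" "finite ?T3" by (rule finite_subset[of _ "Pow {..<n}"]; auto)+
  have s6: "2 * s ^ 6 \<le> 1" using power_mono[of s "1 / 2" 6] s by (simp add: power_divide)
  have split: "{e. e \<subseteq> {..<n} \<and> 2 \<le> card e \<and> card e \<le> 4} = ?T \<union> ?T3"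
    by (auto simp: le_Suc_eq numeral_eq_Suc)
  have "expec (?T \<union> ?T3) (\<lambda>e. \<tau> (card e)) (\<lambda>R. F (\<Union>(clique ` R)))
    = expec ?T (\<lambda>e. \<tau> (card e)) (\<lambda>R'. expec ?T3 (\<lambda>e. \<tau> (card e)) (\<lambda>R. F (\<Union>(clique ` (R' \<union> R)))))"
    by (rule expec_union_disjoint) (use fT in auto)
  also have "\<dots> = expec ?T (\<lambda>_. \<tau> 4) (\<lambda>R'. expec ?T3 (\<lambda>e. \<tau> (card e)) (\<lambda>R. F (\<Union>(clique ` R') \<union> \<Union>(clique ` R))))"
    by (intro expec_cong) (auto simp: image_Un)
  also have "\<dots> \<le> expec ?T (\<lambda>_. \<tau> 4) (\<lambda>R'. expec ?E (\<lambda>_. z3) (\<lambda>X. F (\<Union>(clique ` R') \<union> X)) + B3)"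
    unfolding B3_def
  proof (intro expec_le pairs_triples_cover[OF q])
    show "mono (\<lambda>X. F (\<Union>(clique ` R') \<union> X))" for R' by (intro monoI monoD[OF F(1)]) auto
    show "min 1 (y + 18 * q) \<le> z3" by (simp add: z3_def)
  qed (use \<tau> z3 F s6 in auto)
  \<comment> \<open>After the swap the edges \<open>X\<close> that replace pairs and triangles are
    held fixed while the copies of K4 are covered.\<close>
  also have "\<dots> = expec ?E (\<lambda>_. z3) (\<lambda>X. expec ?T (\<lambda>_. \<tau> 4) (\<lambda>R'. F (\<Union>(clique ` R') \<union> X))) + B3"
    unfolding expec_add by (subst expec_swap) (simp add: expec_const fT)
  also have "expec ?E (\<lambda>_. z3) (\<lambda>X. expec ?T (\<lambda>_. \<tau> 4) (\<lambda>R'. F (\<Union>(clique ` R') \<union> X)))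
    \<le> expec ?E (\<lambda>_. z3) (\<lambda>X. expec ?E (\<lambda>_. 50 * s) (\<lambda>Y. F (X \<union> Y)) + B4)"
  proof (rule expec_le)
    fix X
    have m: "mono (\<lambda>Y. F (Y \<union> X))" by (intro monoI monoD[OF F(1)]) auto
    have "expec ?T (\<lambda>_. \<tau> 4) (\<lambda>R'. F (\<Union>(clique ` R') \<union> X)) \<le> expec ?T (\<lambda>_. 2 * s ^ 6) (\<lambda>R'. F (\<Union>(clique ` R') \<union> X))"
      by (rule expec_mono_prob[OF fT(1)]) (use \<tau> s6 in \<open>auto intro!: monoI monoD[OF F(1)]\<close>)
    also have "\<dots> \<le> expec ?E (\<lambda>_. 50 * s) (\<lambda>Y. F (Y \<union> X) + of_bool (crowded n k Y))"
      by (rule quads_cover[OF s n m]) (use F in auto)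
    finally show "expec ?T (\<lambda>_. \<tau> 4) (\<lambda>R'. F (\<Union>(clique ` R') \<union> X))
      \<le> expec ?E (\<lambda>_. 50 * s) (\<lambda>Y. F (X \<union> Y)) + B4"
      by (simp add: expec_add B4_def Un_commute)
  qed (use z3 in auto)
  also have "\<dots> = expec ?E (\<lambda>_. 1 - (1 - z3) * (1 - 50 * s)) F + B4"
    unfolding expec_add by (simp add: expec_const finite_all_edges expec_union)
  also have "expec ?E (\<lambda>_. 1 - (1 - z3) * (1 - 50 * s)) F \<le> expec ?E (\<lambda>_. z) F"
  proof (rule expec_mono_prob[OF finite_all_edges F(1)])
    have "0 \<le> z3 * (50 * s)" "0 \<le> (1 - z3) * (1 - 50 * s)" "0 \<le> (1 - z3) * (50 * s)"
      using z3 s by (intro mult_nonneg_nonneg; simp)+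
    moreover have "1 - (1 - z3) * (1 - 50 * s) = z3 + 50 * s - z3 * (50 * s)"
      "z3 + 50 * s - z3 * (50 * s) = z3 + (1 - z3) * (50 * s)"
      by (simp_all add: algebra_simps)
    moreover have "min 1 (z3 + 50 * s) \<le> z" using \<tau> s by (auto simp: z3_def min_def split: if_splits)
    ultimately show "0 \<le> 1 - (1 - z3) * (1 - 50 * s) \<and> 1 - (1 - z3) * (1 - 50 * s) \<le> z \<and> z \<le> 1"
      using \<tau> z3 by linarith
  qed
  finally show ?thesis unfolding split by (simp add: B3_def B4_def)
qed

text \<open>The first bound discards vertex sets of size 4 at the price m (n p)^4; the second keeps
  them and discards sizes from 5 on. Through \<open>slack\<close> one further \<open>q\<close>
  absorbs the error of \<open>pair_prob_le\<close>, which turns 18 q into 19 q.\<close>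

lemma upper_bound:
  fixes p :: real and n m k :: nat
  defines "q \<equiv> root 3 (real m * p ^ 3)" and "s \<equiv> root 6 (real m * p ^ 4)"
    and "pm \<equiv> 1 - exp (- real m * p\<^sup>2 * (1 - p) ^ (n - 2))"
  assumes p: "0 \<le> p" "p \<le> 1" and n0: "1 \<le> n" and Q: "(real n * p)\<^sup>2 \<le> 1 / 8"
    and slack: "4 * (real n * p)\<^sup>2 * (real m * p\<^sup>2) \<le> q"
    and q: "real n * q\<^sup>2 \<le> 1 / 2" "real k * q \<le> 1" "18 * q \<le> 1"
    and F: "mono F" "\<And>S. 0 \<le> F S" "\<And>S. F S \<le> 1"
  shows "min 1 (pm + 19 * q) \<le> z \<Longrightarrow> z \<le> 1 \<Longrightarrow>
      (obj {..<n} p ^^ m) F {} \<le> expec (all_edges n) (\<lambda>_. z) F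
        + expec (all_edges n) (\<lambda>_. 18 * q) (\<lambda>X. of_bool (crowded n k X)) + real m * (real n * p) ^ 4"
    and "min 1 (pm + 19 * q + 50 * s) \<le> z \<Longrightarrow> z \<le> 1 \<Longrightarrow> 50 * s \<le> 1 \<Longrightarrow> real (n * n) * s ^ 4 \<le> 1 \<Longrightarrow> real n * s\<^sup>2 \<le> 1 / 5 \<Longrightarrow>
      (obj {..<n} p ^^ m) F {} \<le> expec (all_edges n) (\<lambda>_. z) F
        + expec (all_edges n) (\<lambda>_. 18 * q) (\<lambda>X. of_bool (crowded n k X))
        + expec (all_edges n) (\<lambda>_. 50 * s) (\<lambda>X. of_bool (crowded n k X)) + real m * (real n * p) ^ 5"
proof -
  define g where "g j = p ^ j * (1 - p) ^ (n - j) / (1 - (real n * p)\<^sup>2)" for j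
  define \<tau> where "\<tau> j = 1 - (1 - g j) ^ m" for j
  let ?Ty = "\<lambda>\<kappa>. {e. e \<subseteq> {..<n} \<and> 2 \<le> card e \<and> card e \<le> (\<kappa>::nat)}"
  have q0: "0 \<le> q" and s0: "0 \<le> s" using p by (auto simp: q_def s_def real_root_ge_zero)
  have q3: "q ^ 3 = real m * p ^ 3" and s6: "s ^ 6 = real m * p ^ 4"
    unfolding q_def s_def using p by (auto intro!: real_root_pow_pos2)
  have "p \<le> real n * p" using n0 p mult_right_mono[of 1 "real n" p] by simp
  then have p2: "p\<^sup>2 \<le> (real n * p)\<^sup>2" using p by (intro power_mono) auto
  have g0: "0 \<le> g j" for j using p Q by (simp add: g_def)
  \<comment> \<open>The factor 2 bounds 1 / (1 - (n p)^2); it is the origin of the 2 in 2 q^3 and 2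
    s^6.\<close>
  have gp: "g j \<le> 2 * p ^ j" for j
  proof -
    have "p ^ j * (1 - p) ^ (n - j) \<le> p ^ j * 1" using p by (intro mult_left_mono power_le_one) auto
    moreover have "p ^ j * 1 \<le> p ^ j * (2 * (1 - (real n * p)\<^sup>2))" using p Q by (intro mult_left_mono) auto
    ultimately show ?thesis using Q by (simp add: g_def divide_le_eq algebra_simps)
  qed
  have g1: "g j \<le> 1" if "2 \<le> j" for j
  proof -
    have "p ^ j \<le> p\<^sup>2" using that p by (intro power_decreasing) auto
    then show ?thesis using gp[of j] p2 Q by linarith
  qed
  have \<tau>01: "0 \<le> \<tau> j" "\<tau> j \<le> 1" if "2 \<le> j" for j
    using g0[of j] g1[OF that] power_le_one[of "1 - g j" m] by (auto simp: \<tau>_def)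
  have \<tau>u: "\<tau> j \<le> 2 * (real m * p ^ j)" if "2 \<le> j" for j
  proof -
    have "\<tau> j \<le> real m * g j" unfolding \<tau>_def using g0 g1[OF that] by (intro one_minus_power_le)
    also have "\<dots> \<le> real m * (2 * p ^ j)" using gp by (intro mult_left_mono) auto
    finally show ?thesis by simp
  qed
  have \<tau>2: "\<tau> 2 \<le> pm + q"
  proof -
    let ?\<rho> = "p\<^sup>2 * (1 - p) ^ (n - 2)"
    have r: "0 \<le> ?\<rho>" "?\<rho> \<le> p\<^sup>2"
      using p mult_left_mono[OF power_le_one[of "1 - p" "n - 2"], of "p\<^sup>2"] by auto
    have "\<tau> 2 \<le> 1 - exp (- (real m * ?\<rho>)) + 4 * (real n * p)\<^sup>2 * (real m * ?\<rho>)"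
      unfolding \<tau>_def g_def using r p2 Q by (intro pair_prob_le) auto
    also have "\<dots> \<le> 1 - exp (- (real m * ?\<rho>)) + 4 * (real n * p)\<^sup>2 * (real m * p\<^sup>2)"
      using r by (intro add_left_mono mult_left_mono) auto
    also have "\<dots> \<le> pm + q" using slack by (simp add: pm_def mult_ac)
    finally show ?thesis .
  qed
  have main: "(obj {..<n} p ^^ m) F {} \<le> expec (?Ty \<kappa>) (\<lambda>e. \<tau> (card e)) (\<lambda>R. F (\<Union>(clique ` R))) + real m * (real n * p) ^ Suc \<kappa>" for \<kappa>
  proof -
    have fTy: "finite (?Ty \<kappa>)" by (rule finite_subset[of _ "Pow {..<n}"]) auto
    have "(obj {..<n} p ^^ m) F {} \<le> expec (?Ty \<kappa>) (\<lambda>e. 1 - (1 - g (card e)) ^ m) (\<lambda>R. F ({} \<union> \<Union>(clique ` R))) + real m * (real n * p) ^ Suc \<kappa>"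
    proof (rule obj_pow_le)
      fix F' :: "nat set set \<Rightarrow> real" and S
      assume F': "mono F'" "\<And>S. 0 \<le> F' S" "\<And>S. F' S \<le> 1"
      have "obj {..<n} p F' S \<le> expec (?Ty \<kappa>) (\<lambda>e. g (card e)) (\<lambda>R. F' (S \<union> \<Union>(clique ` R))) + (real (card {..<n}) * p) ^ Suc \<kappa>"
        by (rule obj_le) (use p Q F' g1 in \<open>auto simp: g_def\<close>)
      then show "obj {..<n} p F' S \<le> expec (?Ty \<kappa>) (\<lambda>e. g (card e)) (\<lambda>R. F' (S \<union> \<Union>(clique ` R))) + (real n * p) ^ Suc \<kappa>" by simp
    qed (use p F g0 g1 fTy in auto)
    then show ?thesis by (simp add: \<tau>_def)
  qed
  have q': "\<tau> 3 \<le> 2 * q ^ 3" "\<tau> 4 \<le> 2 * s ^ 6" unfolding q3 s6 using \<tau>u[of 3] \<tau>u[of 4] by auto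
  show "(obj {..<n} p ^^ m) F {} \<le> expec (all_edges n) (\<lambda>_. z) F
        + expec (all_edges n) (\<lambda>_. 18 * q) (\<lambda>X. of_bool (crowded n k X)) + real m * (real n * p) ^ 4"
    if "min 1 (pm + 19 * q) \<le> z" "z \<le> 1"
  proof -
    have "min 1 (pm + q + 18 * q) \<le> z" using that(1) by simp
    from main[of 3] pairs_triples_cover[OF q0 q F \<tau>01[of 2] \<tau>2 this that(2) \<tau>01(1)[of 3] q'(1)] show ?thesis by simp
  qed
  show "(obj {..<n} p ^^ m) F {} \<le> expec (all_edges n) (\<lambda>_. z) F
        + expec (all_edges n) (\<lambda>_. 18 * q) (\<lambda>X. of_bool (crowded n k X))
        + expec (all_edges n) (\<lambda>_. 50 * s) (\<lambda>X. of_bool (crowded n k X)) + real m * (real n * p) ^ 5"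
    if "min 1 (pm + 19 * q + 50 * s) \<le> z" "z \<le> 1" "50 * s \<le> 1" "real (n * n) * s ^ 4 \<le> 1" "real n * s\<^sup>2 \<le> 1 / 5"
  proof -
    have "min 1 (pm + q + 18 * q + 50 * s) \<le> z" using that(1) by simp
    from main[of 4] pairs_triples_quads_cover[OF q0 q s0 that(3-5) F \<tau>01[of 2] \<tau>2 this that(2) \<tau>01(1)[of 3] q'(1) \<tau>01(1)[of 4] q'(2)]
    show ?thesis by simp
  qed
qed

text \<open>The intersection graph never exceeds the complete graph, and G(n, z) is complete with
  probability at least 1 - n^2 (1 - z).\<close>

lemma complete_bound:
  assumes F: "mono F" "\<And>S. 0 \<le> F S" "\<And>S. F S \<le> 1" and p: "0 \<le> p" "p \<le> 1"
    and z: "0 \<le> z" "z \<le> 1"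
  shows "(obj {..<n} p ^^ m) F {} \<le> expec (all_edges n) (\<lambda>_. z) F + real n ^ 2 * (1 - z)"
proof -
  let ?E = "all_edges n"
  have cl: "clique U \<subseteq> ?E" if "U \<subseteq> {..<n}" for U using that by (auto simp: clique_def all_edges_def)
  have "(obj {..<n} p ^^ r) F S \<le> F ?E" if "S \<subseteq> ?E" for r S
    using that
  proof (induction r arbitrary: S)
    case (Suc r)
    have "obj {..<n} p ((obj {..<n} p ^^ r) F) S \<le> F ?E"
      unfolding obj_def[of "{..<n}" p "(obj {..<n} p ^^ r) F" S]
      using p Suc.prems cl by (intro expec_le_const Suc.IH) auto
    then show ?case by simp
  qed (auto intro: monoD[OF F(1)])
  then have 1: "(obj {..<n} p ^^ m) F {} \<le> F ?E" by simp
  have "z ^ card ?E * F ?E = expec ?E (\<lambda>_. z) (\<lambda>S. F ?E * of_bool (?E \<subseteq> S))"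
    unfolding expec_cmult by (simp add: expec_all_in finite_all_edges)
  also have "\<dots> \<le> expec ?E (\<lambda>_. z) F"
    using F z by (intro expec_le) (auto simp: of_bool_def dest: subset_antisym)
  finally have 2: "z ^ card ?E * F ?E \<le> expec ?E (\<lambda>_. z) F" .
  have "1 - z ^ card ?E \<le> real (card ?E) * (1 - z)"
    using one_minus_power_le[of "1 - z" "card ?E"] z by simp
  also have "real (card ?E) * (1 - z) \<le> real (n ^ 2) * (1 - z)"
  proof (intro mult_right_mono of_nat_mono)
    show "card ?E \<le> n ^ 2" using card_all_edges_le[of n] by (simp add: power2_eq_square)
  qed (use z in auto)
  finally have 3: "1 - z ^ card ?E \<le> real n ^ 2 * (1 - z)" by simp
  have "(1 - z ^ card ?E) * F ?E \<le> (1 - z ^ card ?E) * 1"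
    using F z power_le_one[of z "card ?E"] by (intro mult_left_mono) auto
  with 1 2 3 show ?thesis by (simp add: algebra_simps)
qed

subsection \<open>Asymptotics\<close>

text \<open>This is \<open>prob_crowded\<close> for z = 50 n^(-5/9), a common bound for 18 q and 50
  s, and \<open>k\<close> the floor of sqrt n. It vanishes because n z is of order n^(4/9), below
  sqrt n, and because 22 - 40 * 5/9 < 0.\<close>

definition crowded_err :: "nat \<Rightarrow> real" where
  "crowded_err n = real n * (exp (50 * real n powr (4 / 9)) / 2 powr (sqrt (real n) - 1))
     + real n ^ 22 * (50 * real n powr (- 5 / 9)) ^ 40"

lemma crowded_err_tendsto: "crowded_err \<longlonglongrightarrow> 0"
  unfolding crowded_err_def by real_asymp

lemma prob_crowded_le_err:
  assumes "0 \<le> z" "z \<le> 1" "z \<le> 50 * real n powr (- 5 / 9)" "1 \<le> n"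
  shows "expec (all_edges n) (\<lambda>_. z) (\<lambda>Z. of_bool (crowded n (nat \<lfloor>sqrt (real n)\<rfloor>) Z)) \<le> crowded_err n"
proof -
  let ?k = "nat \<lfloor>sqrt (real n)\<rfloor>"
  have "(1 + z) ^ n \<le> exp z ^ n" using exp_ge_add_one_self[of z] assms by (intro power_mono) auto
  also have "\<dots> = exp (real n * z)" by (simp add: exp_of_nat_mult)
  also have "\<dots> \<le> exp (50 * real n powr (4 / 9))"
  proof -
    have "real n * z \<le> real n * (50 * real n powr (- 5 / 9))" using assms by (intro mult_left_mono) auto
    also have "\<dots> = 50 * (real n powr 1 * real n powr (- 5 / 9))" using assms by simp
    also have "\<dots> = 50 * real n powr (4 / 9)" unfolding powr_add[symmetric] by simp
    finally show ?thesis by simp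
  qed
  finally have 1: "(1 + z) ^ n \<le> exp (50 * real n powr (4 / 9))" .
  have "sqrt (real n) - 1 \<le> real ?k" by linarith
  then have "2 powr (sqrt (real n) - 1) \<le> (2::real) powr real ?k" by (intro powr_mono) auto
  also have "2 powr real ?k = 2 ^ ?k" by (rule powr_realpow) simp
  finally have 2: "2 powr (sqrt (real n) - 1) \<le> 2 ^ ?k" .
  have "expec (all_edges n) (\<lambda>_. z) (\<lambda>Z. of_bool (crowded n ?k Z)) \<le> real n * ((1 + z) ^ n / 2 ^ ?k) + real n ^ 22 * z ^ 40"
    by (rule prob_crowded) (use assms in auto)
  also have "\<dots> \<le> crowded_err n" unfolding crowded_err_def
    using 1 2 assms by (intro add_mono mult_left_mono frac_le power_mono) auto
  finally show ?thesis .
qed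

lemma power_powr_eq: "0 < x \<Longrightarrow> (x powr a) ^ j = x powr (real j * a)"
  by (simp add: powr_power mult.commute)

lemma root_le_powr:
  assumes "0 < x" "0 < j" "y \<le> x powr (real j * a)"
  shows "root j y \<le> x powr a"
proof -
  have "root j y \<le> root j ((x powr a) ^ j)" using assms by (intro real_root_le_mono) (auto simp: power_powr_eq)
  then show ?thesis using assms by (simp add: real_root_power_cancel)
qed

text \<open>The bounds \<open>pv\<close> force q and s below n^(-5/9), and then every hypothesis of
  \<open>upper_bound\<close> reduces to one of the inequalities \<open>num\<close>, which involve
  \<open>n\<close> alone and hold eventually.\<close>

lemma upper_moderate:
  fixes p L :: real and n m :: nat
  defines "q \<equiv> root 3 (real m * p ^ 3)" and "s \<equiv> root 6 (real m * p ^ 4)"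
    and "pm \<equiv> 1 - exp (- real m * p\<^sup>2 * (1 - p) ^ (n - 2))"
  assumes p: "0 \<le> p" "p \<le> 1" and n: "1 \<le> n"
    and pv: "p \<le> real n powr (- 5 / 3)" "real m * p\<^sup>2 * p \<le> real n powr (- 5 / 3)"
    and num: "(real n * real n powr (- 5 / 3))\<^sup>2 \<le> 1 / 8" "64 * real n ^ 6 * (real n powr (- 5 / 3)) ^ 5 \<le> 1"
      "real n * (real n powr (- 5 / 9))\<^sup>2 \<le> 1 / 5" "sqrt (real n) * real n powr (- 5 / 9) \<le> 1"
      "50 * real n powr (- 5 / 9) \<le> 1" "real n ^ 2 * (real n powr (- 5 / 9)) ^ 4 \<le> 1"
    and F: "mono F" "\<And>S. 0 \<le> F S" "\<And>S. F S \<le> 1"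
  shows "(obj {..<n} p ^^ m) F {} \<le> expec (all_edges n) (\<lambda>_. clamp01 (pm + 30 * q)) F + crowded_err n + real m * (real n * p) ^ 4"
    and "(obj {..<n} p ^^ m) F {} \<le> expec (all_edges n) (\<lambda>_. clamp01 (pm + 30 * q + 157 * s)) F + 2 * crowded_err n + real m * (real n * p) ^ 5"
proof -
  define v where "v = real n powr (- 5 / 3)"
  define y where "y = real n powr (- 5 / 9)"
  define k where "k = nat \<lfloor>sqrt (real n)\<rfloor>"
  have npos: "0 < real n" using n by simp
  have q0: "0 \<le> q" and s0: "0 \<le> s" using p by (auto simp: q_def s_def real_root_ge_zero)
  have y0: "0 \<le> y" and v0: "0 \<le> v" by (auto simp: y_def v_def)
  have Lp: "real m * p ^ 3 \<le> v" using pv(2) by (simp add: v_def power_numeral_reduce mult_ac)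
  have qy: "q \<le> y" unfolding q_def y_def
    using Lp npos by (intro root_le_powr) (auto simp: v_def)
  have "real m * p ^ 4 = (real m * p ^ 3) * p" by (simp add: power_numeral_reduce)
  also have "\<dots> \<le> v * v" using Lp pv(1) p v0 by (intro mult_mono) (auto simp: v_def)
  also have "\<dots> = real n powr (real 6 * (- 5 / 9))" by (simp add: v_def powr_add[symmetric])
  finally have sy: "s \<le> y" unfolding s_def y_def using npos by (intro root_le_powr) auto
  have pm0: "0 \<le> pm" using p by (simp add: pm_def mult_nonneg_nonneg)
  have Q: "(real n * p)\<^sup>2 \<le> 1 / 8"
  proof -
    have "(real n * p)\<^sup>2 \<le> (real n * v)\<^sup>2" using p pv by (intro power_mono mult_left_mono) (auto simp: v_def)
    also have "\<dots> \<le> 1 / 8" using num(1) by (simp add: v_def)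
    finally show ?thesis .
  qed
  have slack: "4 * (real n * p)\<^sup>2 * (real m * p\<^sup>2) \<le> q"
  proof -
    \<comment> \<open>Cubes are compared, as q^3 = m p^3. Once m p^3 is split off, the rest is at
      most 64 n^6 (n^(-5/3))^5 = 64 n^(-7/3).\<close>
    have "(4 * (real n * p)\<^sup>2 * (real m * p\<^sup>2)) ^ 3 = (real m * p ^ 3) * (64 * real n ^ 6 * ((real m * p ^ 3)\<^sup>2 * p ^ 3))"
      by (simp add: power_numeral_reduce mult_ac)
    also have "\<dots> \<le> (real m * p ^ 3) * (64 * real n ^ 6 * (v\<^sup>2 * v ^ 3))"
      using Lp pv(1) p v0 by (intro mult_left_mono mult_mono power_mono) (auto simp: v_def)
    also have "64 * real n ^ 6 * (v\<^sup>2 * v ^ 3) \<le> 1" using num(2) by (simp add: v_def power_numeral_reduce mult_ac)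
    then have "(real m * p ^ 3) * (64 * real n ^ 6 * (v\<^sup>2 * v ^ 3)) \<le> (real m * p ^ 3) * 1"
      using p by (intro mult_left_mono) auto
    finally have "root 3 ((4 * (real n * p)\<^sup>2 * (real m * p\<^sup>2)) ^ 3) \<le> q"
      unfolding q_def by (intro real_root_le_mono) auto
    then show ?thesis using p by (simp add: real_root_power_cancel)
  qed
  have ny2: "real n * q\<^sup>2 \<le> 1 / 5" "real n * s\<^sup>2 \<le> 1 / 5"
  proof -
    have "real n * q\<^sup>2 \<le> real n * y\<^sup>2" "real n * s\<^sup>2 \<le> real n * y\<^sup>2"
      using qy sy q0 s0 by (auto intro!: mult_left_mono power_mono)
    then show "real n * q\<^sup>2 \<le> 1 / 5" "real n * s\<^sup>2 \<le> 1 / 5" using num(3) by (auto simp: y_def)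
  qed
  have "real k \<le> sqrt (real n)" by (simp add: k_def)
  then have "real k * q \<le> sqrt (real n) * y" using qy q0 by (intro mult_mono) auto
  then have kq: "real k * q \<le> 1" using num(4) by (simp add: y_def)
  have y50: "50 * y \<le> 1" using num(5) by (simp add: y_def)
  have q18: "18 * q \<le> 1" and s50: "50 * s \<le> 1" using y50 qy sy y0 by linarith+
  have zy: "18 * q \<le> 50 * real n powr (- 5 / 9)" "50 * s \<le> 50 * real n powr (- 5 / 9)"
    using qy sy y0 unfolding y_def by linarith+
  have "real (n * n) * s ^ 4 \<le> real (n * n) * y ^ 4" using sy s0 by (intro mult_left_mono power_mono) auto
  then have s4: "real (n * n) * s ^ 4 \<le> 1" using num(6) by (simp add: y_def power2_eq_square)
  have B3: "expec (all_edges n) (\<lambda>_. 18 * q) (\<lambda>X. of_bool (crowded n k X)) \<le> crowded_err n"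
    unfolding k_def by (rule prob_crowded_le_err) (use q0 q18 zy n in auto)
  have B4: "expec (all_edges n) (\<lambda>_. 50 * s) (\<lambda>X. of_bool (crowded n k X)) \<le> crowded_err n"
    unfolding k_def by (rule prob_crowded_le_err) (use s0 s50 zy n in auto)
  have ny2': "real n * q\<^sup>2 \<le> 1 / 2" using ny2 by simp
  note ub = upper_bound[where k = k, OF p n Q slack[unfolded q_def] ny2'[unfolded q_def] kq[unfolded q_def] q18[unfolded q_def] F,
      folded q_def s_def pm_def]
  have z1: "min 1 (pm + 19 * q) \<le> clamp01 (pm + 30 * q)" "clamp01 (pm + 30 * q) \<le> 1"
    using pm0 q0 by (auto simp: clamp01_def)
  have z2: "min 1 (pm + 19 * q + 50 * s) \<le> clamp01 (pm + 30 * q + 157 * s)" "clamp01 (pm + 30 * q + 157 * s) \<le> 1"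
    using pm0 q0 s0 by (auto simp: clamp01_def)
  show "(obj {..<n} p ^^ m) F {} \<le> expec (all_edges n) (\<lambda>_. clamp01 (pm + 30 * q)) F + crowded_err n + real m * (real n * p) ^ 4"
    using ub(1)[OF z1] B3 by linarith
  show "(obj {..<n} p ^^ m) F {} \<le> expec (all_edges n) (\<lambda>_. clamp01 (pm + 30 * q + 157 * s)) F + 2 * crowded_err n + real m * (real n * p) ^ 5"
    using ub(2)[OF z2 s50 s4 ny2(2)] B3 B4 by linarith
qed

text \<open>Write alpha = 10/3 + 4 \<open>\<delta>\<close>. In p^2 <= 2 C ln n / n^alpha one half of
  the surplus absorbs the logarithm and the rounding of \<open>m\<close>, the other half leaves p <=
  n^(-5/3) n^(-\<open>\<delta>\<close>). The factor n^(-\<open>\<delta>\<close>) cancels the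
  logarithm in m p^3 and survives in m (n p)^5, because n^5 (n^(-5/3))^3 = 1.\<close>

lemma moderate_range:
  fixes \<alpha> C :: real
  assumes "10 / 3 < \<alpha>" "0 < C"
  defines "\<delta> \<equiv> (\<alpha> - 10 / 3) / 4"
  shows "\<forall>\<^sub>F n in sequentially. \<forall>p m. 0 \<le> p \<longrightarrow> m = nat \<lfloor>real n powr \<alpha>\<rfloor> \<longrightarrow> real m * p\<^sup>2 \<le> C * ln (real n) \<longrightarrow>
    p \<le> real n powr (- 5 / 3) \<and> real m * p\<^sup>2 * p \<le> real n powr (- 5 / 3) \<and> real m * (real n * p) ^ 5 \<le> real n powr (- \<delta>)"
proof -
  have \<delta>: "0 < \<delta>" "\<alpha> = 10 / 3 + 4 * \<delta>" using assms(1) by (auto simp: \<delta>_def field_simps)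
  have "\<forall>\<^sub>F n in sequentially. 2 * C * ln (real n) \<le> real n powr (2 * \<delta>)" using \<delta>(1) by real_asymp
  moreover have "\<forall>\<^sub>F n in sequentially. C * ln (real n) \<le> real n powr \<delta>" using \<delta>(1) by real_asymp
  moreover have "\<forall>\<^sub>F n in sequentially. 2 \<le> real n powr \<alpha>" using assms(1) by real_asymp
  ultimately show ?thesis using eventually_ge_at_top[of 2]
  proof eventually_elim
    case (elim n)
    show ?case
    proof (intro allI impI)
      fix p :: real and m :: nat
      assume p: "0 \<le> p" and m: "m = nat \<lfloor>real n powr \<alpha>\<rfloor>" and L: "real m * p\<^sup>2 \<le> C * ln (real n)"
      have npos: "0 < real n" using elim by simp
      define v where "v = real n powr (- 5 / 3)"
      define w where "w = real n powr (- \<delta>)"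
      have w: "0 < w" "w \<le> 1" unfolding w_def using elim \<delta> by (auto intro!: powr_le1 simp: powr_minus_divide ge_one_powr_ge_zero)
      have v: "0 < v" unfolding v_def using npos by simp
      have "real n powr \<alpha> / 2 \<le> real m" unfolding m using elim(3) by linarith
      then have "real n powr \<alpha> / 2 * p\<^sup>2 \<le> real m * p\<^sup>2" by (intro mult_right_mono) auto
      then have "real n powr \<alpha> * p\<^sup>2 \<le> 2 * C * ln (real n)" using L by simp
      then have "real n powr \<alpha> * p\<^sup>2 \<le> real n powr (2 * \<delta>)" using elim(1) by linarith
      then have "p\<^sup>2 \<le> real n powr (2 * \<delta>) / real n powr \<alpha>" using npos by (simp add: le_divide_eq mult.commute)
      also have "\<dots> = real n powr (2 * (- 5 / 3 - \<delta>))" 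
      proof -
        have "2 * \<delta> - \<alpha> = 2 * (- 5 / 3 - \<delta>)" using \<delta>(2) by simp
        then show ?thesis by (simp only: powr_diff[symmetric])
      qed
      also have "\<dots> = (v * w)\<^sup>2" unfolding v_def w_def powr_add[symmetric] using npos by (simp add: power_powr_eq)
      finally have "p \<le> v * w" by (rule power2_le_imp_le) (use v w in simp)
      note pvw = this
      have Lw: "real m * p\<^sup>2 \<le> 1 / w" using L elim(2) npos by (simp add: w_def powr_minus_divide)
      have 1: "p \<le> v" using pvw mult_left_le[of w v] w v by linarith
      have "real m * p\<^sup>2 * p \<le> 1 / w * (v * w)" using Lw pvw p w v by (intro mult_mono) auto
      then have 2: "real m * p\<^sup>2 * p \<le> v" using w by simp
      have n5: "real n ^ 5 * v ^ 3 = 1"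
      proof -
        have a: "real n ^ 5 = real n powr 5" using npos by (simp add: powr_realpow)
        have b: "v ^ 3 = real n powr (- 5)" unfolding v_def using npos by (simp add: power_powr_eq)
        show ?thesis unfolding a b powr_add[symmetric] using npos by simp
      qed
      have "real m * (real n * p) ^ 5 = real n ^ 5 * ((real m * p\<^sup>2 * p) * (p * p))" by (simp add: power_numeral_reduce mult_ac)
      also have "\<dots> \<le> real n ^ 5 * (v * (v * (v * w)))"
        using 1 2 pvw p v w by (intro mult_left_mono mult_mono) auto
      also have "\<dots> = (real n ^ 5 * v ^ 3) * w" by (simp add: power_numeral_reduce)
      also have "\<dots> = w" unfolding n5 by simp
      finally show "p \<le> real n powr (- 5 / 3) \<and> real m * p\<^sup>2 * p \<le> real n powr (- 5 / 3) \<and> real m * (real n * p) ^ 5 \<le> real n powr (- \<delta>)"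
        using 1 2 by (simp add: v_def w_def)
    qed
  qed
qed

section \<open>Restriction to graphs, complements, and the dense case\<close>

lemma rig_graph_subset: "rig_graph n W \<subseteq> all_edges n"
  by (auto simp: rig_graph_def all_edges_def)

lemma prob_RIG_cong:
  assumes "\<And>S. S \<subseteq> all_edges n \<Longrightarrow> S \<in> A \<longleftrightarrow> S \<in> B"
  shows "prob_RIG n m p A = prob_RIG n m p B"
  unfolding prob_RIG_def using assms[OF rig_graph_subset] by simp

lemma prob_Gnp_cong:
  assumes "\<And>S. S \<subseteq> all_edges n \<Longrightarrow> S \<in> A \<longleftrightarrow> S \<in> B"
  shows "prob_Gnp n p A = prob_Gnp n p B"
  unfolding prob_Gnp_eq using assms by (intro expec_cong) auto

lemma prob_Gnp_compl: "prob_Gnp n p (- A) = 1 - prob_Gnp n p A"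
proof -
  have "prob_Gnp n p (- A) = expec (all_edges n) (\<lambda>_. clamp01 p) (\<lambda>S. 1 + (- 1) * of_bool (S \<in> A))"
    unfolding prob_Gnp_eq by (intro expec_cong) auto
  also have "\<dots> = 1 - prob_Gnp n p A"
    unfolding expec_add expec_cmult prob_Gnp_eq by (simp add: expec_const finite_all_edges)
  finally show ?thesis .
qed

lemma prob_RIG_compl: "prob_RIG n m p (- A) = 1 - prob_RIG n m p A"
proof -
  have "(obj {..<n} p ^^ m) (\<lambda>S. 1 + (- 1) * F S) S = 1 + (- 1) * (obj {..<n} p ^^ m) F S" for F :: "nat set set \<Rightarrow> real" and S
    by (induction m arbitrary: S) (simp_all only: funpow.simps o_apply id_apply obj_def expec_add expec_cmult expec_const finite_lessThan)
  moreover have "(\<lambda>S. of_bool (S \<in> - A)) = (\<lambda>S. 1 + (- 1) * of_bool (S \<in> A) :: real)" by (auto simp: fun_eq_iff)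
  ultimately show ?thesis unfolding prob_RIG_eq by simp
qed

text \<open>The 8 is halved by (1 - p)^(n - 2) >= 1/2, so 1 - z <= n^(-4), and the factor n^2 in
  \<open>complete_bound\<close> leaves n^(-2).\<close>

lemma upper_dense:
  fixes p z :: real
  assumes p: "0 \<le> p" "p \<le> 1" and n: "1 \<le> n" and np: "real n * p \<le> 1 / 2"
    and L: "8 * ln (real n) < real m * p\<^sup>2"
    and z: "1 - exp (- real m * p\<^sup>2 * (1 - p) ^ (n - 2)) \<le> z" "z \<le> 1"
    and F: "mono F" "\<And>S. 0 \<le> F S" "\<And>S. F S \<le> 1"
  shows "(obj {..<n} p ^^ m) F {} \<le> expec (all_edges n) (\<lambda>_. z) F + 1 / real n ^ 2"
proof -
  have npos: "0 < real n" "0 \<le> ln (real n)" using n by auto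
  have "1 / 2 \<le> (1 - p) ^ (n - 2)" using one_minus_power_ge[of p "n - 2" n] p np by simp
  then have "8 * ln (real n) * (1 / 2) \<le> real m * p\<^sup>2 * (1 - p) ^ (n - 2)" 
    by (rule mult_mono[OF less_imp_le[OF L]]) (use p npos in auto)
  then have "exp (- real m * p\<^sup>2 * (1 - p) ^ (n - 2)) \<le> exp (- (real 4 * ln (real n)))" by simp
  also have "\<dots> = 1 / real n ^ 4" using npos(1) by (simp only: exp_minus exp_of_nat_mult exp_ln inverse_eq_divide)
  finally have z4: "1 - z \<le> 1 / real n ^ 4" using z by linarith
  have "1 - exp (- real m * p\<^sup>2 * (1 - p) ^ (n - 2)) \<ge> 0" using p by (simp add: mult_nonneg_nonneg)
  then have z0: "0 \<le> z" using z by linarith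
  have "(obj {..<n} p ^^ m) F {} \<le> expec (all_edges n) (\<lambda>_. z) F + real n ^ 2 * (1 - z)"
    by (rule complete_bound[OF F p z0 z(2)])
  also have "real n ^ 2 * (1 - z) \<le> real n ^ 2 * (1 / real n ^ 4)" using z4 by (intro mult_left_mono) auto
  also have "\<dots> = 1 / real n ^ 2" using npos by (simp add: power_numeral_reduce)
  finally show ?thesis by simp
qed

section \<open>The limit for increasing properties\<close>

lemma increasing_limit:
  fixes A :: "nat \<Rightarrow> nat set set set"
    and a \<alpha> :: real and m :: "nat \<Rightarrow> nat" and p pminus pplus :: "nat \<Rightarrow> real"
  assumes up: "\<And>n G H. G \<in> A n \<Longrightarrow> G \<subseteq> H \<Longrightarrow> H \<in> A n"
    and alpha: "\<alpha> > 10 / 3"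
    and m_def: "\<And>n. m n = nat \<lfloor>real n powr \<alpha>\<rfloor>"
    and p_range: "\<And>n. 0 \<le> p n \<and> p n \<le> 1"
    and pminus_def: "\<And>n. pminus n = 1 - exp (- real (m n) * p n ^ 2 * (1 - p n) ^ (n - 2))"
    and regimes:
      "(p \<in> o(\<lambda>n. 1 / (real n * real (m n) powr (1/4))) \<and>
        (\<forall>n. pplus n = pminus n + 30 * root 3 (real (m n) * p n ^ 3)))
       \<or>
       (p \<in> O(\<lambda>n. real (m n) powr (-1/2) * sqrt (ln (real n))) \<and>
        (\<forall>n. pplus n = pminus n + 30 * root 3 (real (m n) * p n ^ 3) + 157 * root 6 (real (m n) * p n ^ 4)))"
    and lim_minus: "(\<lambda>n. prob_Gnp n (pminus n) (A n)) \<longlonglongrightarrow> a"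
    and lim_plus: "(\<lambda>n. prob_Gnp n (pplus n) (A n)) \<longlonglongrightarrow> a"
  shows "(\<lambda>n. prob_RIG n (m n) (p n) (A n)) \<longlonglongrightarrow> a"
proof -
  define F where "F n = (\<lambda>S. of_bool (S \<in> A n) :: real)" for n
  define R where "R n = prob_RIG n (m n) (p n) (A n)" for n
  have F: "mono (F n)" "0 \<le> F n S" "F n S \<le> 1" for n S
    using up by (auto simp: F_def mono_def)
  have R: "R n = (obj {..<n} (p n) ^^ m n) (F n) {}" for n unfolding R_def F_def prob_RIG_eq ..
  have G: "prob_Gnp n x (A n) = expec (all_edges n) (\<lambda>_. clamp01 x) (F n)" for n x
    unfolding F_def prob_Gnp_eq ..
  have pm01: "0 \<le> pminus n" "pminus n \<le> 1" for n
    using p_range[of n] by (auto simp: pminus_def mult_nonneg_nonneg)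
  have m1: "\<forall>\<^sub>F n in sequentially. 1 \<le> m n"
  proof -
    have "\<forall>\<^sub>F n in sequentially. 1 \<le> real n powr \<alpha>" using alpha by real_asymp
    then show ?thesis by eventually_elim (simp add: m_def le_nat_iff)
  qed
  define \<delta> where "\<delta> = (\<alpha> - 10 / 3) / 4"
  have \<delta>: "0 < \<delta>" using alpha by (simp add: \<delta>_def)
  note moderate = moderate_range[OF alpha, folded \<delta>_def]
  have num: "\<forall>\<^sub>F n in sequentially. (real n * real n powr (- 5 / 3))\<^sup>2 \<le> 1 / 8"
    "\<forall>\<^sub>F n in sequentially. 64 * real n ^ 6 * (real n powr (- 5 / 3)) ^ 5 \<le> 1"
    "\<forall>\<^sub>F n in sequentially. real n * (real n powr (- 5 / 9))\<^sup>2 \<le> 1 / 5"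
    "\<forall>\<^sub>F n in sequentially. sqrt (real n) * real n powr (- 5 / 9) \<le> 1"
    "\<forall>\<^sub>F n in sequentially. 50 * real n powr (- 5 / 9) \<le> 1"
    "\<forall>\<^sub>F n in sequentially. real n ^ 2 * (real n powr (- 5 / 9)) ^ 4 \<le> 1"
    by real_asymp+
  \<comment> \<open>Both regimes are reduced to the same data: an upper bound with a vanishing
    error, and n p -> 0, which drives the lower bound.\<close>
  obtain e where e: "e \<longlonglongrightarrow> 0" and np: "(\<lambda>n. real n * p n) \<longlonglongrightarrow> 0"
    and upper: "\<forall>\<^sub>F n in sequentially. R n \<le> prob_Gnp n (pplus n) (A n) + e n"
    using regimes
  proof (elim disjE conjE)
    assume po: "p \<in> o(\<lambda>n. 1 / (real n * real (m n) powr (1/4)))"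
      and pp: "\<forall>n. pplus n = pminus n + 30 * root 3 (real (m n) * p n ^ 3)"
    \<comment> \<open>This is n p m^(1/4); for m >= 1 it bounds n p, and its fourth power equals the
      error m (n p)^4.\<close>
    define t where "t n = p n / (1 / (real n * real (m n) powr (1/4)))" for n
    have t0: "t \<longlonglongrightarrow> 0" unfolding t_def by (rule smalloD_tendsto[OF po])
    have npt: "\<forall>\<^sub>F n in sequentially. real n * p n \<le> t n"
      using m1
    proof eventually_elim
      case (elim n)
      have "1 \<le> real (m n) powr (1/4)" using elim by (intro ge_one_powr_ge_zero) auto
      then have "real n * p n * 1 \<le> real n * p n * real (m n) powr (1/4)"
        using p_range[of n] by (intro mult_left_mono) auto
      then show ?case by (simp add: t_def mult_ac)
    qed
    have np: "(\<lambda>n. real n * p n) \<longlonglongrightarrow> 0"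
      by (rule tendsto_sandwich[OF _ npt tendsto_const t0]) (use p_range in auto)
    have t4: "\<forall>\<^sub>F n in sequentially. real (m n) * (real n * p n) ^ 4 \<le> t n ^ 4"
      using m1
    proof eventually_elim
      case (elim n)
      have "(real (m n) powr (1/4)) ^ 4 = real (m n)" using elim by (simp add: powr_power)
      then show ?case by (simp add: t_def power_mult_distrib mult_ac)
    qed
    have e: "(\<lambda>n. crowded_err n + t n ^ 4 + 1 / real n ^ 2) \<longlonglongrightarrow> 0"
    proof -
      have "(\<lambda>n. 1 / real n ^ 2) \<longlonglongrightarrow> 0" by real_asymp
      then have "(\<lambda>n. crowded_err n + t n ^ 4 + 1 / real n ^ 2) \<longlonglongrightarrow> 0 + 0 ^ 4 + 0"
        by (intro tendsto_add tendsto_power crowded_err_tendsto t0)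
      then show ?thesis by simp
    qed
    have "\<forall>\<^sub>F n in sequentially. real n * p n < 1 / 2" using np by (rule order_tendstoD) simp
    then have "\<forall>\<^sub>F n in sequentially. R n \<le> prob_Gnp n (pplus n) (A n) + (crowded_err n + t n ^ 4 + 1 / real n ^ 2)"
      using num moderate[of 8, simplified] t4 eventually_ge_at_top[of 1]
    proof eventually_elim
      case (elim n)
      note pr = conjunct1[OF p_range[of n]] conjunct2[OF p_range[of n]]
      have c0: "0 \<le> crowded_err n" unfolding crowded_err_def by simp
      have t0: "0 \<le> t n ^ 4" by simp
      have q0: "0 \<le> root 3 (real (m n) * p n ^ 3)" using pr by (simp add: real_root_ge_zero)
      show ?case
      \<comment> \<open>Since p = o(n^(-1) m^(-1/4)) need not bound m p^2 by a multiple of ln n,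
        \<open>moderate_range\<close> covers only the first case; in the other one the graph with
        parameter \<open>pminus\<close> is already almost surely complete in the limit.\<close>
      proof (cases "real (m n) * (p n)\<^sup>2 \<le> 8 * ln (real n)")
        case True
        have b: "p n \<le> real n powr (- 5 / 3)" "real (m n) * (p n)\<^sup>2 * p n \<le> real n powr (- 5 / 3)"
          using elim(8) pr m_def[of n] True by auto
        have "R n \<le> prob_Gnp n (pplus n) (A n) + crowded_err n + real (m n) * (real n * p n) ^ 4"
          unfolding R G pp[rule_format] pminus_def
          by (rule upper_moderate(1)[OF pr elim(10) b elim(2-7) F])
        moreover have "0 \<le> 1 / real n ^ 2" by simp
        ultimately show ?thesis using elim(9) by linarith
      next
        case False
        have "R n \<le> prob_Gnp n (pplus n) (A n) + 1 / real n ^ 2"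
          unfolding R G
        proof (rule upper_dense[OF pr elim(10) _ _ _ _ F])
          show "1 - exp (- real (m n) * (p n)\<^sup>2 * (1 - p n) ^ (n - 2)) \<le> clamp01 (pplus n)" "clamp01 (pplus n) \<le> 1"
            using q0 pm01[of n] unfolding pp[rule_format] pminus_def[symmetric] by (auto simp: clamp01_def)
        qed (use elim(1) False in auto)
        then show ?thesis using c0 t0 by linarith
      qed
    qed
    with e np show thesis by (intro that) 
  next
    assume pO: "p \<in> O(\<lambda>n. real (m n) powr (-1/2) * sqrt (ln (real n)))"
      and pp: "\<forall>n. pplus n = pminus n + 30 * root 3 (real (m n) * p n ^ 3) + 157 * root 6 (real (m n) * p n ^ 4)"
    obtain c where c: "0 < c" and pc: "\<forall>\<^sub>F n in sequentially. norm (p n) \<le> c * norm (real (m n) powr (-1/2) * sqrt (ln (real n)))"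
      using pO by (elim landau_o.bigE)
    have L: "\<forall>\<^sub>F n in sequentially. real (m n) * (p n)\<^sup>2 \<le> c\<^sup>2 * ln (real n)"
      using pc m1 eventually_ge_at_top[of 1]
    proof eventually_elim
      case (elim n)
      have l: "0 \<le> ln (real n)" using elim by simp
      have "(p n)\<^sup>2 \<le> (c * (real (m n) powr (-1/2) * sqrt (ln (real n))))\<^sup>2"
        using elim(1) p_range[of n] l by (intro power_mono) auto
      also have "\<dots> = c\<^sup>2 * ((real (m n) powr (-1/2))\<^sup>2 * ln (real n))" using l by (simp add: power_mult_distrib)
      also have "(real (m n) powr (-1/2))\<^sup>2 = 1 / real (m n)"
      proof -
        have "0 < real (m n)" using elim(2) by simp
        from power_powr_eq[OF this, of "-1/2" 2] this show ?thesis by (simp only:) (simp add: powr_minus_divide)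
      qed
      finally have "real (m n) * (p n)\<^sup>2 \<le> real (m n) * (c\<^sup>2 * (1 / real (m n) * ln (real n)))" by (intro mult_left_mono) auto
      then show ?case using elim(2) by simp
    qed
    have b: "\<forall>\<^sub>F n in sequentially. p n \<le> real n powr (- 5 / 3) \<and> real (m n) * (p n)\<^sup>2 * p n \<le> real n powr (- 5 / 3)
        \<and> real (m n) * (real n * p n) ^ 5 \<le> real n powr (- \<delta>)"
      using L moderate[OF zero_less_power[OF c]] by eventually_elim (use p_range m_def in auto)
    have "\<forall>\<^sub>F n in sequentially. real n * p n \<le> real n * real n powr (- 5 / 3)"
      using b by eventually_elim (auto intro: mult_left_mono)
    moreover have "(\<lambda>n. real n * real n powr (- 5 / 3)) \<longlonglongrightarrow> 0" by real_asymp
    ultimately have np: "(\<lambda>n. real n * p n) \<longlonglongrightarrow> 0"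
      by (rule tendsto_sandwich[OF _ _ tendsto_const, rotated]) (use p_range in auto)
    have e: "(\<lambda>n. 2 * crowded_err n + real n powr (- \<delta>)) \<longlonglongrightarrow> 0"
    proof -
      have "(\<lambda>n. real n powr (- \<delta>)) \<longlonglongrightarrow> 0" using \<delta> by real_asymp
      then have "(\<lambda>n. 2 * crowded_err n + real n powr (- \<delta>)) \<longlonglongrightarrow> 2 * 0 + 0"
        by (intro tendsto_intros crowded_err_tendsto)
      then show ?thesis by simp
    qed
    have "\<forall>\<^sub>F n in sequentially. R n \<le> prob_Gnp n (pplus n) (A n) + (2 * crowded_err n + real n powr (- \<delta>))"
      using b num eventually_ge_at_top[of 1]
    proof eventually_elim
      case (elim n)
      note pr = conjunct1[OF p_range[of n]] conjunct2[OF p_range[of n]]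
      have b: "p n \<le> real n powr (- 5 / 3)" "real (m n) * (p n)\<^sup>2 * p n \<le> real n powr (- 5 / 3)"
        using elim(1) by auto
      have "R n \<le> prob_Gnp n (pplus n) (A n) + 2 * crowded_err n + real (m n) * (real n * p n) ^ 5"
        unfolding R G pp[rule_format] pminus_def
        by (rule upper_moderate(2)[OF pr elim(8) b elim(2-7) F])
      then show ?case using elim(1) by linarith
    qed
    with e np show thesis by (intro that)
  qed
  have "\<forall>\<^sub>F n in sequentially. real n * p n < 1 / 2" using np by (rule order_tendstoD) simp
  then have lower: "\<forall>\<^sub>F n in sequentially. prob_Gnp n (pminus n) (A n) - 36 * (real n * p n) \<le> R n"
    using eventually_ge_at_top[of 3]
  proof eventually_elim
    case (elim n)
    note pr = conjunct1[OF p_range[of n]] conjunct2[OF p_range[of n]]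
    have "clamp01 (pminus n) = pminus n" using pm01[of n] by (simp add: clamp01_def)
    then have "prob_Gnp n (pminus n) (A n) \<le> R n + 36 * (real n * p n)"
      unfolding R G using lower_bound[OF pr elim(2) _ F, of "m n"] elim(1) by (simp add: pminus_def)
    then show ?case by simp
  qed
  have "(\<lambda>n. prob_Gnp n (pminus n) (A n) - 36 * (real n * p n)) \<longlonglongrightarrow> a - 36 * 0"
    by (intro tendsto_diff tendsto_mult lim_minus np tendsto_const)
  then have l: "(\<lambda>n. prob_Gnp n (pminus n) (A n) - 36 * (real n * p n)) \<longlonglongrightarrow> a" by simp
  have "(\<lambda>n. prob_Gnp n (pplus n) (A n) + e n) \<longlonglongrightarrow> a + 0" by (intro tendsto_add lim_plus e)
  then have u: "(\<lambda>n. prob_Gnp n (pplus n) (A n) + e n) \<longlonglongrightarrow> a" by simp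
  have "R \<longlonglongrightarrow> a" by (rule tendsto_sandwich[OF lower upper l u])
  then show ?thesis unfolding R_def .
qed

theorem theorem4:
  fixes A :: "nat \<Rightarrow> nat set set set"
    and a \<alpha> :: real
    and m :: "nat \<Rightarrow> nat"
    and p pminus pplus :: "nat \<Rightarrow> real"
  defines "c3 \<equiv> (30::real)" and "c4 \<equiv> (157::real)"
  assumes a_range: "0 \<le> a" "a \<le> 1"
    and mono: "monotone_property A"
    and alpha: "\<alpha> > 10 / 3"
    and m_def: "\<forall>n. m n = nat \<lfloor>real n powr \<alpha>\<rfloor>"
    and p_range: "\<forall>n. 0 \<le> p n \<and> p n \<le> 1"
    and pminus_def: "\<forall>n. pminus n = 1 - exp (- real (m n) * p n ^ 2 * (1 - p n) ^ (n - 2))"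
    and regimes:
      "(p \<in> \<Omega>(\<lambda>n. 1 / (real n * real (m n) powr (1/3))) \<and>
        p \<in> o(\<lambda>n. 1 / (real n * real (m n) powr (1/4))) \<and>
        (\<forall>n. pplus n = 1 - exp (- real (m n) * p n ^ 2 * (1 - p n) ^ (n - 2))
                        + c3 * root 3 (real (m n) * p n ^ 3)))
       \<or>
       (p \<in> \<Omega>(\<lambda>n. 1 / (real n * real (m n) powr (1/4))) \<and>
        p \<in> O(\<lambda>n. real (m n) powr (-1/2) * sqrt (ln (real n))) \<and>
        (\<forall>n. pplus n = 1 - exp (- real (m n) * p n ^ 2 * (1 - p n) ^ (n - 2))
                        + c3 * root 3 (real (m n) * p n ^ 3)
                        + c4 * root 6 (real (m n) * p n ^ 4)))"
    and lim_minus: "(\<lambda>n. prob_Gnp n (pminus n) (A n)) \<longlonglongrightarrow> a"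
    and lim_plus: "(\<lambda>n. prob_Gnp n (pplus n) (A n)) \<longlonglongrightarrow> a"
  shows "(\<lambda>n. prob_RIG n (m n) (p n) (A n)) \<longlonglongrightarrow> a"
proof -
  have reg: "(p \<in> o(\<lambda>n. 1 / (real n * real (m n) powr (1/4))) \<and>
        (\<forall>n. pplus n = pminus n + 30 * root 3 (real (m n) * p n ^ 3)))
       \<or>
       (p \<in> O(\<lambda>n. real (m n) powr (-1/2) * sqrt (ln (real n))) \<and>
        (\<forall>n. pplus n = pminus n + 30 * root 3 (real (m n) * p n ^ 3) + 157 * root 6 (real (m n) * p n ^ 4)))"
    using regimes pminus_def by (simp add: c3_def c4_def) blast
  note limit = increasing_limit[OF _ alpha m_def[rule_format] p_range[rule_format] pminus_def[rule_format] reg]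
  from mono have gp: "\<And>n. A n \<subseteq> Pow (all_edges n)" and
    "(\<forall>n G H. G \<in> A n \<longrightarrow> G \<subseteq> H \<longrightarrow> H \<subseteq> all_edges n \<longrightarrow> H \<in> A n) \<or>
     (\<forall>n G H. G \<in> A n \<longrightarrow> H \<subseteq> G \<longrightarrow> H \<in> A n)"
    by (auto simp: monotone_property_def graph_property_def)
  from this(2) show ?thesis
  proof
    assume up: "\<forall>n G H. G \<in> A n \<longrightarrow> G \<subseteq> H \<longrightarrow> H \<subseteq> all_edges n \<longrightarrow> H \<in> A n"
    \<comment> \<open>\<open>increasing_limit\<close> wants closure upwards among all sets, whereas
      \<open>A n\<close> is closed only among the graphs on \<open>n\<close> vertices. The upward
      closure agrees with \<open>A n\<close> on those graphs.\<close>
    define B where "B n = {H. \<exists>G\<in>A n. G \<subseteq> H}" for n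
    have AB: "S \<in> A n \<longleftrightarrow> S \<in> B n" if "S \<subseteq> all_edges n" for S n
      using up that by (auto simp: B_def)
    have G: "prob_Gnp n x (A n) = prob_Gnp n x (B n)" for n x by (intro prob_Gnp_cong AB)
    have R: "prob_RIG n k x (A n) = prob_RIG n k x (B n)" for n k x by (intro prob_RIG_cong AB)
    have "(\<lambda>n. prob_RIG n (m n) (p n) (B n)) \<longlonglongrightarrow> a"
    proof (rule limit)
      show "H \<in> B n" if "G \<in> B n" "G \<subseteq> H" for n G H using that by (auto simp: B_def)
      show "(\<lambda>n. prob_Gnp n (pminus n) (B n)) \<longlonglongrightarrow> a" using lim_minus by (simp only: G)
      show "(\<lambda>n. prob_Gnp n (pplus n) (B n)) \<longlonglongrightarrow> a" using lim_plus by (simp only: G)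
    qed
    then show ?thesis by (simp only: R)
  next
    assume down: "\<forall>n G H. G \<in> A n \<longrightarrow> H \<subseteq> G \<longrightarrow> H \<in> A n"
    have "(\<lambda>n. 1 - prob_Gnp n (pminus n) (A n)) \<longlonglongrightarrow> 1 - a" "(\<lambda>n. 1 - prob_Gnp n (pplus n) (A n)) \<longlonglongrightarrow> 1 - a"
      by (intro tendsto_intros lim_minus lim_plus)+
    \<comment> \<open>The complement is taken among all sets. It is closed upwards there as it
      stands, because \<open>down\<close> holds for arbitrary subsets.\<close>
    then have "(\<lambda>n. prob_RIG n (m n) (p n) (- A n)) \<longlonglongrightarrow> 1 - a"
      unfolding prob_Gnp_compl[symmetric] by (intro limit) (use down in auto)
    then have "(\<lambda>n. 1 - prob_RIG n (m n) (p n) (A n)) \<longlonglongrightarrow> 1 - a"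
      unfolding prob_RIG_compl .
    from tendsto_diff[OF tendsto_const this, of 1] show ?thesis
      by (simp only: diff_diff_eq2 add_diff_cancel_left')
  qed
qed

end
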